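(* For every $m\geq 4$, let $\mathfrak{r}_{(m,m-1)}^{4,1,2m-5}$ be the $(2m+3)$-dimensional complex Lie algebra whose Cartan–Maurer equations, in a basis $\omega_1,\dots,\omega_{2m+2},\theta$ of the dual space, are $$\begin{aligned} d\omega_1&=\theta\wedge\omega_1,\\ d\omega_2&=(2m-4)\,\theta\wedge\omega_2,\\ d\omega_j&=\omega_1\wedge\omega_{j-1}+(2m-6+j)\,\theta\wedge\omega_j,\quad 3\leq j\leq 2m-2,\\ d\omega_{2m-1}&=\omega_1\wedge\omega_{2m-2}+\omega_2\wedge\omega_3+(4m-7)\,\theta\wedge\omega_{2m-1},\\ d\omega_{2m}&=\omega_1\wedge\omega_{2m-1}+\omega_2\wedge\omega_4+(4m-6)\,\theta\wedge\omega_{2m},\\ d\omega_{2m+1}&=\sum_{j=2}^m(-1)^j\omega_j\wedge\omega_{2m+1-j}+(6m-11)\,\theta\wedge\omega_{2m+1},\\ d\omega_{2m+2}&=\omega_1\wedge\omega_{2m+1}+\sum_{j=2}^m(-1)^j(m+1-j)\,\omega_j\wedge\omega_{2m+2-j}+(6m-10)\,\theta\wedge\omega_{2m+2},\\ d\theta&=0. \end{aligned}$$ Then $\mathfrak{r}_{(m,m-1)}^{4,1,2m-5}$ is solvable, decomposable and rigid. Moreover, its nilradical is isomorphic to $\mathfrak{g}_{(m,m-1)}^{4,1}+\overline{\psi}_{2,2m-5}$, i.e. to the vector space $\mathfrak{g}_{(m,m-1)}^{4,1}$ with bracket $\mu+\overline{\psi}_{2,2m-5}$, where $\mu$ is the bracket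 of $\mathfrak{g}_{(m,m-1)}^{4,1}$.
   Context: All Lie algebras are finite-dimensional over $\mathbb{C}$. Convention for Cartan–Maurer equations: if $(X_i)$ is the basis dual to $(\omega_i)$ and $[X_i,X_j]=\sum_l C_{ij}^lX_l$, then $d\omega_l=\sum_{i<j}C_{ij}^l\,\omega_i\wedge\omega_j$ (the form $\theta$ being treated as one more basis element). The algebra $\mathfrak{g}_{(m,m-1)}^{4,1}$ ($m\geq 4$) is the $(2m+2)$-dimensional Lie algebra with Cartan–Maurer equations $d\omega_1=d\omega_2=0$, $d\omega_j=\omega_1\wedge\omega_{j-1}$ for $3\leq j\leq 2m$, $d\omega_{2m+1}=\sum_{j=2}^m(-1)^j\omega_j\wedge\omega_{2m+1-j}$, $d\omega_{2m+2}=\omega_1\wedge\omega_{2m+1}+\sum_{j=2}^m(-1)^j(m+1-j)\,\omega_j\wedge\omega_{2m+2-j}$. With $X_1,\dots,X_{2m+2}$ the dual basis, $\overline{\psi}_{2,2m-5}$ is the alternating bilinear map on $\mathfrak{g}_{(m,m-1)}^{4,1}$ with $\overline{\psi}_{2,2m-5}(X_2,X_3)=X_{2m-1}$, $\overline{\psi}_{2,2m-5}(X_2,X_4)=X_{2m}$, and which vanishes on all other pairs of basis vectors (up to antisymmetry). Decomposable: a solvable non-nilpotent Lie algebra $\mathfrak{g}$ is decomposable if $\mathfrak{g}=\mathfrak{n}\oplus\mathfrak{t}$ as vector spaces, where $\mathfrak{n}$ is the nilradical and $\mathfrak{t}$ is an abelian subalgebra all of whose elements are $\mathrm{ad}$-semisimple.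 Rigid: a Lie algebra law $\nu$ on $\mathbb{C}^n$ is rigid if its orbit under the change-of-basis action of $GL(n,\mathbb{C})$ is open in the algebraic variety of all Lie algebra laws on $\mathbb{C}^n$. *)

theory Defs
  imports Complex_Main "HOL-Library.Function_Algebras"
begin

section \<open>The coordinate spaces \<open>\<complex>\<^sup>n\<close>\<close>

text \<open>
  Vectors are functions \<open>nat \<Rightarrow> complex\<close>; \<open>coord_space n\<close> is \<open>\<complex>\<^sup>n\<close>, with coordinates
  numbered from 1 to \<open>n\<close>. Explicit carriers are used because the dimension depends
  on the parameter \<open>m\<close>.
\<close>

type_synonym cvec = "nat \<Rightarrow> complex"

definition cscale :: "complex \<Rightarrow> cvec \<Rightarrow> cvec" where
  "cscale c v = (\<lambda>i. c * v i)"

interpretation cvec: vector_space cscale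
  by unfold_locales (auto simp: cscale_def fun_eq_iff algebra_simps)

definition coord_space :: "nat \<Rightarrow> cvec set" where
  "coord_space n = {v. \<forall>i. i \<notin> {1..n} \<longrightarrow> v i = 0}"

definition basis_vec :: "nat \<Rightarrow> cvec" where
  "basis_vec i = (\<lambda>k. if k = i then 1 else 0)"


section \<open>Lie algebras with underlying space a subspace of \<open>nat \<Rightarrow> complex\<close>\<close>

type_synonym bracket = "cvec \<Rightarrow> cvec \<Rightarrow> cvec"

text \<open>In the following, \<open>L\<close> is the underlying space of a Lie algebra with bracket \<open>br\<close>.\<close>

definition bracket_space :: "bracket \<Rightarrow> cvec set \<Rightarrow> cvec set \<Rightarrow> cvec set" where
  "bracket_space br A B = cvec.span {br x y | x y. x \<in> A \<and> y \<in> B}"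

fun derived_series :: "cvec set \<Rightarrow> bracket \<Rightarrow> nat \<Rightarrow> cvec set" where
  "derived_series L br 0 = L"
| "derived_series L br (Suc k) =
     bracket_space br (derived_series L br k) (derived_series L br k)"

fun lower_central_series :: "cvec set \<Rightarrow> bracket \<Rightarrow> nat \<Rightarrow> cvec set" where
  "lower_central_series L br 0 = L"
| "lower_central_series L br (Suc k) = bracket_space br L (lower_central_series L br k)"

definition solvable :: "cvec set \<Rightarrow> bracket \<Rightarrow> bool" where
  "solvable L br \<longleftrightarrow> (\<exists>k. derived_series L br k = {0})"

definition nilpotent :: "cvec set \<Rightarrow> bracket \<Rightarrow> bool" where
  "nilpotent L br \<longleftrightarrow> (\<exists>k. lower_central_series L br k = {0})"

definition lie_ideal :: "cvec set \<Rightarrow> bracket \<Rightarrow> cvec set \<Rightarrow> bool" where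
  "lie_ideal L br I \<longleftrightarrow> cvec.subspace I \<and> I \<subseteq> L \<and> (\<forall>x\<in>L. \<forall>y\<in>I. br x y \<in> I)"

text \<open>The sum of all nilpotent ideals, which for finite-dimensional \<open>L\<close> is the largest one.\<close>

definition nilradical :: "cvec set \<Rightarrow> bracket \<Rightarrow> cvec set" where
  "nilradical L br = cvec.span (\<Union>{I. lie_ideal L br I \<and> nilpotent I br})"

text \<open>Over \<open>\<complex>\<close>, semisimple means diagonalizable: \<open>L\<close> has a basis of eigenvectors of \<open>ad x\<close>.\<close>

definition ad_semisimple :: "cvec set \<Rightarrow> bracket \<Rightarrow> cvec \<Rightarrow> bool" where
  "ad_semisimple L br x \<longleftrightarrow>
     (\<exists>B. cvec.independent B \<and> cvec.span B = L \<and> (\<forall>v\<in>B. \<exists>c. br x v = cscale c v))"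

text \<open>An abelian subspace is automatically closed under the bracket.\<close>

definition abelian_subalgebra :: "cvec set \<Rightarrow> bracket \<Rightarrow> cvec set \<Rightarrow> bool" where
  "abelian_subalgebra L br T \<longleftrightarrow> cvec.subspace T \<and> T \<subseteq> L \<and> (\<forall>x\<in>T. \<forall>y\<in>T. br x y = 0)"

definition decomposable :: "cvec set \<Rightarrow> bracket \<Rightarrow> bool" where
  "decomposable L br \<longleftrightarrow>
     solvable L br \<and> \<not> nilpotent L br \<and>
     (\<exists>T. abelian_subalgebra L br T \<and> (\<forall>x\<in>T. ad_semisimple L br x) \<and>
          nilradical L br \<inter> T = {0} \<and>
          {x + y | x y. x \<in> nilradical L br \<and> y \<in> T} = L)"

text \<open>
  Every linear map between subspaces extends to the whole ambient space, so requiring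
  \<open>f\<close> to be linear everywhere is no restriction.
\<close>

definition lie_isomorphic :: "cvec set \<Rightarrow> bracket \<Rightarrow> cvec set \<Rightarrow> bracket \<Rightarrow> bool" where
  "lie_isomorphic L br L' br' \<longleftrightarrow>
     (\<exists>f. Vector_Spaces.linear cscale cscale f \<and> bij_betw f L L' \<and>
          (\<forall>x\<in>L. \<forall>y\<in>L. f (br x y) = br' (f x) (f y)))"


section \<open>The variety of Lie algebra laws on \<open>\<complex>\<^sup>n\<close> and rigidity\<close>

text \<open>
  A bilinear map on \<open>\<complex>\<^sup>n\<close> is given by its structure constants: \<open>C i j l\<close> is the
  coefficient of \<open>X\<^sub>l\<close> in the image of \<open>(X\<^sub>i, X\<^sub>j)\<close>, where \<open>X\<^sub>1, \<dots>, X\<^sub>n\<close> is the standard basis.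
\<close>

type_synonym structure_constants = "nat \<Rightarrow> nat \<Rightarrow> nat \<Rightarrow> complex"

definition bilinear_of :: "nat \<Rightarrow> structure_constants \<Rightarrow> bracket" where
  "bilinear_of n C x y = (\<lambda>l. \<Sum>i=1..n. \<Sum>j=1..n. x i * y j * C i j l)"

definition lie_laws :: "nat \<Rightarrow> structure_constants set" where
  "lie_laws n = {C.
     (\<forall>i j l. C i j l \<noteq> 0 \<longrightarrow> i \<in> {1..n} \<and> j \<in> {1..n} \<and> l \<in> {1..n}) \<and>
     (let br = bilinear_of n C; V = coord_space n in
       (\<forall>x\<in>V. br x x = 0) \<and>
       (\<forall>x\<in>V. \<forall>y\<in>V. \<forall>z\<in>V. br x (br y z) + br y (br z x) + br z (br x y) = 0))}"

text \<open>Polynomial functions in the structure constants, and the Zariski topology they define.\<close>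

inductive_set polynomial_functions :: "(structure_constants \<Rightarrow> complex) set" where
  const: "(\<lambda>_. c) \<in> polynomial_functions"
| coord: "(\<lambda>C. C i j l) \<in> polynomial_functions"
| add: "\<lbrakk>p \<in> polynomial_functions; q \<in> polynomial_functions\<rbrakk>
        \<Longrightarrow> (\<lambda>C. p C + q C) \<in> polynomial_functions"
| mult: "\<lbrakk>p \<in> polynomial_functions; q \<in> polynomial_functions\<rbrakk>
        \<Longrightarrow> (\<lambda>C. p C * q C) \<in> polynomial_functions"

definition zariski_closed_in :: "structure_constants set \<Rightarrow> structure_constants set \<Rightarrow> bool" where
  "zariski_closed_in V Z \<longleftrightarrow>
     (\<exists>S \<subseteq> polynomial_functions. Z = {C \<in> V. \<forall>p\<in>S. p C = 0})"

definition zariski_open_in :: "structure_constants set \<Rightarrow> structure_constants set \<Rightarrow> bool" where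
  "zariski_open_in V U \<longleftrightarrow> U \<subseteq> V \<and> zariski_closed_in V (V - U)"

text \<open>
  \<open>GL n\<close> consists of the linear maps restricting to an automorphism of \<open>\<complex>\<^sup>n\<close>, and
  \<open>change_basis n g C\<close> gives the structure constants of \<open>(x, y) \<mapsto> g (C (g\<inverse> x, g\<inverse> y))\<close>.
\<close>

definition GL :: "nat \<Rightarrow> (cvec \<Rightarrow> cvec) set" where
  "GL n = {g. Vector_Spaces.linear cscale cscale g \<and>
              bij_betw g (coord_space n) (coord_space n)}"

definition change_basis ::
  "nat \<Rightarrow> (cvec \<Rightarrow> cvec) \<Rightarrow> structure_constants \<Rightarrow> structure_constants" where
  "change_basis n g C = (\<lambda>i j l.
     if i \<in> {1..n} \<and> j \<in> {1..n} \<and> l \<in> {1..n}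
     then let h = inv_into (coord_space n) g
          in g (bilinear_of n C (h (basis_vec i)) (h (basis_vec j))) l
     else 0)"

definition orbit :: "nat \<Rightarrow> structure_constants \<Rightarrow> structure_constants set" where
  "orbit n C = {change_basis n g C | g. g \<in> GL n}"

definition rigid :: "nat \<Rightarrow> structure_constants \<Rightarrow> bool" where
  "rigid n C \<longleftrightarrow> C \<in> lie_laws n \<and> zariski_open_in (lie_laws n) (orbit n C)"


section \<open>Laws given by Cartan--Maurer equations\<close>

text \<open>
  \<open>wedge a b i j\<close> is the value of \<open>\<omega>\<^sub>a \<and> \<omega>\<^sub>b\<close> at \<open>(X\<^sub>i, X\<^sub>j)\<close>. With the convention
  \<open>d\<omega>\<^sub>l = \<Sum>\<^sub>i\<^sub><\<^sub>j C\<^sub>i\<^sub>j\<^sup>l \<omega>\<^sub>i \<and> \<omega>\<^sub>j\<close>, the structure constant \<open>C\<^sub>i\<^sub>j\<^sup>l\<close> is the value of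
  \<open>d\<omega>\<^sub>l\<close> at \<open>(X\<^sub>i, X\<^sub>j)\<close>. A law is entered below through the 2-forms \<open>d\<omega>\<^sub>l\<close>, as functions of \<open>l\<close>.
\<close>

definition wedge :: "nat \<Rightarrow> nat \<Rightarrow> nat \<Rightarrow> nat \<Rightarrow> complex" where
  "wedge a b i j = (if i = a \<and> j = b then 1 else 0) - (if i = b \<and> j = a then 1 else 0)"

definition law_of_forms :: "(nat \<Rightarrow> nat \<Rightarrow> nat \<Rightarrow> complex) \<Rightarrow> structure_constants" where
  "law_of_forms d = (\<lambda>i j l. d l i j)"

text \<open>The algebra \<open>\<gg>\<close>\<open>\<^bsub>(m,m-1)\<^esub>\<^bsup>4,1\<^esup>\<close>, of dimension \<open>2m+2\<close>.\<close>

definition g_forms :: "nat \<Rightarrow> nat \<Rightarrow> nat \<Rightarrow> nat \<Rightarrow> complex" where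
  "g_forms m l = (\<lambda>a b.
     if l \<in> {3..2*m} then wedge 1 (l - 1) a b
     else if l = 2*m + 1 then
       (\<Sum>j=2..m. (-1)^j * wedge j (2*m + 1 - j) a b)
     else if l = 2*m + 2 then
       wedge 1 (2*m + 1) a b
       + (\<Sum>j=2..m. (-1)^j * (of_nat m + 1 - of_nat j) * wedge j (2*m + 2 - j) a b)
     else 0)"

definition g_law :: "nat \<Rightarrow> structure_constants" where
  "g_law m = law_of_forms (g_forms m)"

text \<open>The structure constants of the cochain \<open>\<psi>\<close>\<open>\<^bsub>2,2m-5\<^esub>\<close> on \<open>\<complex>\<^bsup>2m+2\<^esup>\<close>.\<close>

definition psi :: "nat \<Rightarrow> structure_constants" where
  "psi m = (\<lambda>i j l.
     if l = 2*m - 1 then wedge 2 3 i j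
     else if l = 2*m then wedge 2 4 i j
     else 0)"

definition g_psi_bracket :: "nat \<Rightarrow> bracket" where
  "g_psi_bracket m = (\<lambda>x y.
     bilinear_of (2*m + 2) (g_law m) x y + bilinear_of (2*m + 2) (psi m) x y)"

text \<open>
  The algebra \<open>\<rr>\<close>\<open>\<^bsub>(m,m-1)\<^esub>\<^bsup>4,1,2m-5\<^esup>\<close>, of dimension \<open>2m+3\<close>. The index \<open>2m+3\<close> stands for
  \<open>\<theta>\<close>. Scalars are formed in \<open>complex\<close>, index subtractions in \<open>nat\<close> (all are exact for \<open>m \<ge> 4\<close>).
\<close>

definition r_forms :: "nat \<Rightarrow> nat \<Rightarrow> nat \<Rightarrow> nat \<Rightarrow> complex" where
  "r_forms m l = (\<lambda>a b. let \<theta> = 2*m + 3; M = of_nat m in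
     if l = 1 then wedge \<theta> 1 a b
     else if l = 2 then (2*M - 4) * wedge \<theta> 2 a b
     else if l \<in> {3..2*m - 2} then
       wedge 1 (l - 1) a b + (2*M - 6 + of_nat l) * wedge \<theta> l a b
     else if l = 2*m - 1 then
       wedge 1 (2*m - 2) a b + wedge 2 3 a b + (4*M - 7) * wedge \<theta> (2*m - 1) a b
     else if l = 2*m then
       wedge 1 (2*m - 1) a b + wedge 2 4 a b + (4*M - 6) * wedge \<theta> (2*m) a b
     else if l = 2*m + 1 then
       (\<Sum>j=2..m. (-1)^j * wedge j (2*m + 1 - j) a b)
       + (6*M - 11) * wedge \<theta> (2*m + 1) a b
     else if l = 2*m + 2 then
       wedge 1 (2*m + 1) a b
       + (\<Sum>j=2..m. (-1)^j * (M + 1 - of_nat j) * wedge j (2*m + 2 - j) a b)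
       + (6*M - 10) * wedge \<theta> (2*m + 2) a b
     else 0)"

definition r_law :: "nat \<Rightarrow> structure_constants" where
  "r_law m = law_of_forms (r_forms m)"

definition r_bracket :: "nat \<Rightarrow> bracket" where
  "r_bracket m = bilinear_of (2*m + 3) (r_law m)"

end

(* Rigidity is obtained from an explicit Zariski neighbourhood of the law. Let D = ad X_theta. A law C
   near the given one has eigenvalues \<alpha>, \<mu> of D with eigenvectors v_1, v_2, both taken as
   columns of the adjugates of \<alpha> - D and \<mu> - D, so that they are polynomial in the data.
   Setting v_(j+1) = [v_1, v_j], v_(2m+1) = [v_2, v_(2m-1)] and v_(2m+2) = [v_1, v_(2m+1)], the
   nonvanishing of a few coordinates of these vectors makes all of them eigenvectors, and requiring
   [v_2, v_3] to have a component in the eigenspace of v_(2m-1) forces \<mu> = (2m-4) \<alpha>. Hence C is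
   graded by the same weights as the given law, and the Jacobi identity determines the remaining
   brackets. The existence of suitable \<alpha>, \<mu> is a Zariski-open condition: all roots of a monic P
   are roots of F iff P divides F^(deg P), and the remainder is polynomial in the coefficients. *)
theory Submission
  imports "Jordan_Normal_Form.Char_Poly" Defs
begin

section \<open>Polynomial functions and elimination of eigenvalues\<close>

text \<open>No cohomology is computed; the simple spectrum of D = ad X_theta does the work. The
  weights 0, 1, 2m-4, ..., 4m-6, 6m-11, 6m-10 are pairwise distinct for m >= 4, so in a law with
  these weights the bracket of two weight vectors is zero or a multiple of a single weight vector,
  and only scalars remain to be found. The relation for \<mu> arises because [v_2, v_3] has
  eigenvalue 2 \<mu> + \<alpha> and v_(2m-1) has eigenvalue (2m-3) \<alpha> + \<mu>. Having a
  component in the eigenspace of nu is expressed by a coordinate of adj(nu - D) y: since adj(nu - D)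
  (nu - D) = det(nu - D), for an eigenvalue nu and an eigenvector y with eigenvalue s it can be
  nonzero only if s = nu. The obstacle is that eigenvalues are not polynomial in the structure
  constants: the condition is polynomial in (C, \<alpha>, \<mu>), and existence is projected to C
  one variable at a time. A neighbourhood of the given law alone suffices, since GL acts by linear
  maps on structure constants and carries it to every point of the orbit.\<close>

inductive_set poly_fun :: "('a \<Rightarrow> complex) set \<Rightarrow> ('a \<Rightarrow> complex) set" for G where
  const: "(\<lambda>_. c) \<in> poly_fun G"
| gen: "g \<in> G \<Longrightarrow> g \<in> poly_fun G"
| add: "\<lbrakk>p \<in> poly_fun G; q \<in> poly_fun G\<rbrakk> \<Longrightarrow> (\<lambda>x. p x + q x) \<in> poly_fun G"
| mult: "\<lbrakk>p \<in> poly_fun G; q \<in> poly_fun G\<rbrakk> \<Longrightarrow> (\<lambda>x. p x * q x) \<in> poly_fun G"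

lemma poly_fun_uminus: "p \<in> poly_fun G \<Longrightarrow> (\<lambda>x. - p x) \<in> poly_fun G"
  using poly_fun.mult[OF poly_fun.const[of "-1"], of p G] by simp

lemma poly_fun_diff: "p \<in> poly_fun G \<Longrightarrow> q \<in> poly_fun G \<Longrightarrow> (\<lambda>x. p x - q x) \<in> poly_fun G"
  using poly_fun.add[OF _ poly_fun_uminus[of q G], of p] by simp

lemma poly_fun_sum:
  "(\<And>i. i \<in> A \<Longrightarrow> p i \<in> poly_fun G) \<Longrightarrow> (\<lambda>x. \<Sum>i\<in>A. p i x) \<in> poly_fun G"
proof (induction A rule: infinite_finite_induct)
  case (insert a A)
  then show ?case using poly_fun.add[of "p a" G "\<lambda>x. \<Sum>i\<in>A. p i x"] by simp
qed (simp_all add: poly_fun.const)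

lemma poly_fun_prod:
  "(\<And>i. i \<in> A \<Longrightarrow> p i \<in> poly_fun G) \<Longrightarrow> (\<lambda>x. \<Prod>i\<in>A. p i x) \<in> poly_fun G"
proof (induction A rule: infinite_finite_induct)
  case (insert a A)
  then show ?case using poly_fun.mult[of "p a" G "\<lambda>x. \<Prod>i\<in>A. p i x"] by simp
qed (simp_all add: poly_fun.const)

lemmas poly_fun_intros =
  poly_fun.const poly_fun.add poly_fun.mult poly_fun_uminus poly_fun_diff poly_fun_sum poly_fun_prod

text \<open>A point is a pair of a base point and a value t, so this generates the polynomial
  functions over \<open>G\<close> in one more variable. Leaving the generators arbitrary allows
  iteration, first for \<alpha> and then for \<mu>.\<close>

definition adjoin_variable :: "('a \<Rightarrow> complex) set \<Rightarrow> ('a \<times> complex \<Rightarrow> complex) set" where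
  "adjoin_variable G = insert snd ((\<lambda>g. g \<circ> fst) ` G)"

lemma poly_fun_adjoin_fst: "p \<in> poly_fun G \<Longrightarrow> (\<lambda>x. p (fst x)) \<in> poly_fun (adjoin_variable G)"
proof (induction rule: poly_fun.induct)
  case (gen g)
  then have "g \<circ> fst \<in> poly_fun (adjoin_variable G)"
    by (intro poly_fun.gen) (auto simp: adjoin_variable_def)
  then show ?case by (simp add: o_def)
qed (auto intro: poly_fun.intros(1,3,4))

lemma poly_fun_adjoin_snd: "(\<lambda>x. snd x) \<in> poly_fun (adjoin_variable G)"
  by (rule poly_fun.gen) (simp add: adjoin_variable_def)

text \<open>Univariate polynomials over the ring \<open>poly_fun G\<close>. No degree bound common
  to all x is part of the notion; it is carried separately where a sum over a fixed range is
  needed.\<close>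

definition poly_family :: "('a \<Rightarrow> complex) set \<Rightarrow> ('a \<Rightarrow> complex poly) set" where
  "poly_family G = {\<Phi>. \<forall>k. (\<lambda>x. coeff (\<Phi> x) k) \<in> poly_fun G}"

lemma poly_familyD: "\<Phi> \<in> poly_family G \<Longrightarrow> (\<lambda>x. coeff (\<Phi> x) k) \<in> poly_fun G"
  by (simp add: poly_family_def)

lemma poly_family_const: "(\<lambda>_. p) \<in> poly_family G"
  by (simp add: poly_family_def poly_fun.const)

lemma poly_family_add:
  "\<Phi> \<in> poly_family G \<Longrightarrow> \<Psi> \<in> poly_family G \<Longrightarrow> (\<lambda>x. \<Phi> x + \<Psi> x) \<in> poly_family G"
  by (simp add: poly_family_def poly_fun.add)

lemma poly_family_diff:
  "\<Phi> \<in> poly_family G \<Longrightarrow> \<Psi> \<in> poly_family G \<Longrightarrow> (\<lambda>x. \<Phi> x - \<Psi> x) \<in> poly_family G"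
  by (simp add: poly_family_def poly_fun_diff)

lemma poly_family_mult:
  "\<Phi> \<in> poly_family G \<Longrightarrow> \<Psi> \<in> poly_family G \<Longrightarrow> (\<lambda>x. \<Phi> x * \<Psi> x) \<in> poly_family G"
  by (simp add: poly_family_def coeff_mult poly_fun_intros)

lemma poly_family_power: "\<Phi> \<in> poly_family G \<Longrightarrow> (\<lambda>x. \<Phi> x ^ k) \<in> poly_family G"
  by (induction k) (simp_all add: poly_family_const poly_family_mult)

lemma poly_family_sum:
  "(\<And>i. i \<in> A \<Longrightarrow> \<Phi> i \<in> poly_family G) \<Longrightarrow> (\<lambda>x. \<Sum>i\<in>A. \<Phi> i x) \<in> poly_family G"
  by (simp add: poly_family_def coeff_sum poly_fun_sum)

lemma poly_family_prod:
  "(\<And>i. i \<in> A \<Longrightarrow> \<Phi> i \<in> poly_family G) \<Longrightarrow> (\<lambda>x. \<Prod>i\<in>A. \<Phi> i x) \<in> poly_family G"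
proof (induction A rule: infinite_finite_induct)
  case (insert a A)
  then show ?case using poly_family_mult[of "\<Phi> a" G "\<lambda>x. \<Prod>i\<in>A. \<Phi> i x"] by simp
qed (simp_all add: poly_family_const)

lemma poly_family_smult:
  "p \<in> poly_fun G \<Longrightarrow> \<Phi> \<in> poly_family G \<Longrightarrow> (\<lambda>x. Polynomial.smult (p x) (\<Phi> x)) \<in> poly_family G"
  by (simp add: poly_family_def poly_fun.mult)

lemma poly_family_pCons:
  assumes "p \<in> poly_fun G" "\<Phi> \<in> poly_family G"
  shows "(\<lambda>x. pCons (p x) (\<Phi> x)) \<in> poly_family G"
  unfolding poly_family_def
proof (intro CollectI allI)
  fix k show "(\<lambda>x. coeff (pCons (p x) (\<Phi> x)) k) \<in> poly_fun G"
    using assms by (cases k) (simp_all add: poly_family_def)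
qed

text \<open>Powers of the adjoined variable are collected. The bound \<open>d\<close>, uniform in x,
  is what \<open>poly_family_mod\<close> relies on.\<close>

lemma poly_fun_adjoin_as_poly:
  assumes "f \<in> poly_fun (adjoin_variable G)"
  obtains \<Phi> d where "\<Phi> \<in> poly_family G" "\<And>x. degree (\<Phi> x) \<le> d"
    "\<And>x t. f (x, t) = poly (\<Phi> x) t"
proof -
  have "\<exists>\<Phi>\<in>poly_family G. (\<exists>d. \<forall>x. degree (\<Phi> x) \<le> d) \<and> (\<forall>x t. f (x, t) = poly (\<Phi> x) t)"
    using assms
  proof (induction rule: poly_fun.induct)
    case (const c)
    show ?case by (rule bexI[of _ "\<lambda>_. [:c:]"]) (auto simp: poly_family_const)
  next
    case (gen g)
    consider "g = snd" | h where "h \<in> G" "g = h \<circ> fst"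
      using gen by (auto simp: adjoin_variable_def)
    then show ?case
    proof cases
      case 1
      then show ?thesis by (intro bexI[of _ "\<lambda>_. [:0, 1:]"]) (auto simp: poly_family_const)
    next
      case 2
      then show ?thesis
        by (intro bexI[of _ "\<lambda>x. [:h x:]"]) (auto intro!: poly_family_pCons poly_family_const poly_fun.gen)
    qed
  next
    case (add p q)
    then obtain \<Phi> \<Psi> d e where *: "\<Phi> \<in> poly_family G" "\<Psi> \<in> poly_family G"
      "\<forall>x t. p (x, t) = poly (\<Phi> x) t" "\<forall>x t. q (x, t) = poly (\<Psi> x) t"
      "\<forall>x. degree (\<Phi> x) \<le> d" "\<forall>x. degree (\<Psi> x) \<le> e" by auto
    have "\<forall>x. degree (\<Phi> x + \<Psi> x) \<le> max d e"
      using *(5,6) by (meson degree_add_le max.coboundedI1 max.coboundedI2)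
    with * show ?case by (intro bexI[of _ "\<lambda>x. \<Phi> x + \<Psi> x"]) (auto simp: poly_family_add)
  next
    case (mult p q)
    then obtain \<Phi> \<Psi> d e where *: "\<Phi> \<in> poly_family G" "\<Psi> \<in> poly_family G"
      "\<forall>x t. p (x, t) = poly (\<Phi> x) t" "\<forall>x t. q (x, t) = poly (\<Psi> x) t"
      "\<forall>x. degree (\<Phi> x) \<le> d" "\<forall>x. degree (\<Psi> x) \<le> e" by auto
    have "\<forall>x. degree (\<Phi> x * \<Psi> x) \<le> d + e"
      using *(5,6) by (meson add_mono degree_mult_le order_trans)
    with * show ?case by (intro bexI[of _ "\<lambda>x. \<Phi> x * \<Psi> x"]) (auto simp: poly_family_mult)
  qed
  then show ?thesis using that by blast
qed

text \<open>A monic divisor needs no division by its leading coefficient: t^(k+1) mod P is t (t^k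
  mod P) minus the coefficient of t^n in it times P, so polynomiality in x survives each
  step.\<close>

lemma poly_family_monom_mod:
  assumes P: "P \<in> poly_family G" and monic: "\<And>x. monic (P x)" and deg: "\<And>x. degree (P x) = n"
  shows "(\<lambda>x. monom 1 k mod P x) \<in> poly_family G"
proof (induction k)
  case 0
  show ?case
  proof (cases "n = 0")
    case True
    then have "P x = 1" for x using monic[of x] deg[of x] by (auto elim!: degree_eq_zeroE simp: one_pCons)
    then show ?thesis by (simp add: poly_family_const)
  next
    case False
    then have "monom 1 0 mod P x = 1" for x
      by (simp add: mod_poly_less deg monom_0 one_pCons)
    then show ?thesis by (simp add: poly_family_const)
  qed
next
  case (Suc k)
  have nz: "P x \<noteq> 0" for x using monic[of x] by auto
  have eq: "monom 1 (Suc k) mod P x = pCons 0 (monom 1 k mod P x) -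
      Polynomial.smult (coeff (pCons 0 (monom 1 k mod P x)) n) (P x)" for x
    using mod_pCons_eq[of 0 "monom 1 k" "P x"] nz[of x] monic[of x] deg[of x] by (simp add: monom_Suc)
  have 1: "(\<lambda>x. pCons 0 (monom 1 k mod P x)) \<in> poly_family G"
    using poly_family_pCons[OF poly_fun.const Suc.IH] .
  show ?case unfolding eq
    by (intro poly_family_diff poly_family_smult P 1 poly_familyD[OF 1])
qed

lemma poly_family_mod:
  assumes P: "P \<in> poly_family G" "\<And>x. monic (P x)" "\<And>x. degree (P x) = n"
    and F: "\<Phi> \<in> poly_family G" "\<And>x. degree (\<Phi> x) \<le> d"
  shows "(\<lambda>x. \<Phi> x mod P x) \<in> poly_family G"
proof -
  have sum_mod: "(\<Sum>k\<in>A. f k) mod p = (\<Sum>k\<in>A. f k mod p)" if "finite A"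
    for A :: "nat set" and f :: "nat \<Rightarrow> complex poly" and p
    using that by (induction A) (auto simp: poly_mod_add_left)
  have "\<Phi> x mod P x = (\<Sum>k\<le>d. Polynomial.smult (coeff (\<Phi> x) k) (monom 1 k mod P x))" for x
  proof -
    have "\<Phi> x = (\<Sum>k\<le>d. Polynomial.smult (coeff (\<Phi> x) k) (monom 1 k))"
      by (subst (1) poly_as_sum_of_monoms'[OF F(2)[of x], symmetric]) (simp add: smult_monom)
    then have "\<Phi> x mod P x = (\<Sum>k\<le>d. Polynomial.smult (coeff (\<Phi> x) k) (monom 1 k)) mod P x"
      by (rule arg_cong)
    then show ?thesis by (simp add: sum_mod mod_smult_left)
  qed
  then show ?thesis
    by (simp only:) (intro poly_family_sum poly_family_smult poly_familyD[OF F(1)]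
        poly_family_monom_mod[where n = n] P)
qed

text \<open>A monic \<open>P\<close> divides a power of \<open>F\<close> iff every root of \<open>P\<close> is a root of \<open>F\<close>, and the
  remainder of the power modulo \<open>P\<close> depends polynomially on the coefficients.\<close>

lemma eliminate_root:
  assumes P: "P \<in> poly_family G" "\<And>x. monic (P x)" "\<And>x. degree (P x) = n"
    and f: "f \<in> poly_fun (adjoin_variable G)"
    and root: "poly (P x0) t0 = 0" "f (x0, t0) \<noteq> 0"
  obtains q where "q \<in> poly_fun G" "q x0 \<noteq> 0"
    "\<And>x. q x \<noteq> 0 \<Longrightarrow> \<exists>t. poly (P x) t = 0 \<and> f (x, t) \<noteq> 0"
proof -
  obtain \<Phi> d where F: "\<Phi> \<in> poly_family G" "\<And>x. degree (\<Phi> x) \<le> d"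
    "\<And>x t. f (x, t) = poly (\<Phi> x) t" using poly_fun_adjoin_as_poly[OF f] by metis
  \<comment> \<open>The exponent is the degree of P, which bounds the multiplicity of every root of
    P.\<close>
  define R where "R x = \<Phi> x ^ n mod P x" for x
  have "degree (\<Phi> x ^ n) \<le> d * n" for x
    using degree_power_le[of "\<Phi> x" n] F(2)[of x] by (meson le_trans mult_le_mono1)
  then have R: "R \<in> poly_family G" unfolding R_def
    by (intro poly_family_mod[of P G n _ "d*n"] P poly_family_power F)
  have nz: "P x \<noteq> 0" for x using P(2)[of x] by auto
  have iff: "R x = 0 \<longleftrightarrow> (\<forall>t. poly (P x) t = 0 \<longrightarrow> f (x, t) = 0)" for x
    using nullstellensatz_univariate[of "P x" "\<Phi> x"] nz[of x]
    by (auto simp: R_def F(3) P(3) mod_eq_0_iff_dvd)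
  then have "R x0 \<noteq> 0" using root by blast
  \<comment> \<open>A single polynomial is wanted, so one remainder coefficient that survives at
    \<open>x0\<close> is kept. Its nonvanishing at x is sufficient for the condition at x, not
    equivalent to it.\<close>
  then obtain k where k: "coeff (R x0) k \<noteq> 0" by (auto simp: poly_eq_iff)
  show ?thesis
  proof (rule that[of "\<lambda>x. coeff (R x) k"])
    show "(\<lambda>x. coeff (R x) k) \<in> poly_fun G" using R by (rule poly_familyD)
    show "\<exists>t. poly (P x) t = 0 \<and> f (x, t) \<noteq> 0" if "coeff (R x) k \<noteq> 0" for x
      using iff[of x] that by fastforce
  qed (fact k)
qed


section \<open>Adjugates and characteristic polynomials\<close>

text \<open>Coordinates are numbered from 1, matrix entries from 0.\<close>

definition coord_mat :: "nat \<Rightarrow> (nat \<Rightarrow> nat \<Rightarrow> 'a) \<Rightarrow> 'a mat" where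
  "coord_mat n M = mat n n (\<lambda>(i, j). M (Suc i) (Suc j))"

lemma coord_mat_carrier [simp]: "coord_mat n M \<in> carrier_mat n n"
  by (simp add: coord_mat_def)

definition adjugate :: "nat \<Rightarrow> (nat \<Rightarrow> nat \<Rightarrow> complex) \<Rightarrow> nat \<Rightarrow> nat \<Rightarrow> complex" where
  "adjugate n M i j = adj_mat (coord_mat n M) $$ (i - 1, j - 1)"

definition char_mat :: "(nat \<Rightarrow> nat \<Rightarrow> complex) \<Rightarrow> complex \<Rightarrow> nat \<Rightarrow> nat \<Rightarrow> complex" where
  "char_mat M t i j = (if i = j then t else 0) - M i j"

lemma poly_char_poly_coord_mat:
  "poly (char_poly (coord_mat n M)) t = det (coord_mat n (char_mat M t))"
proof -
  have "- char_matrix (coord_mat n M) t = coord_mat n (char_mat M t)"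
    by (rule eq_matI) (auto simp: coord_mat_def char_matrix_def char_mat_def)
  then show ?thesis by (simp add: char_poly_matrix[OF coord_mat_carrier])
qed

lemma poly_family_char_poly:
  assumes "\<And>i j. (\<lambda>x. M x i j) \<in> poly_fun G"
  shows "(\<lambda>x. char_poly (coord_mat n (M x))) \<in> poly_family G"
proof -
  have eq: "char_poly (coord_mat n (M x)) =
    (\<Sum>p | p permutes {0..<n}. of_int (sign p) *
      (\<Prod>i = 0..<n. [:- M x (Suc i) (Suc (p i)), if i = p i then 1 else 0:]))" for x
    unfolding char_poly_def
    by (subst det_def'[of _ n])
      (auto intro!: sum.cong prod.cong simp: char_poly_matrix_def coord_mat_def permutes_in_image)
  show ?thesis unfolding eq
    by (intro poly_family_sum poly_family_mult poly_family_prod poly_family_const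
        poly_family_pCons poly_fun_intros assms)
qed

lemma poly_fun_det:
  assumes "\<And>i j. i < n \<Longrightarrow> j < n \<Longrightarrow> (\<lambda>x. A x $$ (i, j)) \<in> poly_fun G"
    and "\<And>x. A x \<in> carrier_mat n n"
  shows "(\<lambda>x. det (A x)) \<in> poly_fun G"
  unfolding det_def'[OF assms(2)]
  by (intro poly_fun_intros assms(1)) (auto simp: permutes_in_image)

lemma poly_fun_adjugate:
  assumes M: "\<And>i j. (\<lambda>x. M x i j) \<in> poly_fun G" and ij: "i \<in> {1..n}" "j \<in> {1..n}"
  shows "(\<lambda>x. adjugate n (M x) i j) \<in> poly_fun G"
proof -
  have eq: "adjugate n (M x) i j =
      (- 1) ^ (j - 1 + (i - 1)) * det (mat_delete (coord_mat n (M x)) (j - 1) (i - 1))" for x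
    using ij by (simp add: adjugate_def adj_mat_def coord_mat_def cofactor_def less_diff_conv2)
  show ?thesis unfolding eq
  proof (intro poly_fun_intros poly_fun_det[of "n - 1"])
    show "mat_delete (coord_mat n (M x)) (j - 1) (i - 1) \<in> carrier_mat (n - 1) (n - 1)" for x
      by (rule mat_delete_carrier) simp
    show "(\<lambda>x. mat_delete (coord_mat n (M x)) (j - 1) (i - 1) $$ (a, b)) \<in> poly_fun G"
      if "a < n - 1" "b < n - 1" for a b
      using that by (simp add: mat_delete_def coord_mat_def M)
  qed
qed

lemma sum_shift_to_one: "(\<Sum>j = 1..n. f j) = (\<Sum>j = 0..<n. f (Suc j))"
  for f :: "nat \<Rightarrow> 'a::comm_monoid_add"
  by (simp add: sum.shift_bounds_Suc_ivl[symmetric] atLeastLessThanSuc_atLeastAtMost)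

lemma mult_adjugate:
  assumes "i \<in> {1..n}" "k \<in> {1..n}"
  shows "(\<Sum>j = 1..n. M i j * adjugate n M j k) = (if i = k then det (coord_mat n M) else 0)"
proof -
  let ?A = "coord_mat n M"
  have "(?A * adj_mat ?A) $$ (i - 1, k - 1) = (\<Sum>j = 0..<n. M i (Suc j) * adjugate n M (Suc j) k)"
    using assms adj_mat(1)[of ?A n]
    by (auto simp: scalar_prod_def adjugate_def coord_mat_def less_diff_conv2 intro!: sum.cong)
  moreover have "(?A * adj_mat ?A) $$ (i - 1, k - 1) = (if i = k then det ?A else 0)"
    using assms by (auto simp: adj_mat(2)[of ?A n])
  ultimately show ?thesis by (simp only: sum_shift_to_one)
qed

lemma adjugate_mult:
  assumes "i \<in> {1..n}" "k \<in> {1..n}"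
  shows "(\<Sum>j = 1..n. adjugate n M i j * M j k) = (if i = k then det (coord_mat n M) else 0)"
proof -
  let ?A = "coord_mat n M"
  have "(adj_mat ?A * ?A) $$ (i - 1, k - 1) = (\<Sum>j = 0..<n. adjugate n M i (Suc j) * M (Suc j) k)"
    using assms adj_mat(1)[of ?A n]
    by (auto simp: scalar_prod_def adjugate_def coord_mat_def less_diff_conv2 intro!: sum.cong)
  moreover have "(adj_mat ?A * ?A) $$ (i - 1, k - 1) = (if i = k then det ?A else 0)"
    using assms by (auto simp: adj_mat(3)[of ?A n])
  ultimately show ?thesis by (simp only: sum_shift_to_one)
qed

lemma det_coord_mat_diagonal:
  assumes "\<And>i j. i \<noteq> j \<Longrightarrow> M i j = 0"
  shows "det (coord_mat n M) = (\<Prod>i = 1..n. M i i)"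
proof -
  have "det (coord_mat n M) = prod_list (diag_mat (coord_mat n M))"
    using assms by (intro det_upper_triangular[of _ n]) (auto simp: coord_mat_def)
  also have "\<dots> = (\<Prod>i = 0..<n. M (Suc i) (Suc i))"
    by (auto simp: prod_list_diag_prod coord_mat_def intro!: prod.cong)
  also have "\<dots> = (\<Prod>i = 1..n. M i i)"
    by (simp add: prod.atLeast1_atMost_eq atLeast0LessThan)
  finally show ?thesis .
qed

text \<open>The k-th diagonal cofactor is the product of the other diagonal entries;
  \<open>M k k\<close> itself may be zero. Applied to t - ad X_theta at \<open>r_law m\<close>,
  where t is a weight, this shows that adjugate columns are nonzero multiples of basis
  vectors.\<close>

lemma adjugate_diagonal:
  assumes diag: "\<And>i j. i \<noteq> j \<Longrightarrow> M i j = 0" and k: "k \<in> {1..n}"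
    and nz: "\<And>i. i \<in> {1..n} \<Longrightarrow> i \<noteq> k \<Longrightarrow> M i i \<noteq> 0"
  shows "adjugate n M k k \<noteq> 0"
    and "i \<in> {1..n} \<Longrightarrow> i \<noteq> k \<Longrightarrow> adjugate n M i k = 0"
proof -
  let ?B = "mat_delete (coord_mat n M) (k - 1) (k - 1)"
  have B: "?B \<in> carrier_mat (n - 1) (n - 1)" by (rule mat_delete_carrier) simp
  have "upper_triangular ?B"
    using diag by (auto simp: upper_triangular_def mat_delete_def coord_mat_def)
  then have "det ?B = prod_list (diag_mat ?B)" by (rule det_upper_triangular[OF _ B])
  also have "\<dots> = (\<Prod>i = 0..<n - 1. ?B $$ (i, i))"
    unfolding prod_list_diag_prod carrier_matD(1)[OF B] ..
  also have "\<dots> \<noteq> 0"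
    using nz k by (auto simp: mat_delete_def coord_mat_def)
  finally show "adjugate n M k k \<noteq> 0"
    using k by (auto simp: adjugate_def adj_mat_def coord_mat_def cofactor_def less_diff_conv2)
  show "adjugate n M i k = 0" if "i \<in> {1..n}" "i \<noteq> k"
  proof -
    \<comment> \<open>Row i of the product of M with its adjugate has only this term, and the
      product is zero off the diagonal.\<close>
    have "M i i * adjugate n M i k = (\<Sum>j = 1..n. M i j * adjugate n M j k)"
      using that diag by (subst sum.remove[of _ i]) (auto intro!: sum.neutral)
    also have "\<dots> = 0" using mult_adjugate[OF that(1) k, of M] that(2) by simp
    finally show ?thesis using nz that by simp
  qed
qed

text \<open>Characteristic polynomials are monic of the same degree \<open>n\<close> for every x, as
  division with remainder requires. The base point x may itself contain another eigenvalue that is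
  eliminated later.\<close>

lemma eliminate_eigenvalue:
  assumes M: "\<And>i j. (\<lambda>x. M x i j) \<in> poly_fun G"
    and f: "f \<in> poly_fun (adjoin_variable G)"
    and root: "det (coord_mat n (char_mat (M x0) t0)) = 0" "f (x0, t0) \<noteq> 0"
  obtains q where "q \<in> poly_fun G" "q x0 \<noteq> 0"
    "\<And>x. q x \<noteq> 0 \<Longrightarrow> \<exists>t. det (coord_mat n (char_mat (M x) t)) = 0 \<and> f (x, t) \<noteq> 0"
proof (rule eliminate_root[of "\<lambda>x. char_poly (coord_mat n (M x))" G n f x0 t0])
  show "(\<lambda>x. char_poly (coord_mat n (M x))) \<in> poly_family G"
    by (rule poly_family_char_poly) (rule M)
  show "monic (char_poly (coord_mat n (M x)))" "degree (char_poly (coord_mat n (M x))) = n" for x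
    using degree_monic_char_poly[of "coord_mat n (M x)" n] by auto
qed (use f root that in \<open>auto simp: poly_char_poly_coord_mat\<close>)


section \<open>Bilinear maps and laws on coordinate spaces\<close>

text \<open>Keeps the index \<open>1\<close> from being rewritten to \<open>Suc 0\<close>, so that
  facts about index \<open>1\<close> still match.\<close>

declare One_nat_def [simp del]

lemma cscale_apply [simp]: "cscale c v i = c * v i"
  by (simp add: cscale_def)

lemma subspace_coord_space: "cvec.subspace (coord_space n)"
  by (auto simp: cvec.subspace_def coord_space_def)

lemma zero_coord_space [simp]: "0 \<in> coord_space n"
  by (simp add: coord_space_def)

lemma basis_vec_coord_space: "i \<in> {1..n} \<Longrightarrow> basis_vec i \<in> coord_space n"
  by (auto simp: basis_vec_def coord_space_def)

lemma sum_fun_apply: "(\<Sum>i\<in>A. f i) x = (\<Sum>i\<in>A. f i x)"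
  by (induction A rule: infinite_finite_induct) auto

lemma coord_space_expansion:
  assumes "x \<in> coord_space n"
  shows "(\<Sum>i = 1..n. cscale (x i) (basis_vec i)) = x"
proof
  fix l
  have "(\<Sum>i = 1..n. cscale (x i) (basis_vec i)) l = (\<Sum>i = 1..n. if l = i then x i else 0)"
    unfolding sum_fun_apply by (intro sum.cong) (auto simp: basis_vec_def)
  also have "\<dots> = x l" using assms by (auto simp: coord_space_def)
  finally show "(\<Sum>i = 1..n. cscale (x i) (basis_vec i)) l = x l" .
qed

lemma span_basis_vec: "cvec.span (basis_vec ` {1..n}) = coord_space n"
proof
  show "cvec.span (basis_vec ` {1..n}) \<subseteq> coord_space n"
    by (rule cvec.span_minimal[OF _ subspace_coord_space]) (auto intro: basis_vec_coord_space)
  show "coord_space n \<subseteq> cvec.span (basis_vec ` {1..n})"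
  proof
    fix x assume "x \<in> coord_space n"
    then have "x = (\<Sum>i = 1..n. cscale (x i) (basis_vec i))" by (simp add: coord_space_expansion)
    also have "\<dots> \<in> cvec.span (basis_vec ` {1..n})"
      by (intro cvec.span_sum cvec.span_scale cvec.span_base) auto
    finally show "x \<in> cvec.span (basis_vec ` {1..n})" .
  qed
qed

lemma inj_basis_vec: "inj basis_vec"
  by (rule injI) (metis basis_vec_def zero_neq_one)

lemma independent_basis_vec: "cvec.independent (basis_vec ` {1..n})"
  unfolding cvec.independent_explicit_finite_subsets
proof (intro allI impI ballI)
  fix S u v
  assume S: "S \<subseteq> basis_vec ` {1..n}" "finite S" and 0: "(\<Sum>v\<in>S. cscale (u v) v) = 0" and v: "v \<in> S"
  obtain k where k: "v = basis_vec k" using S v by auto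
  have "(\<Sum>w\<in>S. cscale (u w) w) k = (\<Sum>w\<in>S. if w = v then u w else 0)"
    unfolding sum_fun_apply
  proof (rule sum.cong)
    fix w assume "w \<in> S"
    then obtain j where "w = basis_vec j" using S by auto
    then show "cscale (u w) w k = (if w = v then u w else 0)"
      using k injD[OF inj_basis_vec, of j k] by (auto simp: basis_vec_def)
  qed simp
  also have "\<dots> = u v" using v S(2) by simp
  finally show "u v = 0" using 0 by simp
qed

lemma bilinear_of_add_left: "bilinear_of n C (x + y) z = bilinear_of n C x z + bilinear_of n C y z"
  by (auto simp: bilinear_of_def fun_eq_iff algebra_simps sum.distrib)

lemma bilinear_of_add_right: "bilinear_of n C z (x + y) = bilinear_of n C z x + bilinear_of n C z y"
  by (auto simp: bilinear_of_def fun_eq_iff algebra_simps sum.distrib)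

lemma bilinear_of_scale_left: "bilinear_of n C (cscale c x) z = cscale c (bilinear_of n C x z)"
  by (auto simp: bilinear_of_def fun_eq_iff algebra_simps sum_distrib_left)

lemma bilinear_of_scale_right: "bilinear_of n C z (cscale c x) = cscale c (bilinear_of n C z x)"
  by (auto simp: bilinear_of_def fun_eq_iff algebra_simps sum_distrib_left)

lemmas bilinear_of_linear = bilinear_of_add_left bilinear_of_add_right
  bilinear_of_scale_left bilinear_of_scale_right

lemma bilinear_of_0_left [simp]: "bilinear_of n C 0 z = 0"
  by (auto simp: bilinear_of_def fun_eq_iff)

lemma bilinear_of_0_right [simp]: "bilinear_of n C z 0 = 0"
  by (auto simp: bilinear_of_def fun_eq_iff)

lemma bilinear_of_sum_left:
  "bilinear_of n C (\<Sum>i\<in>A. f i) z = (\<Sum>i\<in>A. bilinear_of n C (f i) z)"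
proof -
  interpret Vector_Spaces.linear cscale cscale "\<lambda>x. bilinear_of n C x z"
    by unfold_locales (simp_all add: bilinear_of_linear)
  show ?thesis by (rule sum)
qed

lemma bilinear_of_basis_vec:
  assumes "i \<in> {1..n}" "j \<in> {1..n}"
  shows "bilinear_of n C (basis_vec i) (basis_vec j) = C i j"
proof
  fix l
  have "(\<Sum>j'=1..n. basis_vec i i' * basis_vec j j' * C i' j' l) = (if i' = i then C i' j l else 0)" for i'
  proof -
    have "(\<Sum>j'=1..n. basis_vec i i' * basis_vec j j' * C i' j' l) =
        (\<Sum>j'=1..n. if j' = j then (if i' = i then C i' j' l else 0) else 0)"
      by (rule sum.cong) (auto simp: basis_vec_def)
    then show ?thesis using assms(2) by simp
  qed
  then have "bilinear_of n C (basis_vec i) (basis_vec j) l = (\<Sum>i'=1..n. if i' = i then C i' j l else 0)"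
    by (simp add: bilinear_of_def)
  also have "\<dots> = C i j l" using assms by simp
  finally show "bilinear_of n C (basis_vec i) (basis_vec j) l = C i j l" .
qed

text \<open>The support clause of \<open>lie_laws\<close> alone: it keeps brackets inside
  \<open>coord_space n\<close> and makes a law recoverable from its brackets of basis
  vectors.\<close>

definition law_support :: "nat \<Rightarrow> structure_constants \<Rightarrow> bool" where
  "law_support n C \<longleftrightarrow> (\<forall>i j l. C i j l \<noteq> 0 \<longrightarrow> i \<in> {1..n} \<and> j \<in> {1..n} \<and> l \<in> {1..n})"

lemma law_supportD: "law_support n C \<Longrightarrow> C i j l \<noteq> 0 \<Longrightarrow> i \<in> {1..n} \<and> j \<in> {1..n} \<and> l \<in> {1..n}"
  by (simp add: law_support_def)

lemma bilinear_of_closed: "law_support n C \<Longrightarrow> bilinear_of n C x y \<in> coord_space n"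
  by (force simp: law_support_def bilinear_of_def coord_space_def intro!: sum.neutral)

lemma law_support_eqI:
  assumes "law_support n C" "law_support n C'"
    and "\<And>i j. i \<in> {1..n} \<Longrightarrow> j \<in> {1..n} \<Longrightarrow>
      bilinear_of n C (basis_vec i) (basis_vec j) = bilinear_of n C' (basis_vec i) (basis_vec j)"
  shows "C = C'"
proof (intro ext)
  fix i j l
  show "C i j l = C' i j l"
  proof (cases "i \<in> {1..n} \<and> j \<in> {1..n}")
    case True
    then show ?thesis using assms(3)[of i j] by (simp add: bilinear_of_basis_vec)
  next
    case False
    then have "C i j l = 0" "C' i j l = 0"
      using law_supportD[OF assms(1), of i j l] law_supportD[OF assms(2), of i j l] by blast+
    then show ?thesis by simp
  qed
qed

definition jacobiator :: "bracket \<Rightarrow> cvec \<Rightarrow> cvec \<Rightarrow> cvec \<Rightarrow> cvec" where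
  "jacobiator br x y z = br x (br y z) + br y (br z x) + br z (br x y)"

lemma jacobiator_linear:
  fixes n C defines "br \<equiv> bilinear_of n C"
  shows "jacobiator br (x + x') y z = jacobiator br x y z + jacobiator br x' y z"
    "jacobiator br y (x + x') z = jacobiator br y x z + jacobiator br y x' z"
    "jacobiator br y z (x + x') = jacobiator br y z x + jacobiator br y z x'"
    "jacobiator br (cscale c x) y z = cscale c (jacobiator br x y z)"
    "jacobiator br y (cscale c x) z = cscale c (jacobiator br y x z)"
    "jacobiator br y z (cscale c x) = cscale c (jacobiator br y z x)"
    "jacobiator br 0 y z = 0" "jacobiator br y 0 z = 0" "jacobiator br y z 0 = 0"
  by (simp_all add: br_def jacobiator_def bilinear_of_linear cvec.scale_right_distrib ac_simps)

lemma lie_laws_iff: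
  "C \<in> lie_laws n \<longleftrightarrow> law_support n C \<and> (\<forall>x\<in>coord_space n. bilinear_of n C x x = 0) \<and>
    (\<forall>x\<in>coord_space n. \<forall>y\<in>coord_space n. \<forall>z\<in>coord_space n. jacobiator (bilinear_of n C) x y z = 0)"
  by (simp add: lie_laws_def law_support_def jacobiator_def Let_def)

lemma coord_space_subspace_induct:
  assumes x: "x \<in> coord_space n" and b: "\<And>i. i \<in> {1..n} \<Longrightarrow> P (basis_vec i)"
    and P: "cvec.subspace {x. P x}"
  shows "P x"
proof -
  have "cvec.span (basis_vec ` {1..n}) \<subseteq> {x. P x}"
    by (rule cvec.span_minimal[OF _ P]) (use b in auto)
  then show ?thesis using x by (auto simp: span_basis_vec)
qed

lemma lie_lawsI_basis:
  assumes supp: "law_support n C" and anti: "\<And>i j. C i j = - C j i"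
    and jac: "\<And>i j k. i \<in> {1..n} \<Longrightarrow> j \<in> {1..n} \<Longrightarrow> k \<in> {1..n} \<Longrightarrow>
      jacobiator (bilinear_of n C) (basis_vec i) (basis_vec j) (basis_vec k) = 0"
  shows "C \<in> lie_laws n"
  unfolding lie_laws_iff
proof (intro conjI ballI supp)
  let ?V = "coord_space n" and ?b = "bilinear_of n C"
  fix x assume x: "x \<in> ?V"
  \<comment> \<open>Exchanging the summation indices and using antisymmetry turns the sum into its
    negative.\<close>
  have "?b x x l = - ?b x x l" for l
  proof -
    have "?b x x l = (\<Sum>i=1..n. \<Sum>j=1..n. x j * x i * C j i l)"
      unfolding bilinear_of_def by (rule sum.swap)
    also have "\<dots> = - ?b x x l"
      unfolding bilinear_of_def sum_negf[symmetric]
      by (intro sum.cong refl) (subst anti, simp)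
    finally show ?thesis .
  qed
  then show "?b x x = 0" by (simp add: fun_eq_iff eq_neg_iff_add_eq_0)
  fix y z assume y: "y \<in> ?V" and z: "z \<in> ?V"
  have sub: "cvec.subspace {x. jacobiator ?b x y z = 0}"
    "cvec.subspace {x. jacobiator ?b y x z = 0}"
    "cvec.subspace {x. jacobiator ?b y z x = 0}" for y z
    by (auto simp: cvec.subspace_def jacobiator_linear)
  have 1: "jacobiator ?b (basis_vec i) (basis_vec j) z = 0" if "i \<in> {1..n}" "j \<in> {1..n}" for i j
    by (rule coord_space_subspace_induct[OF z _ sub(3)]) (use jac that in auto)
  have 2: "jacobiator ?b (basis_vec i) y z = 0" if "i \<in> {1..n}" for i
    by (rule coord_space_subspace_induct[OF y _ sub(2)]) (use 1 that in auto)
  show "jacobiator ?b x y z = 0"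
    by (rule coord_space_subspace_induct[OF x _ sub(1)]) (use 2 in auto)
qed

lemma lie_laws_antisym:
  assumes "C \<in> lie_laws n" "x \<in> coord_space n" "y \<in> coord_space n"
  shows "bilinear_of n C x y = - bilinear_of n C y x"
proof -
  have V: "x + y \<in> coord_space n" using assms(2,3) by (auto simp: coord_space_def)
  have "bilinear_of n C (x + y) (x + y) = 0" "bilinear_of n C x x = 0" "bilinear_of n C y y = 0"
    using assms V unfolding lie_laws_iff by blast+
  then show ?thesis by (simp add: bilinear_of_linear eq_neg_iff_add_eq_0 add.commute)
qed

text \<open>The Jacobi identity in the form from which eigenvalues of ad x are seen to add under
  brackets.\<close>

lemma lie_laws_derivation:
  assumes "C \<in> lie_laws n" "x \<in> coord_space n" "y \<in> coord_space n" "z \<in> coord_space n"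
  defines "br \<equiv> bilinear_of n C"
  shows "br x (br y z) = br (br x y) z + br y (br x z)"
proof -
  have cl: "br x y \<in> coord_space n" for x y
    using assms(1) unfolding br_def lie_laws_iff by (simp add: bilinear_of_closed)
  have "jacobiator br x y z = 0" using assms unfolding lie_laws_iff by blast
  moreover have "br z x = - br x z" "br z (br x y) = - br (br x y) z"
    unfolding br_def by (rule lie_laws_antisym; use assms cl in \<open>simp add: br_def\<close>)+
  moreover have "br y (- br x z) = - br y (br x z)"
    using bilinear_of_scale_right[of n C y "-1" "br x z"]
    by (simp add: br_def cscale_def fun_eq_iff fun_Compl_def)
  ultimately show ?thesis by (simp add: jacobiator_def algebra_simps)
qed

section \<open>The action of \<open>GL n\<close> on laws and its orbits\<close>

text \<open>Elements of \<open>GL n\<close> must be linear on all of \<open>nat \<Rightarrow> complex\<close>; here the coordinates outside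
  \<open>{1..n}\<close> are ignored.\<close>

definition linear_of_basis :: "nat \<Rightarrow> (nat \<Rightarrow> cvec) \<Rightarrow> cvec \<Rightarrow> cvec" where
  "linear_of_basis n w x = (\<Sum>k = 1..n. cscale (x k) (w k))"

lemma linear_linear_of_basis: "Vector_Spaces.linear cscale cscale (linear_of_basis n w)"
  by unfold_locales
    (auto simp: linear_of_basis_def fun_eq_iff sum_fun_apply algebra_simps sum.distrib sum_distrib_left)

lemma linear_of_basis_basis_vec:
  assumes "i \<in> {1..n}" shows "linear_of_basis n w (basis_vec i) = w i"
proof -
  have "linear_of_basis n w (basis_vec i) = (\<Sum>k = 1..n. if k = i then w k else 0)"
    unfolding linear_of_basis_def by (rule sum.cong) (auto simp: basis_vec_def fun_eq_iff)
  then show ?thesis using assms by simp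
qed

lemma linear_of_basis_closed:
  assumes "\<And>k. k \<in> {1..n} \<Longrightarrow> w k \<in> coord_space n"
  shows "linear_of_basis n w x \<in> coord_space n"
  unfolding linear_of_basis_def
  by (intro cvec.subspace_sum[OF subspace_coord_space] cvec.subspace_scale[OF subspace_coord_space] assms)

text \<open>A description of the action free of the inverse that occurs in
  \<open>change_basis\<close>; \<open>orbit_iff\<close> characterises orbits by it.\<close>

definition intertwines :: "nat \<Rightarrow> (cvec \<Rightarrow> cvec) \<Rightarrow> structure_constants \<Rightarrow> structure_constants \<Rightarrow> bool" where
  "intertwines n g C C' \<longleftrightarrow> (\<forall>x\<in>coord_space n. \<forall>y\<in>coord_space n.
     g (bilinear_of n C x y) = bilinear_of n C' (g x) (g y))"

lemma GL_linear: "g \<in> GL n \<Longrightarrow> Vector_Spaces.linear cscale cscale g"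
  by (simp add: GL_def)

lemma GL_closed: "g \<in> GL n \<Longrightarrow> x \<in> coord_space n \<Longrightarrow> g x \<in> coord_space n"
  by (auto simp: GL_def bij_betw_def)

lemma law_support_change_basis: "law_support n (change_basis n g C)"
  by (simp add: law_support_def change_basis_def)

lemma intertwinesI_basis:
  assumes g: "g \<in> GL n"
    and b: "\<And>i j. i \<in> {1..n} \<Longrightarrow> j \<in> {1..n} \<Longrightarrow>
      g (bilinear_of n C (basis_vec i) (basis_vec j)) = bilinear_of n C' (g (basis_vec i)) (g (basis_vec j))"
  shows "intertwines n g C C'"
  unfolding intertwines_def
proof (intro ballI)
  interpret g: Vector_Spaces.linear cscale cscale g by (rule GL_linear[OF g])
  fix x y assume x: "x \<in> coord_space n" and y: "y \<in> coord_space n"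
  have sub: "cvec.subspace {x. g (bilinear_of n C x y) = bilinear_of n C' (g x) (g y)}"
    "cvec.subspace {y. g (bilinear_of n C x y) = bilinear_of n C' (g x) (g y)}" for x y
    by (auto simp: cvec.subspace_def bilinear_of_linear g.add g.scale g.zero)
  have "g (bilinear_of n C (basis_vec i) y) = bilinear_of n C' (g (basis_vec i)) (g y)"
    if "i \<in> {1..n}" for i
    by (rule coord_space_subspace_induct[OF y _ sub(2)]) (use b that in auto)
  then show "g (bilinear_of n C x y) = bilinear_of n C' (g x) (g y)"
    by (intro coord_space_subspace_induct[OF x _ sub(1)]) auto
qed

text \<open>\<open>inv_into\<close> controls nothing outside \<open>coord_space n\<close>, whereas
  \<open>GL n\<close> demands linearity on all functions; so the inverse is rebuilt as the linear
  map with the right values on the basis vectors.\<close>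

lemma GL_inverse:
  assumes g: "g \<in> GL n"
  obtains h where "h \<in> GL n" "\<And>x. x \<in> coord_space n \<Longrightarrow> h (g x) = x"
    "\<And>x. x \<in> coord_space n \<Longrightarrow> g (h x) = x"
proof -
  let ?V = "coord_space n" and ?i = "inv_into (coord_space n) g"
  interpret g: Vector_Spaces.linear cscale cscale g by (rule GL_linear[OF g])
  have bij: "bij_betw g ?V ?V" using g by (simp add: GL_def)
  have i: "?i x \<in> ?V" "g (?i x) = x" if "x \<in> ?V" for x
    using that bij_betw_imp_surj_on[OF bij] by (metis inv_into_into) (metis bij bij_betw_inv_into_right that)
  define h where "h = linear_of_basis n (\<lambda>k. ?i (basis_vec k))"
  have cl: "h x \<in> ?V" for x
    unfolding h_def by (rule linear_of_basis_closed) (rule i(1), rule basis_vec_coord_space)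
  have gh: "g (h x) = x" if "x \<in> ?V" for x
    using coord_space_expansion[OF that]
    by (simp add: h_def linear_of_basis_def g.sum g.scale i basis_vec_coord_space)
  have hg: "h (g x) = x" if "x \<in> ?V" for x
  proof -
    have "g (h (g x)) = g x" by (rule gh) (rule GL_closed[OF g that])
    then show ?thesis by (rule inj_onD[OF bij_betw_imp_inj_on[OF bij] _ cl that])
  qed
  have "bij_betw h ?V ?V"
    by (rule bij_betw_byWitness[where f' = g]) (use gh hg cl GL_closed[OF g] in auto)
  then have "h \<in> GL n" by (simp add: GL_def h_def linear_linear_of_basis)
  then show ?thesis using that gh hg by blast
qed

lemma intertwines_change_basis:
  assumes g: "g \<in> GL n" and C: "law_support n C"
  shows "intertwines n g C (change_basis n g C)"
proof -
  let ?V = "coord_space n" and ?C' = "change_basis n g C"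
  obtain h where h: "h \<in> GL n" and hg: "\<And>x. x \<in> ?V \<Longrightarrow> h (g x) = x"
    and gh: "\<And>x. x \<in> ?V \<Longrightarrow> g (h x) = x" using GL_inverse[OF g] by metis
  interpret g: Vector_Spaces.linear cscale cscale g by (rule GL_linear[OF g])
  interpret h: Vector_Spaces.linear cscale cscale h by (rule GL_linear[OF h])
  have inv: "inv_into ?V g (basis_vec i) = h (basis_vec i)" if "i \<in> {1..n}" for i
    using g basis_vec_coord_space[OF that]
    by (intro inv_into_f_eq) (auto simp: GL_def bij_betw_def gh GL_closed[OF h])
  have basis: "g (bilinear_of n C (h (basis_vec i)) (h (basis_vec j))) =
      bilinear_of n ?C' (basis_vec i) (basis_vec j)" if "i \<in> {1..n}" "j \<in> {1..n}" for i j
  proof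
    fix l
    have "g (bilinear_of n C (h (basis_vec i)) (h (basis_vec j))) \<in> ?V"
      by (rule GL_closed[OF g bilinear_of_closed[OF C]])
    then have "g (bilinear_of n C (h (basis_vec i)) (h (basis_vec j))) l = 0" if "l \<notin> {1..n}"
      using that by (simp add: coord_space_def)
    then show "g (bilinear_of n C (h (basis_vec i)) (h (basis_vec j))) l =
        bilinear_of n ?C' (basis_vec i) (basis_vec j) l"
      using that by (auto simp: bilinear_of_basis_vec change_basis_def inv Let_def)
  qed
  have sub: "cvec.subspace {u. g (bilinear_of n C (h u) (h v)) = bilinear_of n ?C' u v}"
    "cvec.subspace {u. g (bilinear_of n C (h v) (h u)) = bilinear_of n ?C' v u}" for v
    by (auto simp: cvec.subspace_def bilinear_of_linear g.add g.scale h.add h.scale g.zero h.zero)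
  have 1: "g (bilinear_of n C (h (basis_vec i)) (h v)) = bilinear_of n ?C' (basis_vec i) v"
    if "i \<in> {1..n}" "v \<in> ?V" for i v
    by (rule coord_space_subspace_induct[OF that(2) _ sub(2)]) (rule basis[OF that(1)])
  have 2: "g (bilinear_of n C (h u) (h v)) = bilinear_of n ?C' u v" if "u \<in> ?V" "v \<in> ?V" for u v
    by (rule coord_space_subspace_induct[OF that(1) _ sub(1)]) (rule 1[OF _ that(2)])
  show ?thesis unfolding intertwines_def
  proof (intro ballI)
    fix x y assume "x \<in> ?V" "y \<in> ?V"
    then show "g (bilinear_of n C x y) = bilinear_of n ?C' (g x) (g y)"
      using 2[of "g x" "g y"] by (simp add: GL_closed[OF g] hg)
  qed
qed

lemma intertwines_unique:
  assumes g: "g \<in> GL n" and "intertwines n g C C1" "intertwines n g C C2"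
    and "law_support n C1" "law_support n C2"
  shows "C1 = C2"
proof (rule law_support_eqI[of n])
  have surj: "g ` coord_space n = coord_space n" using g by (simp add: GL_def bij_betw_def)
  fix i j assume "i \<in> {1..n}" "j \<in> {1..n}"
  then have "basis_vec i \<in> g ` coord_space n" "basis_vec j \<in> g ` coord_space n"
    by (simp_all only: surj basis_vec_coord_space)
  then obtain x y where "x \<in> coord_space n" "y \<in> coord_space n" "basis_vec i = g x" "basis_vec j = g y"
    by blast
  then show "bilinear_of n C1 (basis_vec i) (basis_vec j) = bilinear_of n C2 (basis_vec i) (basis_vec j)"
    using assms(2,3) by (simp add: intertwines_def)
qed (use assms in auto)

lemma orbit_iff:
  assumes C: "law_support n C"
  shows "C' \<in> orbit n C \<longleftrightarrow> law_support n C' \<and> (\<exists>g\<in>GL n. intertwines n g C C')"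
proof
  assume "C' \<in> orbit n C"
  then obtain g where "g \<in> GL n" "C' = change_basis n g C" by (auto simp: orbit_def)
  then show "law_support n C' \<and> (\<exists>g\<in>GL n. intertwines n g C C')"
    using intertwines_change_basis[OF _ C] law_support_change_basis by blast
next
  assume "law_support n C' \<and> (\<exists>g\<in>GL n. intertwines n g C C')"
  then obtain g where g: "law_support n C'" "g \<in> GL n" "intertwines n g C C'" by blast
  have "C' = change_basis n g C"
    by (rule intertwines_unique[OF g(2,3) intertwines_change_basis[OF g(2) C] g(1)
          law_support_change_basis])
  then show "C' \<in> orbit n C" using g by (auto simp: orbit_def)
qed

lemma intertwines_comp:
  assumes "g \<in> GL n" "intertwines n g C C'" "intertwines n g' C' C''"
  shows "intertwines n (g' \<circ> g) C C''"
  using assms(2,3) GL_closed[OF assms(1)] by (simp add: intertwines_def)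

lemma GL_comp:
  assumes "g \<in> GL n" "g' \<in> GL n" shows "g' \<circ> g \<in> GL n"
  using assms bij_betw_trans[of g "coord_space n" "coord_space n" g' "coord_space n"]
    Vector_Spaces.linear_compose[of cscale cscale g cscale g'] by (simp add: GL_def)

lemma intertwines_inverse:
  assumes "intertwines n g C C'" "h \<in> GL n" "law_support n C"
    "\<And>x. x \<in> coord_space n \<Longrightarrow> h (g x) = x" "\<And>x. x \<in> coord_space n \<Longrightarrow> g (h x) = x"
  shows "intertwines n h C' C"
  unfolding intertwines_def
proof (intro ballI)
  fix x y assume "x \<in> coord_space n" "y \<in> coord_space n"
  then have "bilinear_of n C' x y = g (bilinear_of n C (h x) (h y))"
    using assms(1,5) GL_closed[OF assms(2)] unfolding intertwines_def by metis
  then show "h (bilinear_of n C' x y) = bilinear_of n C (h x) (h y)"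
    using assms(4) bilinear_of_closed[OF assms(3)] by simp
qed

lemma lie_laws_intertwines:
  assumes C: "C \<in> lie_laws n" and C': "law_support n C'" and g: "g \<in> GL n" "intertwines n g C C'"
  shows "C' \<in> lie_laws n"
proof -
  let ?V = "coord_space n"
  interpret g: Vector_Spaces.linear cscale cscale g by (rule GL_linear[OF g(1)])
  have V: "?V = g ` ?V" using g(1) by (simp add: GL_def bij_betw_def)
  have eq: "bilinear_of n C' (g x) (g y) = g (bilinear_of n C x y)" if "x \<in> ?V" "y \<in> ?V" for x y
    using g(2) that by (simp add: intertwines_def)
  have cl: "bilinear_of n C x y \<in> ?V" for x y
    using C by (simp add: lie_laws_iff bilinear_of_closed)
  have "jacobiator (bilinear_of n C') (g x) (g y) (g z) = g (jacobiator (bilinear_of n C) x y z)"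
    if "x \<in> ?V" "y \<in> ?V" "z \<in> ?V" for x y z
    using that by (simp add: jacobiator_def eq cl g.add)
  then have "jacobiator (bilinear_of n C') (g x) (g y) (g z) = 0"
    if "x \<in> ?V" "y \<in> ?V" "z \<in> ?V" for x y z
    using C that by (simp add: lie_laws_iff g.zero)
  then have "\<forall>x\<in>g ` ?V. \<forall>y\<in>g ` ?V. \<forall>z\<in>g ` ?V. jacobiator (bilinear_of n C') x y z = 0"
    by blast
  moreover have "\<forall>x\<in>g ` ?V. bilinear_of n C' x x = 0"
    using C by (auto simp: lie_laws_iff eq g.zero)
  ultimately show ?thesis unfolding lie_laws_iff using C' by (simp flip: V)
qed


section \<open>The structure constants of \<open>\<rr>\<close>\<close>

text \<open>Index expressions such as \<open>2*m + 2\<close> are to stay in this form.\<close>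

declare add_2_eq_Suc' [simp del] add_2_eq_Suc [simp del]

text \<open>The eigenvalue of ad X_theta on X_i. The final 0 is the value at theta itself, and the
  subtractions are exact for \<open>m \<ge> 4\<close>.\<close>

definition weight :: "nat \<Rightarrow> nat \<Rightarrow> nat" where
  "weight m i = (if i = 1 then 1 else if i \<le> 2*m then 2*m + i - 6
     else if i = 2*m + 1 then 6*m - 11 else if i = 2*m + 2 then 6*m - 10 else 0)"

text \<open>The brackets \<open>[w\<^sub>i, w\<^sub>j]\<close> of the law, for an arbitrary family \<open>w\<close> in place of the basis. The
  coefficients for \<open>2 \<le> i, j \<le> 2m\<close> are antisymmetric as they stand, so that \<open>i < j\<close> and \<open>i > j\<close> need
  not be distinguished.\<close>

definition r_table :: "nat \<Rightarrow> (nat \<Rightarrow> cvec) \<Rightarrow> nat \<Rightarrow> nat \<Rightarrow> cvec" where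
  "r_table m w i j =
    (if i = 2*m + 3 then cscale (of_nat (weight m j)) (w j)
     else if j = 2*m + 3 then cscale (- of_nat (weight m i)) (w i)
     else if i = 1 then (if 2 \<le> j \<and> j < 2*m \<or> j = 2*m + 1 then w (Suc j) else 0)
     else if j = 1 then (if 2 \<le> i \<and> i < 2*m \<or> i = 2*m + 1 then cscale (-1) (w (Suc i)) else 0)
     else if i > 2*m \<or> j > 2*m then 0
     else if i + j = 5 then cscale (5 - 2 * of_nat i) (w (2*m - 1))
     else if i + j = 6 then cscale (3 - of_nat i) (w (2*m))
     else if i + j = 2*m + 1 then cscale ((-1)^i) (w (2*m + 1))
     else if i + j = 2*m + 2 then cscale ((-1)^i * (of_nat m + 1 - of_nat i)) (w (2*m + 2))
     else 0)"

lemma sum_wedge: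
  "(\<Sum>j = p..q. c j * wedge j (N - j) a b) =
    (if a \<in> {p..q} \<and> b = N - a then c a else 0) - (if b \<in> {p..q} \<and> a = N - b then c b else 0)"
proof -
  have "(\<Sum>j = p..q. c j * wedge j (N - j) a b) =
      (\<Sum>j = p..q. if j = a then (if b = N - a then c a else 0) else 0) -
      (\<Sum>j = p..q. if j = b then (if a = N - b then c b else 0) else 0)"
  proof -
    have 1: "c j * (if a = j \<and> b = N - j then 1 else 0) =
        (if j = a then (if b = N - a then c a else 0) else 0)" for j
      by (cases "j = a") simp_all
    have 2: "c j * (if a = N - j \<and> b = j then 1 else 0) =
        (if j = b then (if a = N - b then c b else 0) else 0)" for j
      by (cases "j = b") simp_all
    show ?thesis by (simp only: wedge_def right_diff_distrib 1 2 sum_subtractf)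
  qed
  then show ?thesis
    by (simp only: sum.delta finite_atLeastAtMost) (simp only: if_if_eq_conj)
qed

lemma neg_one_power_add_odd: "a + b = 2 * m + 1 \<Longrightarrow> (-1::complex) ^ b = - ((-1) ^ a)"
  by (cases "even a"; cases "even b") (auto, presburger+)

lemma neg_one_power_add_even: "a + b = 2 * m + 2 \<Longrightarrow> (-1::complex) ^ b = (-1) ^ a"
  by (cases "even a"; cases "even b") (auto, presburger+)

text \<open>The form lists only indices up to m. For a > m the contribution comes from j = b with
  the opposite sign of the wedge, and (-1)^b = - (-1)^a as a + b is odd, so both halves carry the
  coefficient (-1)^a.\<close>

lemma sum_wedge_odd:
  assumes "m \<ge> 4"
  shows "(\<Sum>j = 2..m. (-1)^j * wedge j (2*m + 1 - j) a b) =
    (if 2 \<le> a \<and> 2 \<le> b \<and> a + b = 2*m + 1 then (-1)^a else 0)"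
proof (cases "2 \<le> a \<and> 2 \<le> b \<and> a + b = 2*m + 1")
  case True
  then show ?thesis unfolding sum_wedge using neg_one_power_add_odd[of a b m] by auto
next
  case False
  have "\<not> (a \<in> {2..m} \<and> b = 2*m + 1 - a)" "\<not> (b \<in> {2..m} \<and> a = 2*m + 1 - b)"
    using False assms by auto
  then show ?thesis by (simp only: sum_wedge False if_False diff_self)
qed

text \<open>For a > m + 1 the summand j = b contributes, and m + 1 - b = - (m + 1 - a) absorbs the
  sign of the wedge. For a = b = m + 1 no summand contributes, in agreement with the factor m + 1 -
  a = 0.\<close>

lemma sum_wedge_even:
  assumes "m \<ge> 4"
  shows "(\<Sum>j = 2..m. (-1)^j * (of_nat m + 1 - of_nat j) * wedge j (2*m + 2 - j) a b) =
    (if 2 \<le> a \<and> 2 \<le> b \<and> a + b = 2*m + 2 then (-1)^a * (of_nat m + 1 - of_nat a) else 0)"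
proof (cases "2 \<le> a \<and> 2 \<le> b \<and> a + b = 2*m + 2")
  case True
  have "of_nat b = (of_nat (2*m + 2) - of_nat a :: complex)"
    using True by (metis add_diff_cancel_left' of_nat_add)
  moreover have "a \<le> m \<or> a = m + 1 \<or> b \<le> m" using True by arith
  ultimately show ?thesis unfolding sum_wedge using True neg_one_power_add_even[of a b m]
    by (auto simp: algebra_simps)
next
  case False
  have "\<not> (a \<in> {2..m} \<and> b = 2*m + 2 - a)" "\<not> (b \<in> {2..m} \<and> a = 2*m + 2 - b)"
    using False assms by auto
  then show ?thesis by (simp only: sum_wedge False if_False diff_self)
qed

lemma wedge_antisym: "wedge a b i j = - wedge a b j i"
proof -
  have "(j = a \<and> i = b) = (i = b \<and> j = a)" "(j = b \<and> i = a) = (i = a \<and> j = b)" by blast+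
  then show ?thesis by (simp only: wedge_def minus_diff_eq)
qed

text \<open>Closed under all operations from which \<open>r_forms\<close> is built, so that
  \<open>r_law_antisym\<close> becomes a syntactic check.\<close>

definition antisymmetric :: "(nat \<Rightarrow> nat \<Rightarrow> complex) \<Rightarrow> bool" where
  "antisymmetric F \<longleftrightarrow> (\<forall>i j. F i j + F j i = 0)"

lemma antisymmetric_intros:
  "antisymmetric (\<lambda>i j. wedge a b i j)"
  "antisymmetric (\<lambda>i j. 0)"
  "antisymmetric F \<Longrightarrow> antisymmetric G \<Longrightarrow> antisymmetric (\<lambda>i j. F i j + G i j)"
  "antisymmetric F \<Longrightarrow> antisymmetric (\<lambda>i j. c * F i j)"
  "(\<And>k. k \<in> A \<Longrightarrow> antisymmetric (H k)) \<Longrightarrow> antisymmetric (\<lambda>i j. \<Sum>k\<in>A. H k i j)"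
  "(C \<Longrightarrow> antisymmetric F) \<Longrightarrow> (\<not> C \<Longrightarrow> antisymmetric G) \<Longrightarrow>
    antisymmetric (\<lambda>i j. if C then F i j else G i j)"
proof -
  show "antisymmetric (\<lambda>i j. wedge a b i j)"
    unfolding antisymmetric_def by (intro allI, subst wedge_antisym, rule left_minus)
  show "antisymmetric (\<lambda>i j. F i j + G i j)" if "antisymmetric F" "antisymmetric G"
    unfolding antisymmetric_def
  proof (intro allI)
    fix i j
    have "F i j + G i j + (F j i + G j i) = (F i j + F j i) + (G i j + G j i)" by simp
    also have "\<dots> = 0" using that by (simp only: antisymmetric_def add_0)
    finally show "F i j + G i j + (F j i + G j i) = 0" .
  qed
  show "antisymmetric F \<Longrightarrow> antisymmetric (\<lambda>i j. c * F i j)"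
    unfolding antisymmetric_def distrib_left[symmetric] by simp
  show "antisymmetric (\<lambda>i j. \<Sum>k\<in>A. H k i j)" if "\<And>k. k \<in> A \<Longrightarrow> antisymmetric (H k)"
    using that unfolding antisymmetric_def sum.distrib[symmetric] by (intro allI sum.neutral) auto
qed (auto simp: antisymmetric_def)

lemma r_law_antisym: "r_law m i j = - r_law m j i"
proof
  fix l
  have "antisymmetric (r_forms m l)"
    unfolding r_forms_def Let_def by (intro antisymmetric_intros)
  then show "r_law m i j l = (- r_law m j i) l"
    by (simp add: r_law_def law_of_forms_def antisymmetric_def eq_neg_iff_add_eq_0)
qed

text \<open>The case distinction in \<open>r_forms\<close> is resolved here once for each
  coordinate, with the two long sums already evaluated.\<close>

lemma r_law_coord:
  assumes m: "m \<ge> 4"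
  shows "r_law m i j 1 = wedge (2*m+3) 1 i j"
    and "r_law m i j 2 = (2 * of_nat m - 4) * wedge (2*m+3) 2 i j"
    and "l \<in> {3..2*m-2} \<Longrightarrow> r_law m i j l =
      wedge 1 (l-1) i j + (2 * of_nat m - 6 + of_nat l) * wedge (2*m+3) l i j"
    and "r_law m i j (2*m-1) =
      wedge 1 (2*m-2) i j + wedge 2 3 i j + (4 * of_nat m - 7) * wedge (2*m+3) (2*m-1) i j"
    and "r_law m i j (2*m) =
      wedge 1 (2*m-1) i j + wedge 2 4 i j + (4 * of_nat m - 6) * wedge (2*m+3) (2*m) i j"
    and "r_law m i j (2*m+1) = (if 2 \<le> i \<and> 2 \<le> j \<and> i + j = 2*m + 1 then (-1)^i else 0)
      + (6 * of_nat m - 11) * wedge (2*m+3) (2*m+1) i j"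
    and "r_law m i j (2*m+2) = wedge 1 (2*m+1) i j
      + (if 2 \<le> i \<and> 2 \<le> j \<and> i + j = 2*m + 2 then (-1)^i * (of_nat m + 1 - of_nat i) else 0)
      + (6 * of_nat m - 10) * wedge (2*m+3) (2*m+2) i j"
    and "l = 0 \<or> l > 2*m+2 \<Longrightarrow> r_law m i j l = 0"
proof -
  note D = r_law_def law_of_forms_def r_forms_def Let_def sum_wedge_odd[OF m] sum_wedge_even[OF m]
    if_True if_False simp_thms
  show "r_law m i j 1 = wedge (2*m+3) 1 i j" by (simp only: D)
  show "r_law m i j 2 = (2 * of_nat m - 4) * wedge (2*m+3) 2 i j"
  proof -
    have n: "(2::nat) \<noteq> 1"
      using m by auto
    show ?thesis by (simp only: D n)
  qed
  show "r_law m i j l =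
      wedge 1 (l-1) i j + (2 * of_nat m - 6 + of_nat l) * wedge (2*m+3) l i j" if that: "l \<in> {3..2*m-2}"
  proof -
    have n: "l \<noteq> 1" "l \<noteq> 2"
      using m that by auto
    show ?thesis by (simp only: D n that)
  qed
  show "r_law m i j (2*m-1) =
      wedge 1 (2*m-2) i j + wedge 2 3 i j + (4 * of_nat m - 7) * wedge (2*m+3) (2*m-1) i j"
  proof -
    have n: "2*m-1 \<noteq> 1" "2*m-1 \<noteq> 2" "2*m-1 \<notin> {3..2*m-2}"
      using m by auto
    show ?thesis by (simp only: D n)
  qed
  show "r_law m i j (2*m) =
      wedge 1 (2*m-1) i j + wedge 2 4 i j + (4 * of_nat m - 6) * wedge (2*m+3) (2*m) i j"
  proof -
    have n: "2*m \<noteq> 1" "2*m \<noteq> 2" "2*m \<notin> {3..2*m-2}" "2*m \<noteq> 2*m-1"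
      using m by auto
    show ?thesis by (simp only: D n)
  qed
  show "r_law m i j (2*m+1) = (if 2 \<le> i \<and> 2 \<le> j \<and> i + j = 2*m + 1 then (-1)^i else 0)
      + (6 * of_nat m - 11) * wedge (2*m+3) (2*m+1) i j"
  proof -
    have n: "2*m+1 \<noteq> 1" "2*m+1 \<noteq> 2" "2*m+1 \<notin> {3..2*m-2}" "2*m+1 \<noteq> 2*m-1" "2*m+1 \<noteq> 2*m"
      using m by auto
    show ?thesis by (simp only: D n)
  qed
  show "r_law m i j (2*m+2) = wedge 1 (2*m+1) i j
      + (if 2 \<le> i \<and> 2 \<le> j \<and> i + j = 2*m + 2 then (-1)^i * (of_nat m + 1 - of_nat i) else 0)
      + (6 * of_nat m - 10) * wedge (2*m+3) (2*m+2) i j"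
  proof -
    have n: "2*m+2 \<noteq> 1" "2*m+2 \<noteq> 2" "2*m+2 \<notin> {3..2*m-2}" "2*m+2 \<noteq> 2*m-1" "2*m+2 \<noteq> 2*m" "2*m+2 \<noteq> 2*m+1"
      using m by auto
    show ?thesis by (simp only: D n)
  qed
  show "r_law m i j l = 0" if that: "l = 0 \<or> l > 2*m+2"
  proof -
    have n: "l \<noteq> 1" "l \<noteq> 2" "l \<notin> {3..2*m-2}" "l \<noteq> 2*m-1" "l \<noteq> 2*m" "l \<noteq> 2*m+1" "l \<noteq> 2*m+2"
      using m that by auto
    show ?thesis by (simp only: D n )
  qed
qed

lemma coord_cases:
  fixes l m :: nat
  obtains "l = 1" | "l = 2" | "l \<in> {3..2*m-2}" | "l = 2*m-1" | "l = 2*m" | "l = 2*m+1" | "l = 2*m+2"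
    | "l = 0 \<or> l > 2*m+2"
  by fastforce

lemma wedge_nonzero: "wedge a b i j \<noteq> 0 \<Longrightarrow> i = a \<and> j = b \<or> i = b \<and> j = a"
  by (auto simp: wedge_def split: if_splits)

lemma law_support_r_law:
  assumes m: "m \<ge> 4" shows "law_support (2*m + 3) (r_law m)"
  unfolding law_support_def
proof (intro allI impI)
  fix i j l assume nz: "r_law m i j l \<noteq> 0"
  show "i \<in> {1..2*m+3} \<and> j \<in> {1..2*m+3} \<and> l \<in> {1..2*m+3}"
  proof (cases rule: coord_cases[where l = l and m = m])
    case 1
    then have "wedge (2*m+3) 1 i j \<noteq> 0" using nz by (auto simp: r_law_coord[OF m])
    then show ?thesis using 1 m by (auto dest!: wedge_nonzero)
  next
    case 2
    then have "wedge (2*m+3) 2 i j \<noteq> 0" using nz by (auto simp: r_law_coord[OF m])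
    then show ?thesis using 2 m by (auto dest!: wedge_nonzero)
  next
    case 3
    then have "wedge 1 (l-1) i j \<noteq> 0 \<or> wedge (2*m+3) l i j \<noteq> 0"
      using nz by (auto simp: r_law_coord[OF m])
    then show ?thesis using 3 m by (auto dest!: wedge_nonzero)
  next
    case 4
    then have "wedge 1 (2*m-2) i j \<noteq> 0 \<or> wedge 2 3 i j \<noteq> 0 \<or> wedge (2*m+3) (2*m-1) i j \<noteq> 0"
      using nz by (auto simp: r_law_coord[OF m])
    then show ?thesis using 4 m by (auto dest!: wedge_nonzero)
  next
    case 5
    then have "wedge 1 (2*m-1) i j \<noteq> 0 \<or> wedge 2 4 i j \<noteq> 0 \<or> wedge (2*m+3) (2*m) i j \<noteq> 0"
      using nz by (auto simp: r_law_coord[OF m])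
    then show ?thesis using 5 m by (auto dest!: wedge_nonzero)
  next
    case 6
    then have "wedge (2*m+3) (2*m+1) i j \<noteq> 0 \<or> 2 \<le> i \<and> 2 \<le> j \<and> i + j = 2*m + 1"
      using nz by (auto simp: r_law_coord[OF m] split: if_splits)
    then show ?thesis using 6 m by (auto dest!: wedge_nonzero)
  next
    case 7
    then have "wedge 1 (2*m+1) i j \<noteq> 0 \<or> wedge (2*m+3) (2*m+2) i j \<noteq> 0 \<or>
        2 \<le> i \<and> 2 \<le> j \<and> i + j = 2*m + 2"
      using nz by (auto simp: r_law_coord[OF m] split: if_splits)
    then show ?thesis using 7 m by (auto dest!: wedge_nonzero)
  next
    case 8
    then show ?thesis using nz by (simp add: r_law_coord[OF m])
  qed
qed

lemma weight_simps:
  assumes "m \<ge> 4"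
  shows "weight m 1 = 1" "j \<in> {2..2*m} \<Longrightarrow> weight m j = 2*m + j - 6"
    "weight m (2*m+1) = 6*m - 11" "weight m (2*m+2) = 6*m - 10" "weight m (2*m+3) = 0"
  using assms by (auto simp: weight_def)

lemma r_table_theta_left: "r_table m w (2*m+3) j = cscale (of_nat (weight m j)) (w j)"
  by (simp add: r_table_def)

lemma r_table_theta_right:
  "m \<ge> 4 \<Longrightarrow> r_table m w i (2*m+3) = cscale (- of_nat (weight m i)) (w i)"
  by (cases "i = 2*m+3") (simp_all add: r_table_def weight_simps)

lemma r_table_one_left:
  assumes "j \<in> {1..2*m+2}"
  shows "r_table m w 1 j = (if 2 \<le> j \<and> j < 2*m \<or> j = 2*m + 1 then w (Suc j) else 0)"
  using assms by (auto simp: r_table_def)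

lemma r_table_one_right:
  assumes "i \<in> {2..2*m+2}"
  shows "r_table m w i 1 = (if i < 2*m \<or> i = 2*m + 1 then cscale (-1) (w (Suc i)) else 0)"
  using assms by (auto simp: r_table_def)

lemma r_table_high:
  assumes "i \<in> {2..2*m+2}" "j \<in> {2..2*m+2}" "i > 2*m \<or> j > 2*m"
  shows "r_table m w i j = 0"
  using assms by (auto simp: r_table_def)

lemma r_table_low:
  assumes m: "m \<ge> 4" and "i \<in> {2..2*m}" "j \<in> {2..2*m}"
  shows "i + j = 5 \<Longrightarrow> r_table m w i j = cscale (5 - 2 * of_nat i) (w (2*m - 1))"
    and "i + j = 6 \<Longrightarrow> r_table m w i j = cscale (3 - of_nat i) (w (2*m))"
    and "i + j = 2*m + 1 \<Longrightarrow> r_table m w i j = cscale ((-1)^i) (w (2*m + 1))"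
    and "i + j = 2*m + 2 \<Longrightarrow> r_table m w i j = cscale ((-1)^i * (of_nat m + 1 - of_nat i)) (w (2*m + 2))"
    and "i + j \<notin> {5, 6, 2*m + 1, 2*m + 2} \<Longrightarrow> r_table m w i j = 0"
proof -
  have "i \<noteq> 2*m+3" "j \<noteq> 2*m+3" "i \<noteq> 1" "j \<noteq> 1" "\<not> (i > 2*m \<or> j > 2*m)" using assms by auto
  note eq = r_table_def if_not_P[OF this(1)] if_not_P[OF this(2)] if_not_P[OF this(3)]
    if_not_P[OF this(4)] if_not_P[OF this(5)]
  have "2*m + 1 \<noteq> 5" "2*m + 1 \<noteq> 6" "2*m + 2 \<noteq> 5" "2*m + 2 \<noteq> 6" using m by auto
  then show "i + j = 5 \<Longrightarrow> r_table m w i j = cscale (5 - 2 * of_nat i) (w (2*m - 1))"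
    and "i + j = 6 \<Longrightarrow> r_table m w i j = cscale (3 - of_nat i) (w (2*m))"
    and "i + j = 2*m + 1 \<Longrightarrow> r_table m w i j = cscale ((-1)^i) (w (2*m + 1))"
    and "i + j = 2*m + 2 \<Longrightarrow> r_table m w i j = cscale ((-1)^i * (of_nat m + 1 - of_nat i)) (w (2*m + 2))"
    and "i + j \<notin> {5, 6, 2*m + 1, 2*m + 2} \<Longrightarrow> r_table m w i j = 0"
    unfolding eq by simp_all
qed

lemma index_sum_cases:
  obtains "s = 5" | "s = 6" | "s = 2*m + 1" | "s = 2*m + 2" | "s \<notin> {5, 6, 2*m + 1, 2*m + 2 :: nat}"
  by blast

lemma wedge_simps:
  "i \<noteq> a \<Longrightarrow> i \<noteq> b \<Longrightarrow> wedge a b i j = 0"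
  "i \<noteq> a \<Longrightarrow> j \<noteq> a \<Longrightarrow> wedge a b i j = 0"
  "a \<noteq> b \<Longrightarrow> wedge a b a j = (if j = b then 1 else 0)"
  by (auto simp: wedge_def)

lemma r_law_theta:
  assumes m: "m \<ge> 4" and j: "j \<in> {1..2*m+3}"
  shows "r_law m (2*m+3) j = cscale (of_nat (weight m j)) (basis_vec j)"
proof
  fix l
  let ?\<theta> = "2*m+3"
  have w: "wedge ?\<theta> k ?\<theta> j = (if j = k then 1 else 0)" if "k \<le> 2*m+2" for k
    using that by (intro wedge_simps(3)) auto
  have w0: "wedge 1 k ?\<theta> j = 0" if "k \<le> 2*m+2" for k
    using that by (intro wedge_simps(1)) auto
  have w': "wedge 2 3 ?\<theta> j = 0" "wedge 2 4 ?\<theta> j = 0"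
    using m by (auto intro!: wedge_simps(1))
  have "r_law m ?\<theta> j l = (if j = l then of_nat (weight m l) else 0)"
  proof (cases rule: coord_cases[where l = l and m = m])
    case 1
    then show ?thesis by (simp add: r_law_coord(1)[OF m] w weight_simps(1)[OF m])
  next
    case 2
    then show ?thesis using m
      by (simp add: r_law_coord(2)[OF m] w weight_simps(2)[OF m, of 2] of_nat_diff)
  next
    case 3
    then have l: "l \<in> {2..2*m}" "l - 1 \<le> 2*m+2" "l \<le> 2*m+2" by auto
    show ?thesis using m
      by (simp add: r_law_coord(3)[OF m 3] w[OF l(3)] w0[OF l(2)] weight_simps(2)[OF m l(1)] of_nat_diff)
  next
    case 4
    have l: "2*m-1 \<in> {2..2*m}" "2*m-1 \<le> 2*m+2" "2*m-2 \<le> 2*m+2" "2*m + (2*m-1) - 6 = 4*m - 7"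
      using m by auto
    show ?thesis using m unfolding 4
      by (simp add: r_law_coord(4)[OF m] w[OF l(2)] w0[OF l(3)] w' weight_simps(2)[OF m l(1)] l(4) of_nat_diff)
  next
    case 5
    have l: "2*m \<in> {2..2*m}" "2*m \<le> 2*m+2" "2*m-1 \<le> 2*m+2" "2*m + 2*m - 6 = 4*m - 6"
      using m by auto
    show ?thesis using m unfolding 5
      by (simp add: r_law_coord(5)[OF m] w[OF l(2)] w0[OF l(3)] w' weight_simps(2)[OF m l(1)] l(4) of_nat_diff)
  next
    case 6
    have "\<not> (2 \<le> ?\<theta> \<and> 2 \<le> j \<and> ?\<theta> + j = 2*m + 1)" by auto
    then show ?thesis using m unfolding 6
      by (simp add: r_law_coord(6)[OF m] w weight_simps(3)[OF m] of_nat_diff)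
  next
    case 7
    have "\<not> (2 \<le> ?\<theta> \<and> 2 \<le> j \<and> ?\<theta> + j = 2*m + 2)" by auto
    then show ?thesis using m unfolding 7
      by (simp add: r_law_coord(7)[OF m] w w0 weight_simps(4)[OF m] of_nat_diff)
  next
    case 8
    then have "weight m l = 0" if "j = l" using j that by (auto simp: weight_def)
    then show ?thesis using 8 by (simp add: r_law_coord(8)[OF m])
  qed
  then show "r_law m ?\<theta> j l = cscale (of_nat (weight m j)) (basis_vec j) l"
    by (auto simp: basis_vec_def)
qed

lemma r_law_one:
  assumes m: "m \<ge> 4" and j: "j \<in> {1..2*m+2}"
  shows "r_law m 1 j = (if 2 \<le> j \<and> j < 2*m \<or> j = 2*m + 1 then basis_vec (Suc j) else 0)"
proof
  fix l
  have w: "wedge (2*m+3) k 1 j = 0" for k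
    using j by (intro wedge_simps(2)) auto
  have w1: "wedge 1 k 1 j = (if j = k then 1 else 0)" if "k \<noteq> 1" for k
    using that by (intro wedge_simps(3)) auto
  have w': "wedge 2 3 1 j = 0" "wedge 2 4 1 j = 0"
    by (auto intro!: wedge_simps(1))
  note c = r_law_coord[OF m]
  show "r_law m 1 j l = (if 2 \<le> j \<and> j < 2*m \<or> j = 2*m + 1 then basis_vec (Suc j) else 0) l"
  proof (cases rule: coord_cases[where l = l and m = m])
    case 1
    then show ?thesis using m by (auto simp: c(1) w basis_vec_def)
  next
    case 2
    then show ?thesis using m by (auto simp: c(2) w basis_vec_def)
  next
    case 3
    then have "l - 1 \<noteq> 1" by auto
    then show ?thesis using 3 m by (auto simp: c(3) w w1 basis_vec_def)
  next
    case 4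
    have "2*m - 2 \<noteq> 1" using m by auto
    then show ?thesis unfolding 4 using m by (auto simp: c(4) w w1 w' basis_vec_def)
  next
    case 5
    have "2*m - 1 \<noteq> 1" using m by auto
    then show ?thesis unfolding 5 using m by (auto simp: c(5) w w1 w' basis_vec_def)
  next
    case 6
    then show ?thesis using m by (auto simp: c(6) w basis_vec_def)
  next
    case 7
    then show ?thesis using m by (auto simp: c(7) w w1 basis_vec_def)
  next
    case 8
    then show ?thesis using j by (auto simp: c(8) basis_vec_def)
  qed
qed

lemma r_law_ge_2:
  assumes m: "m \<ge> 4" and i: "i \<in> {2..2*m+2}" and j: "j \<in> {2..2*m+2}"
  shows "r_law m i j = r_table m basis_vec i j"
proof -
  \<comment> \<open>The closed form 5 - 2i takes the values 1 and -1 at i = 2 and i = 3; likewise 3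
    - i below takes the values 1, 0, -1 at i = 2, 3, 4. This is how \<open>r_table\<close> avoids
    distinguishing i < j from i > j.\<close>
  have w23: "wedge 2 3 i j = (if i + j = 5 then 5 - 2 * of_nat i else 0)"
  proof (cases "i + j = 5")
    case True
    then consider "i = 2" "j = 3" | "i = 3" "j = 2" using i j by fastforce
    then show ?thesis by cases (simp_all add: wedge_def)
  qed (auto simp: wedge_def)
  have w24: "wedge 2 4 i j = (if i + j = 6 then 3 - of_nat i else 0)"
  proof (cases "i + j = 6")
    case True
    then consider "i = 2" "j = 4" | "i = 3" "j = 3" | "i = 4" "j = 2" using i j by fastforce
    then show ?thesis by cases (simp_all add: wedge_def)
  qed (auto simp: wedge_def)
  have w: "wedge 1 k i j = 0" "wedge (2*m+3) k i j = 0" for k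
    using i j by (auto simp: wedge_def)
  have ij: "2 \<le> i" "2 \<le> j" using i j by auto
  have eq: "r_law m i j l = (if l = 2*m - 1 then wedge 2 3 i j else if l = 2*m then wedge 2 4 i j
      else if l = 2*m+1 then (if i + j = 2*m + 1 then (-1)^i else 0)
      else if l = 2*m+2 then (if i + j = 2*m + 2 then (-1)^i * (of_nat m + 1 - of_nat i) else 0) else 0)" for l
  proof -
    note S = w ij mult_zero_right add_0 add_0_right if_True if_False simp_thms and c = r_law_coord[OF m]
    show ?thesis
    proof (cases rule: coord_cases[where l = l and m = m])
      case 1
      have n: "(1::nat) \<noteq> 2*m-1" "(1::nat) \<noteq> 2*m" "(1::nat) \<noteq> 2*m+1" "(1::nat) \<noteq> 2*m+2"
        using m by auto
      show ?thesis unfolding 1 by (simp only: c(1) S n)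
    next
      case 2
      have n: "(2::nat) \<noteq> 2*m-1" "(2::nat) \<noteq> 2*m" "(2::nat) \<noteq> 2*m+1" "(2::nat) \<noteq> 2*m+2"
        using m by auto
      show ?thesis unfolding 2 by (simp only: c(2) S n)
    next
      case 3
      have n: "l \<noteq> 2*m-1" "l \<noteq> 2*m" "l \<noteq> 2*m+1" "l \<noteq> 2*m+2"
        using m 3 by auto
      show ?thesis by (simp only: c(3)[OF 3] S n)
    next
      case 4
      show ?thesis unfolding 4 by (simp only: c(4) S)
    next
      case 5
      have n: "2*m \<noteq> 2*m-1"
        using m by auto
      show ?thesis unfolding 5 by (simp only: c(5) S n)
    next
      case 6
      have n: "2*m+1 \<noteq> 2*m-1" "2*m+1 \<noteq> 2*m"
        using m by auto
      show ?thesis unfolding 6 by (simp only: c(6) S n)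
    next
      case 7
      have n: "2*m+2 \<noteq> 2*m-1" "2*m+2 \<noteq> 2*m" "2*m+2 \<noteq> 2*m+1"
        using m by auto
      show ?thesis unfolding 7 by (simp only: c(7) S n)
    next
      case 8
      have n: "l \<noteq> 2*m-1" "l \<noteq> 2*m" "l \<noteq> 2*m+1" "l \<noteq> 2*m+2"
        using m 8 by auto
      show ?thesis by (simp only: c(8)[OF 8] S n)
    qed
  qed
  have ne: "2*m - 1 \<noteq> 2*m" "2*m - 1 \<noteq> 2*m+1" "2*m - 1 \<noteq> 2*m+2" using m by auto
  show ?thesis
  proof (cases "i > 2*m \<or> j > 2*m")
    case True
    then have *: "i + j > 2*m + 2" using i j by auto
    have "wedge 2 3 i j = 0" "wedge 2 4 i j = 0" "i + j \<noteq> 2*m + 1" "i + j \<noteq> 2*m + 2"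
      using * m by (simp_all add: w23 w24)
    then show ?thesis unfolding r_table_high[OF i j True] by (auto simp: eq fun_eq_iff)
  next
    case False
    then have low: "i \<in> {2..2*m}" "j \<in> {2..2*m}" using i j by auto
    note tab = r_table_low[OF m low]
    have nm: "2*m + 1 \<noteq> 5" "2*m + 1 \<noteq> 6" "2*m + 2 \<noteq> 5" "2*m + 2 \<noteq> 6" using m by auto
    show ?thesis
    proof (cases rule: index_sum_cases[where s = "i + j" and m = m])
      case 1 then show ?thesis using nm unfolding fun_eq_iff eq w23 w24 tab(1)[OF 1]
        by (auto simp: basis_vec_def)
    next
      case 2 then show ?thesis using nm ne unfolding fun_eq_iff eq w23 w24 tab(2)[OF 2]
        by (auto simp: basis_vec_def)
    next
      case 3 then show ?thesis using nm ne unfolding fun_eq_iff eq w23 w24 tab(3)[OF 3]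
        by (auto simp: basis_vec_def)
    next
      case 4 then show ?thesis using nm ne unfolding fun_eq_iff eq w23 w24 tab(4)[OF 4]
        by (auto simp: basis_vec_def)
    next
      case 5 then show ?thesis unfolding fun_eq_iff eq w23 w24 tab(5)[OF 5] by auto
    qed
  qed
qed

lemma index_pair_cases:
  assumes "i \<in> {1..2*m+3::nat}" "j \<in> {1..2*m+3}"
  obtains (theta1) "i = 2*m+3" | (theta2) "i \<noteq> 2*m+3" "j = 2*m+3" | (one1) "i = 1" "j \<in> {1..2*m+2}"
    | (one2) "i \<in> {2..2*m+2}" "j = 1" | (high) "i \<in> {2..2*m+2}" "j \<in> {2..2*m+2}" "i > 2*m \<or> j > 2*m"
    | (low) "i \<in> {2..2*m}" "j \<in> {2..2*m}"
proof -
  have *: "k = 2*m+3 \<or> k = 1 \<or> k \<in> {2..2*m+2} \<and> k > 2*m \<or> k \<in> {2..2*m}" if "k \<in> {1..2*m+3}" for k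
    using that by auto
  have "j \<in> {1..2*m+2}" if "j \<noteq> 2*m+3" using that assms(2) by auto
  moreover have "k \<in> {2..2*m+2}" if "k \<in> {2..2*m}" for k using that by auto
  ultimately show ?thesis using that *[OF assms(1)] *[OF assms(2)] by metis
qed

lemma r_law_eq_table:
  assumes m: "m \<ge> 4" and i: "i \<in> {1..2*m+3}" and j: "j \<in> {1..2*m+3}"
  shows "r_law m i j = r_table m basis_vec i j"
  using i j
proof (cases rule: index_pair_cases)
  case theta1
  then show ?thesis using r_law_theta[OF m j] by (simp add: r_table_theta_left)
next
  case theta2
  then show ?thesis using r_law_theta[OF m i] r_law_antisym[of m i j]
    by (auto simp: r_table_theta_right[OF m] fun_eq_iff)
next
  case one1
  then show ?thesis using r_law_one[OF m, of j] by (auto simp: r_table_one_left)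
next
  case one2
  then show ?thesis using r_law_one[OF m, of i] r_law_antisym[of m i j] m
    by (auto simp: r_table_one_right fun_eq_iff)
qed (auto intro!: r_law_ge_2[OF m])

lemma r_bracket_basis_vec:
  assumes "m \<ge> 4" "i \<in> {1..2*m+3}" "j \<in> {1..2*m+3}"
  shows "r_bracket m (basis_vec i) (basis_vec j) = r_table m basis_vec i j"
  using assms by (simp only: r_bracket_def bilinear_of_basis_vec r_law_eq_table)

text \<open>The law is monomial and graded by \<open>weight\<close>. This alone yields the Jacobi
  identity for triples containing X_theta, the filtration by weight, and the compatibility of
  \<open>r_table\<close> with linear maps. For a zero product the index k is a dummy.\<close>

lemma r_table_monomial:
  assumes m: "m \<ge> 4" and i: "i \<in> {1..2*m+3}" and j: "j \<in> {1..2*m+3}"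
  obtains k c where "k \<in> {1..2*m+3}" "\<And>w. r_table m w i j = cscale c (w k)"
    "c \<noteq> 0 \<Longrightarrow> weight m k = weight m i + weight m j"
proof -
  note result = that
  have z: "cscale 0 x = 0" "cscale 1 x = x" for x by (simp_all add: cscale_def fun_eq_iff)
  have zero: thesis if "\<And>w. r_table m w i j = 0"
    using that m by (intro result[of 1 0]) (auto simp: z)
  from i j show ?thesis
  proof (cases rule: index_pair_cases)
    case theta1
    show ?thesis
      by (rule result[of j "of_nat (weight m j)"]) (use j m theta1 in \<open>auto simp: r_table_theta_left weight_simps\<close>)
  next
    case theta2
    show ?thesis
      by (rule result[of i "- of_nat (weight m i)"]) (use i m theta2 in \<open>auto simp: r_table_theta_right weight_simps\<close>)
  next
    case one1
    show ?thesis
    proof (cases "2 \<le> j \<and> j < 2*m \<or> j = 2*m + 1")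
      case True
      with one1 m show ?thesis
        by (intro result[of "Suc j" 1]) (auto simp: r_table_one_left z weight_def)
    next
      case False
      with one1 show ?thesis by (intro zero) (auto simp: r_table_one_left)
    qed
  next
    case one2
    show ?thesis
    proof (cases "i < 2*m \<or> i = 2*m + 1")
      case True
      with one2 m show ?thesis
        by (intro result[of "Suc i" "-1"]) (auto simp: r_table_one_right z weight_def)
    next
      case False
      with one2 m show ?thesis by (intro zero) (auto simp: r_table_one_right)
    qed
  next
    case high
    then show ?thesis by (intro zero r_table_high)
  next
    case low
    note tab = r_table_low[OF m low]
    \<comment> \<open>The index sums 5, 6, 2m+1 and 2m+2 give exactly the weights 4m-7, 4m-6, 6m-11
      and 6m-10 of X_(2m-1), X_(2m), X_(2m+1) and X_(2m+2).\<close>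
    have wt: "weight m i + weight m j = 4*m + (i + j) - 12"
      using low m by (simp add: weight_simps)
    show ?thesis
    proof (cases rule: index_sum_cases[where s = "i + j" and m = m])
      case 1
      show ?thesis by (rule result[OF _ tab(1)[OF 1]]) (use m 1 in \<open>auto simp: wt weight_simps\<close>)
    next
      case 2
      show ?thesis by (rule result[OF _ tab(2)[OF 2]]) (use m 2 in \<open>auto simp: wt weight_simps\<close>)
    next
      case 3
      show ?thesis by (rule result[OF _ tab(3)[OF 3]]) (use m 3 in \<open>auto simp: wt weight_simps\<close>)
    next
      case 4
      show ?thesis by (rule result[OF _ tab(4)[OF 4]]) (use m 4 in \<open>auto simp: wt weight_simps\<close>)
    next
      case 5
      show ?thesis by (rule zero[OF tab(5)[OF 5]])
    qed
  qed
qed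


section \<open>The Jacobi identity\<close>

lemma cscale_simps: "cscale 0 x = 0" "cscale 1 x = x" "cscale c 0 = 0" "cscale a (cscale b x) = cscale (a * b) x"
  by (simp_all add: cscale_def fun_eq_iff)

lemma r_bracket_linear:
  "r_bracket m (x + y) z = r_bracket m x z + r_bracket m y z"
  "r_bracket m z (x + y) = r_bracket m z x + r_bracket m z y"
  "r_bracket m (cscale c x) z = cscale c (r_bracket m x z)"
  "r_bracket m z (cscale c x) = cscale c (r_bracket m z x)"
  "r_bracket m 0 z = 0" "r_bracket m z 0 = 0"
  by (simp_all add: r_bracket_def bilinear_of_linear)

lemma cscale_minus_one: "cscale (-1) x = - x"
  by (simp add: cscale_def fun_eq_iff)

lemma r_bracket_minus_right: "r_bracket m x (- y) = - r_bracket m x y"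
  using r_bracket_linear(4)[of m x "-1" y] by (simp only: cscale_minus_one)

lemma r_bracket_antisym: "r_bracket m x y = - r_bracket m y x"
proof
  fix l
  have "r_bracket m x y l = (\<Sum>i=1..2*m+3. \<Sum>j=1..2*m+3. - (y j * x i * r_law m j i l))"
    unfolding r_bracket_def bilinear_of_def
    by (intro sum.cong refl) (subst r_law_antisym, simp)
  also have "\<dots> = - r_bracket m y x l"
    unfolding r_bracket_def bilinear_of_def sum_negf by (subst sum.swap) simp
  finally show "r_bracket m x y l = (- r_bracket m y x) l" by simp
qed

lemma jacobiator_rotate: "jacobiator br y z x = jacobiator br x y z"
  by (simp add: jacobiator_def add.commute add.left_commute)

lemma jacobiator_r_swap: "jacobiator (r_bracket m) y x z = - jacobiator (r_bracket m) x y z"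
proof -
  have neg: "r_bracket m a (r_bracket m b c) = - r_bracket m a (r_bracket m c b)" for a b c
    by (subst r_bracket_antisym[of m b c]) (rule r_bracket_minus_right)
  show ?thesis unfolding jacobiator_def by (subst (1 2 3) neg) simp
qed

text \<open>ad X_theta multiplies [X_i, X_j] by the sum of the two weights, which is the derivation
  property.\<close>

lemma jacobiator_r_theta:
  assumes m: "m \<ge> 4" and i: "i \<in> {1..2*m+3}" and j: "j \<in> {1..2*m+3}"
  shows "jacobiator (r_bracket m) (basis_vec (2*m+3)) (basis_vec i) (basis_vec j) = 0"
proof -
  have t: "2*m+3 \<in> {1..2*m+3}" by simp
  obtain k c where k: "k \<in> {1..2*m+3}" "\<And>w. r_table m w i j = cscale c (w k)"
    "c \<noteq> 0 \<Longrightarrow> weight m k = weight m i + weight m j" using r_table_monomial[OF m i j] by metis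
  have ij: "r_bracket m (basis_vec i) (basis_vec j) = cscale c (basis_vec k)"
    by (simp only: r_bracket_basis_vec[OF m i j] k(2))
  have ji: "r_bracket m (basis_vec j) (basis_vec i) = cscale (- c) (basis_vec k)"
    by (subst r_bracket_antisym) (simp add: ij cscale_def fun_eq_iff)
  have "r_bracket m (basis_vec (2*m+3)) (cscale c (basis_vec k)) =
      cscale (c * (of_nat (weight m i) + of_nat (weight m j))) (basis_vec k)"
    using k(3) by (cases "c = 0")
      (simp_all add: r_bracket_linear r_bracket_basis_vec[OF m t k(1)] r_table_theta_left cscale_simps)
  moreover have "r_bracket m (basis_vec i) (r_bracket m (basis_vec j) (basis_vec (2*m+3))) =
      cscale (- of_nat (weight m j) * c) (basis_vec k)"
    by (simp only: r_bracket_basis_vec[OF m j t] r_table_theta_right[OF m] r_bracket_linear ij cscale_simps)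
  moreover have "r_bracket m (basis_vec j) (r_bracket m (basis_vec (2*m+3)) (basis_vec i)) =
      cscale (of_nat (weight m i) * - c) (basis_vec k)"
    by (simp only: r_bracket_basis_vec[OF m t i] r_table_theta_left r_bracket_linear ji cscale_simps)
  ultimately show ?thesis
    by (simp only: jacobiator_def ij) (simp add: cscale_def fun_eq_iff algebra_simps)
qed

text \<open>X_1 raises an index by one, so table entries of index sum i + j are compared with
  entries of index sum i + j + 1. The alternating signs along the sum 2m + 1 and the factors m + 1 -
  i along 2m + 2, which drop by one at each step, are made for this.\<close>

lemma r_bracket_one_derivation:
  assumes m: "m \<ge> 4" and i: "i \<in> {2..2*m+2}" and j: "j \<in> {2..2*m+2}"
  defines "br \<equiv> r_bracket m" and "e \<equiv> basis_vec"
  shows "br (e 1) (br (e i) (e j)) = br (br (e 1) (e i)) (e j) + br (e i) (br (e 1) (e j))"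
proof -
  have one: "br (e 1) (e k) = (if k < 2*m \<or> k = 2*m + 1 then e (Suc k) else 0)" if "k \<in> {2..2*m+2}" for k
    using that by (simp add: br_def e_def r_bracket_basis_vec[OF m] r_table_one_left)
  have mem: "2*m-1 \<in> {2..2*m+2}" "2*m \<in> {2..2*m+2}" "2*m+1 \<in> {2..2*m+2}" "2*m+2 \<in> {2..2*m+2}"
    using m by auto
  have top: "br (e 1) (e (2*m-1)) = e (2*m)" "br (e 1) (e (2*m)) = 0"
      "br (e 1) (e (2*m+1)) = e (2*m+2)" "br (e 1) (e (2*m+2)) = 0"
  proof -
    have S: "Suc (2*m-1) = 2*m" "Suc (2*m+1) = 2*m+2" "2*m-1 < 2*m" "\<not> 2*m < 2*m" "2*m \<noteq> 2*m+1"
      "\<not> 2*m+2 < 2*m" "2*m+2 \<noteq> 2*m+1" using m by auto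
    show "br (e 1) (e (2*m-1)) = e (2*m)" "br (e 1) (e (2*m)) = 0"
      "br (e 1) (e (2*m+1)) = e (2*m+2)" "br (e 1) (e (2*m+2)) = 0"
      by (simp_all only: one[OF mem(1)] one[OF mem(2)] one[OF mem(3)] one[OF mem(4)] S simp_thms if_True if_False)
  qed
  have tab: "br (e k) (e l) = r_table m e k l" if "k \<in> {2..2*m+2}" "l \<in> {2..2*m+2}" for k l
    using that by (simp add: br_def e_def r_bracket_basis_vec[OF m])
  have zero: "br 0 x = 0" "br x 0 = 0" for x by (simp_all add: br_def r_bracket_linear)
  have scale: "br (e 1) (cscale c x) = cscale c (br (e 1) x)" for c x by (simp add: br_def r_bracket_linear)
  show ?thesis
  proof (cases "i > 2*m \<or> j > 2*m")
    case True
    have "br (e i) (e j) = 0" using tab[OF i j] r_table_high[OF i j True] by simp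
    moreover have "br (br (e 1) (e i)) (e j) = 0"
    proof (cases "i < 2*m \<or> i = 2*m + 1")
      case t: True
      then have "Suc i \<in> {2..2*m+2}" "Suc i > 2*m \<or> j > 2*m" using i True by auto
      then show ?thesis using one[OF i] t tab[OF _ j] r_table_high[OF _ j] by simp
    qed (simp add: one[OF i] zero)
    moreover have "br (e i) (br (e 1) (e j)) = 0"
    proof (cases "j < 2*m \<or> j = 2*m + 1")
      case t: True
      then have "Suc j \<in> {2..2*m+2}" "i > 2*m \<or> Suc j > 2*m" using j True by auto
      then show ?thesis using one[OF j] t tab[OF i] r_table_high[OF i] by simp
    qed (simp add: one[OF j] zero)
    ultimately show ?thesis by (simp add: zero)
  next
    case False
    then have low: "i \<in> {2..2*m}" "j \<in> {2..2*m}" using i j by auto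
    have Suc_in: "Suc i \<in> {2..2*m+2}" "Suc j \<in> {2..2*m+2}" using low by auto
    \<comment> \<open>At i = 2m both sides vanish: X_1 kills X_(2m), and a table entry with an index
      above 2m is zero.\<close>
    have "br (br (e 1) (e i)) (e j) = r_table m e (Suc i) j"
    proof (cases "i = 2*m")
      case True
      then show ?thesis using one[OF i] r_table_high[OF Suc_in(1) j] by (simp add: zero)
    next
      case False
      then show ?thesis using one[OF i] low tab[OF Suc_in(1) j] by simp
    qed
    moreover have "br (e i) (br (e 1) (e j)) = r_table m e i (Suc j)"
    proof (cases "j = 2*m")
      case True
      then show ?thesis using one[OF j] r_table_high[OF i Suc_in(2)] by (simp add: zero)
    next
      case False
      then show ?thesis using one[OF j] low tab[OF i Suc_in(2)] by simp
    qed
    moreover have "br (e 1) (r_table m e i j) = r_table m e (Suc i) j + r_table m e i (Suc j)"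
    proof (cases "i = 2*m \<or> j = 2*m")
      case True
      then have *: "i + j \<ge> 2*m + 2" "i + j \<noteq> 5" "i + j \<noteq> 6" "i + j \<noteq> 2*m+1" using low m by auto
      have "r_table m e (Suc i) j = 0"
      proof (cases "i = 2*m")
        case True
        then show ?thesis using r_table_high[OF Suc_in(1) j] by simp
      next
        case False
        then have "Suc i \<in> {2..2*m}" using low by auto
        then show ?thesis using * m by (intro r_table_low(5)[OF m _ low(2)]) auto
      qed
      moreover have "r_table m e i (Suc j) = 0"
      proof (cases "j = 2*m")
        case True
        then show ?thesis using r_table_high[OF i Suc_in(2)] by simp
      next
        case False
        then have "Suc j \<in> {2..2*m}" using low by auto
        then show ?thesis using * m by (intro r_table_low(5)[OF m low(1)]) auto
      qed
      moreover have "br (e 1) (r_table m e i j) = 0"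
      proof (cases "i + j = 2*m + 2")
        case True
        show ?thesis by (simp only: r_table_low(4)[OF m low True] scale top cscale_simps)
      next
        case False
        then show ?thesis using r_table_low(5)[OF m low, of e] * by (simp add: zero)
      qed
      ultimately show ?thesis by simp
    next
      case False
      then have S: "Suc i \<in> {2..2*m}" "Suc j \<in> {2..2*m}" using low by auto
      note t = r_table_low[OF m low, of e] and ti = r_table_low[OF m S(1) low(2), of e]
        and tj = r_table_low[OF m low(1) S(2), of e]
      \<comment> \<open>These are the sums s for which s or s + 1 is one of 5, 6, 2m + 1, 2m + 2;
        elsewhere all three terms vanish. As m >= 4, the two groups of sums do not meet.\<close>
      consider "i + j = 4" | "i + j = 5" | "i + j = 6" | "i + j = 2*m" | "i + j = 2*m + 1"
        | "i + j = 2*m + 2" | "i + j \<notin> {4, 5, 6, 2*m, 2*m+1, 2*m+2}" by blast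
      then show ?thesis
      proof cases
        case 1
        then have "i = 2" "j = 2" using low by auto
        have "r_table m e i j = 0" using 1 m by (intro t(5)) auto
        moreover have "r_table m e (Suc i) j = cscale (5 - 2 * of_nat (Suc i)) (e (2*m-1))" using 1 by (intro ti(1)) auto
        moreover have "r_table m e i (Suc j) = cscale (5 - 2 * of_nat i) (e (2*m-1))" using 1 by (intro tj(1)) auto
        moreover have "cscale (5 - 2 * of_nat (Suc i)) (e (2*m-1)) + cscale (5 - 2 * of_nat i) (e (2*m-1)) = 0"
          unfolding \<open>i = 2\<close> by (simp add: cscale_def fun_eq_iff)
        ultimately show ?thesis by (simp only: zero)
      next
        case 2
        have "br (e 1) (r_table m e i j) = cscale (5 - 2 * of_nat i) (e (2*m))"
          by (simp only: t(1)[OF 2] scale top)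
        moreover have "r_table m e (Suc i) j = cscale (3 - of_nat (Suc i)) (e (2*m))" using 2 by (intro ti(2)) auto
        moreover have "r_table m e i (Suc j) = cscale (3 - of_nat i) (e (2*m))" using 2 by (intro tj(2)) auto
        ultimately show ?thesis by (simp only:) (simp add: cscale_def fun_eq_iff algebra_simps)
      next
        case 3
        have "br (e 1) (r_table m e i j) = 0"
          by (simp only: t(2)[OF 3] scale top cscale_simps)
        moreover have "7 \<noteq> 2*m + 1" "7 \<noteq> 2*m + 2" using m by auto
        ultimately show ?thesis using ti(5) tj(5) 3 by simp
      next
        case 4
        have "r_table m e i j = 0" using 4 m by (intro t(5)) auto
        moreover have "r_table m e (Suc i) j = cscale ((-1) ^ Suc i) (e (2*m+1))" using 4 by (intro ti(3)) auto
        moreover have "r_table m e i (Suc j) = cscale ((-1) ^ i) (e (2*m+1))" using 4 by (intro tj(3)) auto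
        ultimately show ?thesis by (simp only: zero) (simp add: cscale_def fun_eq_iff)
      next
        case 5
        have "br (e 1) (r_table m e i j) = cscale ((-1) ^ i) (e (2*m+2))"
          by (simp only: t(3)[OF 5] scale top)
        moreover have "r_table m e (Suc i) j = cscale ((-1) ^ Suc i * (of_nat m + 1 - of_nat (Suc i))) (e (2*m+2))"
          using 5 by (intro ti(4)) auto
        moreover have "r_table m e i (Suc j) = cscale ((-1) ^ i * (of_nat m + 1 - of_nat i)) (e (2*m+2))"
          using 5 by (intro tj(4)) auto
        ultimately show ?thesis by (simp only:) (simp add: cscale_def fun_eq_iff algebra_simps)
      next
        case 6
        have "br (e 1) (r_table m e i j) = 0"
          by (simp only: t(4)[OF 6] scale top cscale_simps)
        moreover have "r_table m e (Suc i) j = 0" "r_table m e i (Suc j) = 0"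
          using 6 m by (intro ti(5) tj(5); auto)+
        ultimately show ?thesis by simp
      next
        case 7
        have "r_table m e i j = 0" "r_table m e (Suc i) j = 0" "r_table m e i (Suc j) = 0"
          using 7 by (intro t(5) ti(5) tj(5); auto)+
        then show ?thesis by (simp add: zero)
      qed
    qed
    ultimately show ?thesis by (simp only: tab[OF i j])
  qed
qed

text \<open>In the Jacobi identity each term vanishes separately. A nonzero [X_j, X_k] is a multiple
  of one of the last four vectors. X_(2m-1) pairs only with X_2 and X_3, but it arises only from {j,
  k} = {2, 3}; X_(2m) pairs only with X_2, but it arises only from {2, 4}; the top two pair with
  none of these.\<close>

lemma r_bracket_triple_zero:
  assumes m: "m \<ge> 4" and i: "i \<in> {2..2*m+2}" and j: "j \<in> {2..2*m+2}" and k: "k \<in> {2..2*m+2}"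
    and dist: "i \<noteq> j" "i \<noteq> k" "j \<noteq> k"
  shows "r_bracket m (basis_vec i) (r_bracket m (basis_vec j) (basis_vec k)) = 0"
proof -
  have tab: "r_bracket m (basis_vec p) (basis_vec q) = r_table m basis_vec p q"
    if "p \<in> {2..2*m+2}" "q \<in> {2..2*m+2}" for p q
    using that by (simp add: r_bracket_basis_vec[OF m])
  have high: "r_bracket m (basis_vec i) (cscale c (basis_vec q)) = 0" if "q \<in> {2*m+1, 2*m+2}" for q c
  proof -
    have q: "q \<in> {2..2*m+2}" "i > 2*m \<or> q > 2*m" using that m by auto
    show ?thesis by (simp only: r_bracket_linear tab[OF i q(1)] r_table_high[OF i q] cscale_simps)
  qed
  show ?thesis
  proof (cases "j > 2*m \<or> k > 2*m")
    case True
    then show ?thesis using tab[OF j k] r_table_high[OF j k] by (simp add: r_bracket_linear)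
  next
    case False
    then have low: "j \<in> {2..2*m}" "k \<in> {2..2*m}" using j k by auto
    note t = r_table_low[OF m low, of basis_vec]
    show ?thesis
    proof (cases rule: index_sum_cases[where s = "j + k" and m = m])
      case 1
      then have "i \<noteq> 2" "i \<noteq> 3" using dist low by auto
      then have "r_bracket m (basis_vec i) (basis_vec (2*m-1)) = 0"
      proof (cases "i > 2*m")
        case True
        have q: "2*m-1 \<in> {2..2*m+2}" using m by auto
        show ?thesis using True by (simp only: tab[OF i q]) (intro r_table_high[OF i q] disjI1)
      next
        case False
        have q: "2*m-1 \<in> {2..2*m+2}" "2*m-1 \<in> {2..2*m}" "i \<in> {2..2*m}" using m i False by auto
        show ?thesis unfolding tab[OF i q(1)]
          by (rule r_table_low(5)[OF m q(3,2)]) (use \<open>i \<noteq> 2\<close> \<open>i \<noteq> 3\<close> q m in auto)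
      qed
      then show ?thesis using tab[OF j k] t(1)[OF 1] by (simp add: r_bracket_linear cscale_simps)
    next
      case 2
      then have "i \<noteq> 2" using dist low by auto
      then have "r_bracket m (basis_vec i) (basis_vec (2*m)) = 0"
      proof (cases "i > 2*m")
        case True
        have q: "2*m \<in> {2..2*m+2}" using m by auto
        show ?thesis using True by (simp only: tab[OF i q]) (intro r_table_high[OF i q] disjI1)
      next
        case False
        have q: "2*m \<in> {2..2*m+2}" "2*m \<in> {2..2*m}" "i \<in> {2..2*m}" using m i False by auto
        show ?thesis unfolding tab[OF i q(1)]
          by (rule r_table_low(5)[OF m q(3,2)]) (use \<open>i \<noteq> 2\<close>  q m in auto)
      qed
      then show ?thesis using tab[OF j k] t(2)[OF 2] by (simp add: r_bracket_linear cscale_simps)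
    next
      case 3 then show ?thesis using tab[OF j k] t(3)[OF 3] high by simp
    next
      case 4 then show ?thesis using tab[OF j k] t(4)[OF 4] high by simp
    next
      case 5 then show ?thesis using tab[OF j k] t(5)[OF 5] by (simp add: r_bracket_linear)
    qed
  qed
qed

text \<open>Rotation brings X_theta, or else X_1, to the front; a repeated index is settled by
  antisymmetry of the jacobiator.\<close>

lemma jacobiator_r_basis:
  assumes m: "m \<ge> 4" and ijk: "i \<in> {1..2*m+3}" "j \<in> {1..2*m+3}" "k \<in> {1..2*m+3}"
  shows "jacobiator (r_bracket m) (basis_vec i) (basis_vec j) (basis_vec k) = 0"
proof -
  define J where "J i j k = jacobiator (r_bracket m) (basis_vec i) (basis_vec j) (basis_vec k)" for i j k
  have rot: "J i j k = J j k i" for i j k unfolding J_def by (rule jacobiator_rotate[symmetric])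
  have swap: "J j i k = - J i j k" for i j k unfolding J_def by (rule jacobiator_r_swap)
  have same: "J i i k = 0" for i k
    using swap[of i i k] by (simp add: fun_eq_iff)
  have theta: "J (2*m+3) i j = 0" if "i \<in> {1..2*m+3}" "j \<in> {1..2*m+3}" for i j
    unfolding J_def by (rule jacobiator_r_theta[OF m that])
  have one: "J 1 i j = 0" if i: "i \<in> {2..2*m+2}" and j: "j \<in> {2..2*m+2}" for i j
  proof -
    let ?b = "r_bracket m" and ?e = basis_vec
    have "?b (?e i) (?b (?e j) (?e 1)) = - ?b (?e i) (?b (?e 1) (?e j))"
      by (subst r_bracket_antisym[of m "?e j" "?e 1"]) (rule r_bracket_minus_right)
    moreover have "?b (?e j) (?b (?e 1) (?e i)) = - ?b (?b (?e 1) (?e i)) (?e j)"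
      by (rule r_bracket_antisym)
    ultimately show ?thesis
      unfolding J_def jacobiator_def r_bracket_one_derivation[OF m i j] by simp
  qed
  have big: "J i j k = 0" if "i \<in> {2..2*m+2}" "j \<in> {2..2*m+2}" "k \<in> {2..2*m+2}" for i j k
  proof (cases "i = j \<or> i = k \<or> j = k")
    case True
    then show ?thesis using same rot by metis
  next
    case False
    then show ?thesis using that by (simp add: J_def jacobiator_def r_bracket_triple_zero[OF m])
  qed
  have one': "J 1 i j = 0" if ij: "i \<in> {1..2*m+2}" "j \<in> {1..2*m+2}" for i j
  proof -
    have split: "p = 1 \<or> p \<in> {2..2*m+2}" if "p \<in> {1..2*m+2}" for p using that by auto
    consider "i = 1" | "j = 1" | "i \<in> {2..2*m+2}" "j \<in> {2..2*m+2}"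
      using split[OF ij(1)] split[OF ij(2)] by blast
    then show ?thesis
    proof cases
      case 1
      then show ?thesis by (simp only: same)
    next
      case 2
      then show ?thesis using same[of 1 i] rot[of 1 i 1] rot[of i 1 1] by simp
    next
      case 3
      then show ?thesis by (rule one)
    qed
  qed
  have "J i j k = 0"
  proof (cases "i = 2*m+3 \<or> j = 2*m+3 \<or> k = 2*m+3")
    case True
    then consider "i = 2*m+3" | "j = 2*m+3" | "k = 2*m+3" by blast
    then show ?thesis
    proof cases
      case 1
      then show ?thesis using theta[OF ijk(2,3)] by simp
    next
      case 2
      then show ?thesis using theta[OF ijk(3,1)] rot[of i j k] by simp
    next
      case 3
      then show ?thesis using theta[OF ijk(1,2)] rot[of k i j] by simp
    qed
  next
    case False
    then have ijk': "i \<in> {1..2*m+2}" "j \<in> {1..2*m+2}" "k \<in> {1..2*m+2}" using ijk by auto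
    have split: "p = 1 \<or> p \<in> {2..2*m+2}" if "p \<in> {1..2*m+2}" for p using that by auto
    consider "i = 1" | "j = 1" | "k = 1" | "i \<in> {2..2*m+2}" "j \<in> {2..2*m+2}" "k \<in> {2..2*m+2}"
      using split[OF ijk'(1)] split[OF ijk'(2)] split[OF ijk'(3)] by blast
    then show ?thesis
    proof cases
      case 1
      then show ?thesis using one'[OF ijk'(2,3)] by simp
    next
      case 2
      then show ?thesis using one'[OF ijk'(3,1)] rot[of i j k] by simp
    next
      case 3
      then show ?thesis using one'[OF ijk'(1,2)] rot[of k i j] by simp
    next
      case 4
      then show ?thesis by (rule big)
    qed
  qed
  then show ?thesis by (simp add: J_def)
qed

lemma r_law_lie_law:
  assumes "m \<ge> 4"
  shows "r_law m \<in> lie_laws (2*m + 3)"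
proof (rule lie_lawsI_basis[OF law_support_r_law[OF assms] r_law_antisym])
  show "jacobiator (bilinear_of (2*m + 3) (r_law m)) (basis_vec i) (basis_vec j) (basis_vec k) = 0"
    if "i \<in> {1..2*m+3}" "j \<in> {1..2*m+3}" "k \<in> {1..2*m+3}" for i j k
    using jacobiator_r_basis[OF assms that] by (simp only: r_bracket_def)
qed


section \<open>Solvability, nilradical and decomposability\<close>

lemma r_law_weight:
  assumes m: "m \<ge> 4" and nz: "r_law m i j l \<noteq> 0"
  shows "weight m l = weight m i + weight m j" "l \<noteq> 2*m+3"
proof -
  have ij: "i \<in> {1..2*m+3}" "j \<in> {1..2*m+3}" "l \<in> {1..2*m+3}"
    using law_supportD[OF law_support_r_law[OF m] nz] by auto
  obtain k c where k: "\<And>w. r_table m w i j = cscale c (w k)"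
    "c \<noteq> 0 \<Longrightarrow> weight m k = weight m i + weight m j" using r_table_monomial[OF m ij(1,2)] by metis
  have "r_law m i j l = c * basis_vec k l"
    by (simp only: r_law_eq_table[OF m ij(1,2)] k(1) cscale_apply)
  then have "c \<noteq> 0" "l = k" using nz by (auto simp: basis_vec_def split: if_splits)
  then show "weight m l = weight m i + weight m j" using k(2) by simp
  show "l \<noteq> 2*m+3" using nz r_law_coord(8)[OF m, of "2*m+3" i j] by auto
qed

text \<open>Vectors supported in weights at least k. Level 0 is the whole algebra, level 1 the
  nilradical, and the filtration ends beyond the top weight 6m-10.\<close>

definition weight_filtration :: "nat \<Rightarrow> nat \<Rightarrow> cvec set" where
  "weight_filtration m k = {x \<in> coord_space (2*m+3). \<forall>l. x l \<noteq> 0 \<longrightarrow> k \<le> weight m l}"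

lemma subspace_weight_filtration: "cvec.subspace (weight_filtration m k)"
  unfolding cvec.subspace_def
proof (intro conjI ballI allI)
  show "0 \<in> weight_filtration m k" by (simp add: weight_filtration_def)
next
  fix x y assume "x \<in> weight_filtration m k" "y \<in> weight_filtration m k"
  then show "x + y \<in> weight_filtration m k"
    using cvec.subspace_add[OF subspace_coord_space]
    by (auto simp: weight_filtration_def) (metis add.right_neutral)
next
  fix c x assume "x \<in> weight_filtration m k"
  then show "cscale c x \<in> weight_filtration m k"
    using cvec.subspace_scale[OF subspace_coord_space] by (auto simp: weight_filtration_def)
qed

lemma weight_filtration_antimono: "k \<le> k' \<Longrightarrow> weight_filtration m k' \<subseteq> weight_filtration m k"
  by (force simp: weight_filtration_def)

lemma weight_filtration_0: "weight_filtration m 0 = coord_space (2*m+3)"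
  by (simp add: weight_filtration_def)

lemma weight_bound: "m \<ge> 4 \<Longrightarrow> i \<in> {1..2*m+2} \<Longrightarrow> 1 \<le> weight m i" "m \<ge> 4 \<Longrightarrow> weight m i < 6*m - 9"
  by (auto simp: weight_def)

lemma weight_filtration_1:
  assumes m: "m \<ge> 4" shows "weight_filtration m 1 = coord_space (2*m+2)"
proof
  show "weight_filtration m 1 \<subseteq> coord_space (2*m+2)"
  proof
    fix x assume x: "x \<in> weight_filtration m 1"
    then have "x (2*m+3) = 0" using weight_simps(5)[OF m] by (force simp: weight_filtration_def)
    moreover have "x i = 0" if "i \<notin> {1..2*m+3}" for i
      using x that by (auto simp: weight_filtration_def coord_space_def)
    moreover have "i \<notin> {1..2*m+3} \<or> i = 2*m+3" if "i \<notin> {1..2*m+2}" for i using that by auto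
    ultimately show "x \<in> coord_space (2*m+2)" unfolding coord_space_def by blast
  qed
  show "coord_space (2*m+2) \<subseteq> weight_filtration m 1"
  proof
    fix x assume x: "x \<in> coord_space (2*m+2)"
    then have "x l = 0" if "l \<notin> {1..2*m+2}" for l using that by (simp add: coord_space_def)
    then show "x \<in> weight_filtration m 1"
      using weight_bound(1)[OF m] by (auto simp: weight_filtration_def coord_space_def)
  qed
qed

lemma weight_filtration_trivial:
  assumes "m \<ge> 4" "k \<ge> 6*m - 9" shows "weight_filtration m k = {0}"
proof -
  have "x = 0" if x: "x \<in> weight_filtration m k" for x
  proof
    fix l
    have "\<not> k \<le> weight m l" using weight_bound(2)[OF assms(1), of l] assms(2) by linarith
    then show "x l = 0 l" using x by (auto simp: weight_filtration_def)
  qed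
  moreover have "0 \<in> weight_filtration m k" by (rule cvec.subspace_0[OF subspace_weight_filtration])
  ultimately show ?thesis by blast
qed

text \<open>Weights add. The \<open>1\<close> in the maximum matters for a = b = 0: X_theta never
  occurs in a bracket, and all other basis vectors have positive weight.\<close>

lemma r_bracket_filtration:
  assumes m: "m \<ge> 4" and x: "x \<in> weight_filtration m a" and y: "y \<in> weight_filtration m b"
  shows "r_bracket m x y \<in> weight_filtration m (max 1 (a + b))"
  unfolding weight_filtration_def
proof (intro CollectI conjI allI impI)
  show "r_bracket m x y \<in> coord_space (2*m+3)"
    unfolding r_bracket_def by (rule bilinear_of_closed[OF law_support_r_law[OF m]])
  fix l assume "r_bracket m x y l \<noteq> 0"
  then obtain i j where "x i * y j * r_law m i j l \<noteq> 0"
    unfolding r_bracket_def bilinear_of_def by (metis (no_types, lifting) sum.neutral)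
  then have nz: "x i \<noteq> 0" "y j \<noteq> 0" "r_law m i j l \<noteq> 0" by auto
  have "l \<in> {1..2*m+3}" using law_supportD[OF law_support_r_law[OF m] nz(3)] by auto
  then have "1 \<le> weight m l" using r_law_weight(2)[OF m nz(3)] by (intro weight_bound[OF m]) auto
  moreover have "a \<le> weight m i" "b \<le> weight m j" using nz x y by (auto simp: weight_filtration_def)
  ultimately show "max 1 (a + b) \<le> weight m l" using r_law_weight(1)[OF m nz(3)] by simp
qed

lemma bracket_space_filtration:
  assumes m: "m \<ge> 4" and "A \<subseteq> weight_filtration m a" "B \<subseteq> weight_filtration m b"
  shows "bracket_space (r_bracket m) A B \<subseteq> weight_filtration m (max 1 (a + b))"
  unfolding bracket_space_def
  by (rule cvec.span_minimal[OF _ subspace_weight_filtration])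
    (use assms r_bracket_filtration[OF m] in blast)

section \<open>Derived and lower central series bounded by weight\<close>

lemma zero_in_derived_series: "0 \<in> L \<Longrightarrow> 0 \<in> derived_series L br k"
  by (cases k) (simp_all add: bracket_space_def cvec.span_zero)

lemma zero_in_lower_central_series: "0 \<in> L \<Longrightarrow> 0 \<in> lower_central_series L br k"
  by (cases k) (simp_all add: bracket_space_def cvec.span_zero)

lemma r_solvable:
  assumes m: "m \<ge> 4"
  shows "solvable (coord_space (2*m+3)) (r_bracket m)"
proof -
  have D: "derived_series (coord_space (2*m+3)) (r_bracket m) k \<subseteq> weight_filtration m k" for k
  proof (induction k)
    case 0
    then show ?case by (simp add: weight_filtration_0)
  next
    case (Suc k)
    then have "derived_series (coord_space (2*m+3)) (r_bracket m) (Suc k) \<subseteq>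
        weight_filtration m (max 1 (k + k))"
      by (simp only: derived_series.simps) (rule bracket_space_filtration[OF m])
    \<comment> \<open>For k = 0 the \<open>1\<close> in the maximum gives the step; for k >= 1 the
      sum k + k is at least k + 1.\<close>
    also have "\<dots> \<subseteq> weight_filtration m (Suc k)" by (rule weight_filtration_antimono) auto
    finally show ?case .
  qed
  have "derived_series (coord_space (2*m+3)) (r_bracket m) (6*m - 9) = {0}"
    using D[of "6*m-9"] weight_filtration_trivial[OF m order_refl]
      zero_in_derived_series[OF zero_coord_space[of "2*m+3"], of "r_bracket m" "6*m-9"] by blast
  then show ?thesis unfolding solvable_def by blast
qed

lemma r_nilradical_nilpotent:
  assumes m: "m \<ge> 4"
  shows "nilpotent (coord_space (2*m+2)) (r_bracket m)"
proof -
  \<comment> \<open>Starting in level 1 instead of 0, each bracket with the nilradical raises the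
    level by at least one; hence the shift to \<open>Suc k\<close>.\<close>
  have D: "lower_central_series (coord_space (2*m+2)) (r_bracket m) k \<subseteq> weight_filtration m (Suc k)" for k
  proof (induction k)
    case 0
    then show ?case using weight_filtration_1[OF m] by (simp add: One_nat_def)
  next
    case (Suc k)
    then have "lower_central_series (coord_space (2*m+2)) (r_bracket m) (Suc k) \<subseteq>
        weight_filtration m (max 1 (1 + Suc k))"
      by (simp only: lower_central_series.simps)
        (rule bracket_space_filtration[OF m], simp_all add: weight_filtration_1[OF m])
    then show ?case by (simp add: max_def One_nat_def)
  qed
  have "lower_central_series (coord_space (2*m+2)) (r_bracket m) (6*m - 9) = {0}"
    using D[of "6*m-9"] weight_filtration_trivial[OF m, of "Suc (6*m-9)"]
      zero_in_lower_central_series[OF zero_coord_space[of "2*m+2"], of "r_bracket m" "6*m-9"] by auto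
  then show ?thesis unfolding nilpotent_def by blast
qed

lemma coord_space_mono: "n \<le> n' \<Longrightarrow> coord_space n \<subseteq> coord_space n'"
  by (auto simp: coord_space_def)

lemma r_nilradical_ideal:
  assumes m: "m \<ge> 4"
  shows "lie_ideal (coord_space (2*m+3)) (r_bracket m) (coord_space (2*m+2))"
  unfolding lie_ideal_def
proof (intro conjI ballI subspace_coord_space coord_space_mono)
  fix x y assume "x \<in> coord_space (2*m+3)" "y \<in> coord_space (2*m+2)"
  then show "r_bracket m x y \<in> coord_space (2*m+2)"
    using r_bracket_filtration[OF m, of x 0 y 1] by (simp add: weight_filtration_0 weight_filtration_1[OF m])
qed simp

text \<open>Every basis vector except X_theta kills X_(2m+2), so this bracket detects the
  theta-component of x.\<close>

lemma r_bracket_top: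
  assumes m: "m \<ge> 4" and x: "x \<in> coord_space (2*m+3)"
  shows "r_bracket m x (basis_vec (2*m+2)) = cscale (x (2*m+3) * of_nat (6*m - 10)) (basis_vec (2*m+2))"
proof -
  let ?t = "2*m+3" and ?e = "basis_vec (2*m+2)"
  have e: "2*m+2 \<in> {1..2*m+3}" by simp
  have z: "r_table m basis_vec i (2*m+2) = (if i = ?t then cscale (of_nat (6*m-10)) ?e else 0)"
    if "i \<in> {1..2*m+3}" for i
    using that e
  proof (cases rule: index_pair_cases)
    case theta1
    then show ?thesis by (simp add: r_table_theta_left weight_simps(4)[OF m])
  next
    case one1
    then show ?thesis by (simp add: r_table_one_left)
  next
    case high
    then show ?thesis using r_table_high[OF high] by auto
  qed auto
  have "r_bracket m x ?e = (\<Sum>i = 1..2*m+3. cscale (x i) (r_bracket m (basis_vec i) ?e))"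
    unfolding r_bracket_def
    by (subst coord_space_expansion[OF x, symmetric])
      (simp only: bilinear_of_sum_left bilinear_of_scale_left)
  also have "\<dots> = (\<Sum>i = 1..2*m+3. if i = ?t then cscale (x ?t * of_nat (6*m-10)) ?e else 0)"
    by (rule sum.cong) (simp_all add: r_bracket_basis_vec[OF m _ e] z cscale_simps)
  also have "\<dots> = cscale (x ?t * of_nat (6*m-10)) ?e" by (subst sum.delta) simp_all
  finally show ?thesis .
qed

text \<open>If \<open>x\<close> has a nonzero \<open>\<theta>\<close>-component, then \<open>ad x\<close> acts on \<open>X\<^bsub>2m+2\<^esub>\<close> by a nonzero scalar.\<close>

lemma not_nilpotent_if_theta:
  assumes m: "m \<ge> 4" and I: "lie_ideal (coord_space (2*m+3)) (r_bracket m) I"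
    and x: "x \<in> I" "x (2*m+3) \<noteq> 0"
  shows "\<not> nilpotent I (r_bracket m)"
proof -
  let ?e = "basis_vec (2*m+2)" and ?c = "x (2*m+3) * of_nat (6*m - 10)"
  have sub: "cvec.subspace I" and "x \<in> coord_space (2*m+3)" using I x(1) by (auto simp: lie_ideal_def)
  then have xe: "r_bracket m x ?e = cscale ?c ?e" by (intro r_bracket_top[OF m])
  have "6*m - 10 \<noteq> 0" using m by auto
  then have c: "?c \<noteq> 0" using x(2) by (simp only: mult_eq_0_iff of_nat_eq_0_iff simp_thms)
  have e: "?e = cscale (inverse ?c) (cscale ?c ?e)" by (simp only: cscale_simps left_inverse[OF c])
  have "?e \<in> coord_space (2*m+3)" by (rule basis_vec_coord_space) simp
  \<comment> \<open>Bracketing with x returns a nonzero multiple of X_(2m+2). Hence X_(2m+2) lies in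
    the ideal and, by repetition, in every term of its lower central series.\<close>
  then have "r_bracket m ?e x \<in> I" using I x(1) by (simp add: lie_ideal_def)
  then have "cscale (-1) (r_bracket m ?e x) \<in> I" by (rule cvec.subspace_scale[OF sub])
  moreover have "cscale (-1) (r_bracket m ?e x) = cscale ?c ?e"
    unfolding xe[symmetric] by (subst (2) r_bracket_antisym) (simp add: cscale_def fun_eq_iff)
  ultimately have eI: "?e \<in> I" using e cvec.subspace_scale[OF sub, of "cscale ?c ?e" "inverse ?c"] by simp
  have "?e \<in> lower_central_series I (r_bracket m) k" for k
  proof (induction k)
    case 0
    then show ?case using eI by simp
  next
    case (Suc k)
    then have "r_bracket m x ?e \<in> {r_bracket m x y | x y. x \<in> I \<and> y \<in> lower_central_series I (r_bracket m) k}"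
      using x(1) by blast
    then have "cscale ?c ?e \<in> lower_central_series I (r_bracket m) (Suc k)"
      unfolding lower_central_series.simps bracket_space_def xe[symmetric] by (rule cvec.span_base)
    then have "cscale (inverse ?c) (cscale ?c ?e) \<in> lower_central_series I (r_bracket m) (Suc k)"
      unfolding lower_central_series.simps bracket_space_def by (rule cvec.span_scale)
    then show ?case using e by simp
  qed
  moreover have "?e \<noteq> 0" by (auto simp: basis_vec_def fun_eq_iff)
  ultimately show ?thesis unfolding nilpotent_def by (metis singletonD)
qed

text \<open>A nilpotent ideal has no element with a theta-component, and the hyperplane without
  theta-component is itself a nilpotent ideal.\<close>

lemma r_nilradical:
  assumes m: "m \<ge> 4"
  shows "nilradical (coord_space (2*m+3)) (r_bracket m) = coord_space (2*m+2)"
  unfolding nilradical_def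
proof
  show "cvec.span (\<Union>{I. lie_ideal (coord_space (2*m+3)) (r_bracket m) I \<and> nilpotent I (r_bracket m)})
      \<subseteq> coord_space (2*m+2)"
  proof (rule cvec.span_minimal[OF _ subspace_coord_space], rule Union_least)
    fix I assume "I \<in> {I. lie_ideal (coord_space (2*m+3)) (r_bracket m) I \<and> nilpotent I (r_bracket m)}"
    then have I: "lie_ideal (coord_space (2*m+3)) (r_bracket m) I" "nilpotent I (r_bracket m)" by auto
    show "I \<subseteq> coord_space (2*m+2)"
    proof
      fix x assume x: "x \<in> I"
      then have "x (2*m+3) = 0" using not_nilpotent_if_theta[OF m I(1)] I(2) by blast
      moreover have "x \<in> coord_space (2*m+3)" using x I(1) by (auto simp: lie_ideal_def)
      moreover have "i \<notin> {1..2*m+3} \<or> i = 2*m+3" if "i \<notin> {1..2*m+2}" for i using that by auto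
      ultimately show "x \<in> coord_space (2*m+2)" unfolding coord_space_def by blast
    qed
  qed
  show "coord_space (2*m+2)
      \<subseteq> cvec.span (\<Union>{I. lie_ideal (coord_space (2*m+3)) (r_bracket m) I \<and> nilpotent I (r_bracket m)})"
    using r_nilradical_ideal[OF m] r_nilradical_nilpotent[OF m] by (intro subsetI cvec.span_base) blast
qed

lemma r_decomposable:
  assumes m: "m \<ge> 4"
  shows "decomposable (coord_space (2*m+3)) (r_bracket m)"
proof -
  let ?L = "coord_space (2*m+3)" and ?br = "r_bracket m" and ?t = "basis_vec (2*m+3)"
  \<comment> \<open>The torus is the line through X_theta; its elements act diagonally in the given
    basis.\<close>
  define T where "T = range (\<lambda>c. cscale c ?t)"
  have t: "2*m+3 \<in> {1..2*m+3}" by simp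
  have ad: "?br (cscale c ?t) (basis_vec i) = cscale (c * of_nat (weight m i)) (basis_vec i)"
    if "i \<in> {1..2*m+3}" for c i
    by (simp only: r_bracket_linear r_bracket_basis_vec[OF m t that] r_table_theta_left cscale_simps)
  have "lie_ideal ?L ?br ?L"
    unfolding lie_ideal_def r_bracket_def
    using bilinear_of_closed[OF law_support_r_law[OF m]] subspace_coord_space by blast
  moreover have tL: "?t \<in> ?L" "?t (2*m+3) \<noteq> 0" using basis_vec_coord_space[OF t] by (auto simp: basis_vec_def)
  ultimately have "\<not> nilpotent ?L ?br" using not_nilpotent_if_theta[OF m] by blast
  moreover have "abelian_subalgebra ?L ?br T"
    unfolding abelian_subalgebra_def
  proof (intro conjI ballI)
    have "T = cvec.span {?t}" by (simp add: T_def cvec.span_singleton)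
    then show "cvec.subspace T" by (simp only: cvec.subspace_span)
    show "T \<subseteq> ?L" using tL cvec.subspace_scale[OF subspace_coord_space] by (auto simp: T_def)
    show "?br x y = 0" if "x \<in> T" "y \<in> T" for x y
      using that ad[OF t] by (auto simp: T_def r_bracket_linear weight_simps(5)[OF m] cscale_simps)
  qed
  moreover have "\<forall>x\<in>T. ad_semisimple ?L ?br x"
  proof
    fix x assume "x \<in> T"
    then obtain c where x: "x = cscale c ?t" by (auto simp: T_def)
    show "ad_semisimple ?L ?br x"
      unfolding ad_semisimple_def x
      by (intro exI[of _ "basis_vec ` {1..2*m+3}"] conjI independent_basis_vec span_basis_vec)
        (use ad in blast)
  qed
  moreover have "coord_space (2*m+2) \<inter> T = {0}"
  proof -
    have "cscale c ?t = 0" if "cscale c ?t \<in> coord_space (2*m+2)" for c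
    proof -
      have "cscale c ?t (2*m+3) = 0" using that by (simp only: coord_space_def mem_Collect_eq) simp
      then have "c = 0" by (simp add: basis_vec_def)
      then show ?thesis by (simp only: cscale_simps)
    qed
    moreover have "0 \<in> T" unfolding T_def using cscale_simps(1)[of ?t] by (metis rangeI)
    ultimately show ?thesis by (auto simp: T_def)
  qed
  moreover have "{x + y | x y. x \<in> coord_space (2*m+2) \<and> y \<in> T} = ?L"
  proof
    show "{x + y | x y. x \<in> coord_space (2*m+2) \<and> y \<in> T} \<subseteq> ?L"
    proof
      fix z assume "z \<in> {x + y | x y. x \<in> coord_space (2*m+2) \<and> y \<in> T}"
      then obtain x c where z: "z = x + cscale c ?t" "x \<in> coord_space (2*m+2)" by (auto simp: T_def)
      have "x \<in> ?L" using z(2) coord_space_mono[of "2*m+2" "2*m+3"] by auto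
      moreover have "cscale c ?t \<in> ?L" by (rule cvec.subspace_scale[OF subspace_coord_space tL(1)])
      ultimately show "z \<in> ?L" unfolding z(1) by (rule cvec.subspace_add[OF subspace_coord_space])
    qed
    show "?L \<subseteq> {x + y | x y. x \<in> coord_space (2*m+2) \<and> y \<in> T}"
    proof
      fix x assume x: "x \<in> ?L"
      let ?y = "cscale (x (2*m+3)) ?t"
      have "(x - ?y) i = 0" if i: "i \<notin> {1..2*m+2}" for i
      proof (cases "i = 2*m+3")
        case True
        then show ?thesis by (simp add: basis_vec_def)
      next
        case False
        then have "i \<notin> {1..2*m+3}" using i by auto
        then have "x i = 0" using x unfolding coord_space_def by blast
        then show ?thesis using False by (simp add: basis_vec_def)
      qed
      then have "x - ?y \<in> coord_space (2*m+2)" unfolding coord_space_def by blast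
      moreover have "?y \<in> T" unfolding T_def by (rule rangeI)
      moreover have "x = (x - ?y) + ?y" by simp
      ultimately show "x \<in> {x + y | x y. x \<in> coord_space (2*m+2) \<and> y \<in> T}" by blast
    qed
  qed
  ultimately show ?thesis
    unfolding decomposable_def r_nilradical[OF m] using r_solvable[OF m] by blast
qed

section \<open>The nilradical as \<open>g_law m\<close> plus \<open>psi m\<close>\<close>

lemma r_law_nilradical:
  assumes m: "m \<ge> 4" and i: "i \<in> {1..2*m+2}" and j: "j \<in> {1..2*m+2}"
  shows "r_law m i j l = g_law m i j l + psi m i j l"
proof -
  have w: "wedge (2*m+3) k i j = 0" for k
    using i j by (intro wedge_simps(2)) auto
  note D = g_law_def law_of_forms_def g_forms_def psi_def sum_wedge_odd[OF m] sum_wedge_even[OF m]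
    w mult_zero_right add_0 add_0_right if_True if_False simp_thms
  note c = r_law_coord[OF m]
  show ?thesis
  proof (cases rule: coord_cases[where l = l and m = m])
    case 1
    have n: "1 \<notin> {3..2*m}" "1 \<noteq> 2*m+1" "1 \<noteq> 2*m+2" "1 \<noteq> 2*m-1" "1 \<noteq> 2*m" using m by auto
    show ?thesis unfolding 1 by (simp only: c(1) D n)
  next
    case 2
    have n: "2 \<notin> {3..2*m}" "2 \<noteq> 2*m+1" "2 \<noteq> 2*m+2" "2 \<noteq> 2*m-1" "2 \<noteq> 2*m" using m by auto
    show ?thesis unfolding 2 by (simp only: c(2) D n)
  next
    case 3
    then have n: "l \<in> {3..2*m}" "l \<noteq> 2*m-1" "l \<noteq> 2*m" by auto
    show ?thesis by (simp only: c(3)[OF 3] D n)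
  next
    case 4
    have n: "2*m-1 \<in> {3..2*m}" "2*m - 1 - 1 = 2*m - 2" using m by auto
    show ?thesis unfolding 4 by (simp only: c(4) D n)
  next
    case 5
    have n: "2*m \<in> {3..2*m}" "2*m \<noteq> 2*m-1" using m by auto
    show ?thesis unfolding 5 by (simp only: c(5) D n)
  next
    case 6
    have n: "2*m+1 \<notin> {3..2*m}" "2*m+1 \<noteq> 2*m-1" "2*m+1 \<noteq> 2*m" using m by auto
    show ?thesis unfolding 6 by (simp only: c(6) D n)
  next
    case 7
    have n: "2*m+2 \<notin> {3..2*m}" "2*m+2 \<noteq> 2*m+1" "2*m+2 \<noteq> 2*m-1" "2*m+2 \<noteq> 2*m" using m by auto
    show ?thesis unfolding 7 by (simp only: c(7) D n)
  next
    case 8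
    then have n: "l \<notin> {3..2*m}" "l \<noteq> 2*m+1" "l \<noteq> 2*m+2" "l \<noteq> 2*m-1" "l \<noteq> 2*m" using m by auto
    show ?thesis by (simp only: c(8)[OF 8] D n)
  qed
qed

lemma r_bracket_nilradical:
  assumes m: "m \<ge> 4" and x: "x \<in> coord_space (2*m+2)" and y: "y \<in> coord_space (2*m+2)"
  shows "r_bracket m x y = g_psi_bracket m x y"
proof
  fix l
  have "r_bracket m x y l = (\<Sum>i=1..2*m+3. \<Sum>j=1..2*m+3. x i * y j * r_law m i j l)"
    by (simp only: r_bracket_def bilinear_of_def)
  also have "\<dots> = (\<Sum>i=1..2*m+2. \<Sum>j=1..2*m+3. x i * y j * r_law m i j l)"
    using x by (intro sum.mono_neutral_right) (auto simp: coord_space_def)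
  also have "\<dots> = (\<Sum>i=1..2*m+2. \<Sum>j=1..2*m+2. x i * y j * r_law m i j l)"
    using y by (intro sum.cong refl sum.mono_neutral_right) (auto simp: coord_space_def)
  also have "\<dots> = (\<Sum>i=1..2*m+2. \<Sum>j=1..2*m+2. x i * y j * g_law m i j l + x i * y j * psi m i j l)"
    by (intro sum.cong refl) (simp only: r_law_nilradical[OF m] distrib_left)
  also have "\<dots> = g_psi_bracket m x y l"
    by (simp only: g_psi_bracket_def bilinear_of_def plus_fun_apply sum.distrib)
  finally show "r_bracket m x y l = g_psi_bracket m x y l" .
qed

lemma r_nilradical_isomorphic:
  assumes m: "m \<ge> 4"
  shows "lie_isomorphic (nilradical (coord_space (2*m+3)) (r_bracket m)) (r_bracket m)
    (coord_space (2*m+2)) (g_psi_bracket m)"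
  unfolding r_nilradical[OF m] lie_isomorphic_def
proof (intro exI[of _ "\<lambda>x. x"] conjI ballI)
  show "Vector_Spaces.linear cscale cscale (\<lambda>x. x)" by (rule cvec.linear_ident)
  show "bij_betw (\<lambda>x. x) (coord_space (2*m+2)) (coord_space (2*m+2))" by (simp add: bij_betw_def)
qed (rule r_bracket_nilradical[OF m])


section \<open>Laws graded by the same weights\<close>

text \<open>The simplifier contracts this rule to one that unfolds \<open>cscale\<close> everywhere.\<close>

declare cscale_apply [simp del]

lemma independent_eigenvectors:
  fixes W :: "nat \<Rightarrow> complex"
  assumes fin: "finite S" and inj: "inj_on W S"
    and lin: "Vector_Spaces.linear cscale cscale D"
    and eig: "\<And>k. k \<in> S \<Longrightarrow> D (w k) = cscale (W k) (w k)"
    and nz: "\<And>k. k \<in> S \<Longrightarrow> w k \<noteq> 0"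
    and sum: "(\<Sum>k\<in>S. cscale (a k) (w k)) = 0" and k: "k \<in> S"
  shows "a k = 0"
  using fin inj eig nz sum k
proof (induction S arbitrary: a k rule: finite_induct)
  case (insert p S)
  interpret D: Vector_Spaces.linear cscale cscale D by (rule lin)
  have s: "cscale (a p) (w p) + (\<Sum>k\<in>S. cscale (a k) (w k)) = 0"
    using insert.prems(4) by (simp only: sum.insert[OF insert.hyps(1,2)])
  have "D (cscale (a p) (w p) + (\<Sum>k\<in>S. cscale (a k) (w k))) =
      cscale (a p * W p) (w p) + (\<Sum>k\<in>S. cscale (a k * W k) (w k))"
    unfolding D.add D.scale D.sum
    by (intro arg_cong2[where f = "(+)"] sum.cong refl)
      (simp_all only: insert.prems(2) insertI1 insertI2 cscale_simps)
  then have d: "cscale (a p * W p) (w p) + (\<Sum>k\<in>S. cscale (a k * W k) (w k)) = 0"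
    by (simp only: s D.zero)
  \<comment> \<open>D minus the scalar \<open>W p\<close> kills \<open>w p\<close> and leaves a
    relation over \<open>S\<close> with coefficients multiplied by the nonzero numbers
    \<open>W k - W p\<close>.\<close>
  have "(\<Sum>k\<in>S. cscale (a k * (W k - W p)) (w k)) = 0"
  proof
    fix l
    have "a p * w p l + (\<Sum>k\<in>S. a k * w k l) = 0"
      using fun_cong[OF s, of l] by (simp add: sum_fun_apply cscale_apply)
    moreover have "a p * W p * w p l + (\<Sum>k\<in>S. a k * W k * w k l) = 0"
      using fun_cong[OF d, of l] by (simp add: sum_fun_apply cscale_apply)
    moreover have "(\<Sum>k\<in>S. a k * (W k - W p) * w k l) =
        (a p * W p * w p l + (\<Sum>k\<in>S. a k * W k * w k l)) - W p * (a p * w p l + (\<Sum>k\<in>S. a k * w k l))"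
      by (simp add: algebra_simps sum_distrib_left sum_subtractf)
    ultimately show "(\<Sum>k\<in>S. cscale (a k * (W k - W p)) (w k)) l = 0 l"
      by (simp add: sum_fun_apply cscale_apply)
  qed
  then have "a q * (W q - W p) = 0" if "q \<in> S" for q
    using insert.IH[of "\<lambda>k. a k * (W k - W p)" q] insert.prems that by (simp add: inj_on_insert)
  moreover have "W q \<noteq> W p" if "q \<in> S" for q
    using insert.prems(1) insert.hyps(2) that by (auto simp: inj_on_def)
  ultimately have S0: "a q = 0" if "q \<in> S" for q using that by auto
  then have "(\<Sum>k\<in>S. cscale (a k) (w k)) = 0"
    by (intro sum.neutral) (simp add: cscale_simps)
  then have "cscale (a p) (w p) = 0" using s by (simp only: add_0_right)
  moreover obtain l where "w p l \<noteq> 0" using insert.prems(3)[of p] by (auto simp: fun_eq_iff)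
  ultimately have "a p = 0" by (auto simp: fun_eq_iff cscale_apply)
  then show ?case using S0 insert.prems(5) by auto
qed simp

text \<open>The ambient function space is infinite-dimensional, so surjectivity is obtained inside
  \<open>coord_space n\<close> by counting: an independent set there has at most n elements.\<close>

lemma linear_of_basis_GL:
  assumes w: "\<And>k. k \<in> {1..n} \<Longrightarrow> w k \<in> coord_space n"
    and indep: "\<And>a k. (\<Sum>k = 1..n. cscale (a k) (w k)) = 0 \<Longrightarrow> k \<in> {1..n} \<Longrightarrow> a k = 0"
  shows "linear_of_basis n w \<in> GL n"
proof -
  let ?g = "linear_of_basis n w" and ?V = "coord_space n"
  interpret g: Vector_Spaces.linear cscale cscale ?g by (rule linear_linear_of_basis)
  have inj: "inj_on ?g ?V"
  proof (rule inj_onI)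
    fix x y assume xy: "x \<in> ?V" "y \<in> ?V" "?g x = ?g y"
    have "?g (x - y) = 0" using xy(3) by (simp add: g.diff)
    then have 0: "(x - y) k = 0" if "k \<in> {1..n}" for k
      using indep[of "x - y"] that unfolding linear_of_basis_def by blast
    have "x k = y k" for k
      using xy(1,2) 0[of k] by (cases "k \<in> {1..n}") (auto simp: coord_space_def)
    then show "x = y" by (rule ext)
  qed
  let ?B = "basis_vec ` {1..n}"
  have ind: "cvec.independent (?g ` ?B)"
    by (rule g.independent_injective_image[OF independent_basis_vec]) (simp only: span_basis_vec inj)
  have sub: "?g ` ?B \<subseteq> ?V" using linear_of_basis_closed[of n w] w by blast
  have card: "card (?g ` ?B) = card ?B"
    by (intro card_image inj_on_subset[OF inj]) (auto intro: basis_vec_coord_space)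
  have "v \<in> cvec.span (?g ` ?B)" if v: "v \<in> ?V" for v
  proof (rule ccontr)
    assume nv: "v \<notin> cvec.span (?g ` ?B)"
    have "cvec.independent (insert v (?g ` ?B))" by (rule cvec.independent_insertI[OF nv ind])
    moreover have "insert v (?g ` ?B) \<subseteq> cvec.span ?B" using v sub by (simp only: span_basis_vec insert_subset simp_thms)
    ultimately have "card (insert v (?g ` ?B)) \<le> card ?B"
      using cvec.independent_span_bound[of ?B "insert v (?g ` ?B)"] by blast
    moreover have "v \<notin> ?g ` ?B" using nv cvec.span_base[of v "?g ` ?B"] by blast
    then have "card (insert v (?g ` ?B)) = Suc (card (?g ` ?B))"
      by (intro card_insert_disjoint finite_imageI finite_atLeastAtMost)
    ultimately show False using card by linarith
  qed
  then have "?V \<subseteq> cvec.span (?g ` ?B)" by blast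
  also have "\<dots> = ?g ` ?V" by (simp only: g.span_image span_basis_vec)
  finally have "?V \<subseteq> ?g ` ?V" .
  moreover have "?g ` ?V \<subseteq> ?V" using linear_of_basis_closed[of n w] w by blast
  ultimately have "?g ` ?V = ?V" by blast
  with inj have "bij_betw ?g ?V ?V" unfolding bij_betw_def by blast
  then show ?thesis unfolding GL_def using linear_linear_of_basis by blast
qed

text \<open>The weights are 0 at theta, 1 at X_1, the interval from 2m-4 to 4m-6, then 6m-11 and
  6m-10; for m >= 4 these ranges are disjoint.\<close>

lemma inj_weight: "m \<ge> 4 \<Longrightarrow> inj_on (weight m) {1..2*m+3}"
  by (rule inj_onI) (auto simp: weight_def split: if_splits)

text \<open>Transports the table from the standard basis to an arbitrary family along the linear map
  between them.\<close>

lemma r_table_linear: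
  assumes "m \<ge> 4" "i \<in> {1..2*m+3}" "j \<in> {1..2*m+3}"
    and g: "Vector_Spaces.linear cscale cscale g" "\<And>k. k \<in> {1..2*m+3} \<Longrightarrow> g (w k) = w' k"
  shows "g (r_table m w i j) = r_table m w' i j"
proof -
  interpret g: Vector_Spaces.linear cscale cscale g by (rule g(1))
  obtain k c where "k \<in> {1..2*m+3}" "\<And>w. r_table m w i j = cscale c (w k)"
    using r_table_monomial[OF assms(1-3)] by metis
  then show ?thesis by (simp add: g.scale g(2))
qed

lemma weight_cases:
  assumes m: "m \<ge> 4" and k: "k \<in> {1..2*m+3}"
  obtains "weight m k = 1" | "k \<in> {2..2*m}" "weight m k + 6 = 2*m + k" | "weight m k + 11 = 6*m"
    | "weight m k + 10 = 6*m" | "weight m k = 0"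
proof -
  consider "k = 1" | "k \<in> {2..2*m}" | "k = 2*m+1" | "k = 2*m+2" | "k = 2*m+3" using k by fastforce
  then show ?thesis using that weight_simps[OF m] m by cases auto
qed

text \<open>Nonzero eigenvectors suffice as data: as the weights are distinct,
  \<open>w_independent\<close> and \<open>basis_GL\<close> make \<open>w\<close> a basis.\<close>

locale weight_basis =
  fixes m :: nat and C :: structure_constants and w :: "nat \<Rightarrow> cvec"
  assumes m: "m \<ge> 4" and C: "C \<in> lie_laws (2*m+3)"
    and w_closed: "\<And>k. k \<in> {1..2*m+3} \<Longrightarrow> w k \<in> coord_space (2*m+3)"
    and w_nonzero: "\<And>k. k \<in> {1..2*m+3} \<Longrightarrow> w k \<noteq> 0"
    and theta: "\<And>k. k \<in> {1..2*m+3} \<Longrightarrow>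
      bilinear_of (2*m+3) C (w (2*m+3)) (w k) = cscale (of_nat (weight m k)) (w k)"
begin

abbreviation "n \<equiv> 2*m+3"
abbreviation "br \<equiv> bilinear_of n C"

lemma br_closed: "br x y \<in> coord_space n"
  using C by (simp add: lie_laws_iff bilinear_of_closed)

lemma br_antisym: "i \<in> {1..n} \<Longrightarrow> j \<in> {1..n} \<Longrightarrow> br (w i) (w j) = - br (w j) (w i)"
  by (rule lie_laws_antisym[OF C w_closed w_closed])

lemma br_self: "i \<in> {1..n} \<Longrightarrow> br (w i) (w i) = 0"
  using C w_closed by (simp add: lie_laws_iff)

lemma br_derivation:
  assumes "i \<in> {1..n}" "j \<in> {1..n}" "k \<in> {1..n}"
  shows "br (w i) (br (w j) (w k)) = br (br (w i) (w j)) (w k) + br (w j) (br (w i) (w k))"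
  by (rule lie_laws_derivation[OF C]; rule w_closed; rule assms)

lemma linear_ad: "Vector_Spaces.linear cscale cscale (br x)"
  by unfold_locales (simp_all add: bilinear_of_linear)

lemma w_independent:
  assumes "(\<Sum>k = 1..n. cscale (a k) (w k)) = 0" "k \<in> {1..n}"
  shows "a k = 0"
proof (rule independent_eigenvectors[where S = "{1..n}" and W = "\<lambda>k. of_nat (weight m k)" and D = "br (w n)" and w = w and a = a])
  show "inj_on (\<lambda>k. of_nat (weight m k) :: complex) {1..n}"
    using inj_weight[OF m] by (auto simp: inj_on_def)
qed (use assms theta w_nonzero linear_ad in auto)

lemma basis_GL: "linear_of_basis n w \<in> GL n"
proof (rule linear_of_basis_GL)
  show "a k = 0" if "(\<Sum>k = 1..n. cscale (a k) (w k)) = 0" "k \<in> {1..n}" for a k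
    using that by (rule w_independent)
qed (rule w_closed)

text \<open>As ad w_n is a derivation, the bracket is an eigenvector for the sum of the weights;
  comparing coefficients in the basis of eigenvectors kills those of any other weight.\<close>

lemma br_expansion:
  assumes i: "i \<in> {1..n}" and j: "j \<in> {1..n}"
  obtains x where "br (w i) (w j) = (\<Sum>k = 1..n. cscale (x k) (w k))"
    "\<And>k. k \<in> {1..n} \<Longrightarrow> weight m k \<noteq> weight m i + weight m j \<Longrightarrow> x k = 0"
proof -
  interpret D: Vector_Spaces.linear cscale cscale "br (w n)" by (rule linear_ad)
  have n: "n \<in> {1..n}" by simp
  let ?c = "of_nat (weight m i) + of_nat (weight m j) :: complex"
  have "linear_of_basis n w ` coord_space n = coord_space n"
    using basis_GL by (simp add: GL_def bij_betw_def)
  then have "br (w i) (w j) \<in> linear_of_basis n w ` coord_space n" by (simp only: br_closed)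
  then obtain x where x: "br (w i) (w j) = (\<Sum>k = 1..n. cscale (x k) (w k))"
    unfolding linear_of_basis_def by blast
  have "br (w n) (br (w i) (w j)) = cscale ?c (br (w i) (w j))"
    unfolding br_derivation[OF n i j] theta[OF i] theta[OF j]
    by (simp add: bilinear_of_linear cvec.scale_left_distrib)
  moreover have "br (w n) (br (w i) (w j)) = (\<Sum>k = 1..n. cscale (x k * of_nat (weight m k)) (w k))"
    unfolding x D.sum D.scale by (intro sum.cong refl) (simp only: theta cscale_simps)
  ultimately have eq: "(\<Sum>k = 1..n. cscale (x k * of_nat (weight m k)) (w k)) =
      cscale ?c (\<Sum>k = 1..n. cscale (x k) (w k))" by (simp only: x)
  have "(\<Sum>k = 1..n. cscale (x k * (of_nat (weight m k) - ?c)) (w k)) = 0"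
  proof
    fix l
    have "(\<Sum>k = 1..n. x k * of_nat (weight m k) * w k l) = ?c * (\<Sum>k = 1..n. x k * w k l)"
      using fun_cong[OF eq, of l] by (simp only: sum_fun_apply cscale_apply)
    moreover have "(\<Sum>k = 1..n. x k * (of_nat (weight m k) - ?c) * w k l) =
        (\<Sum>k = 1..n. x k * of_nat (weight m k) * w k l) - ?c * (\<Sum>k = 1..n. x k * w k l)"
      unfolding sum_distrib_left sum_subtractf[symmetric] by (intro sum.cong refl) (simp add: algebra_simps)
    ultimately show "(\<Sum>k = 1..n. cscale (x k * (of_nat (weight m k) - ?c)) (w k)) l = 0 l"
      by (simp only: sum_fun_apply cscale_apply zero_fun_apply) simp
  qed
  then have *: "x k * (of_nat (weight m k) - ?c) = 0" if "k \<in> {1..n}" for k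
    using that by (rule w_independent)
  have "x k = 0" if "k \<in> {1..n}" "weight m k \<noteq> weight m i + weight m j" for k
  proof -
    have "of_nat (weight m k) \<noteq> ?c" using that(2) by (metis of_nat_add of_nat_eq_iff)
    then show ?thesis using *[OF that(1)] by simp
  qed
  with x show ?thesis by (rule that)
qed

lemma br_zero:
  assumes "i \<in> {1..n}" "j \<in> {1..n}"
    and no: "\<And>k. k \<in> {1..n} \<Longrightarrow> weight m k \<noteq> weight m i + weight m j"
  shows "br (w i) (w j) = 0"
proof -
  obtain x where x: "br (w i) (w j) = (\<Sum>k = 1..n. cscale (x k) (w k))"
    "\<And>k. k \<in> {1..n} \<Longrightarrow> weight m k \<noteq> weight m i + weight m j \<Longrightarrow> x k = 0"
    using br_expansion[OF assms(1,2)] by metis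
  show ?thesis unfolding x(1) by (intro sum.neutral ballI) (simp only: x(2)[OF _ no] cscale_simps)
qed

text \<open>Weights are injective, so at most one term of the expansion survives.\<close>

lemma br_multiple:
  assumes "i \<in> {1..n}" "j \<in> {1..n}" "k \<in> {1..n}" "weight m k = weight m i + weight m j"
  obtains c where "br (w i) (w j) = cscale c (w k)"
proof -
  obtain x where x: "br (w i) (w j) = (\<Sum>k = 1..n. cscale (x k) (w k))"
    "\<And>k. k \<in> {1..n} \<Longrightarrow> weight m k \<noteq> weight m i + weight m j \<Longrightarrow> x k = 0"
    using br_expansion[OF assms(1,2)] by metis
  have "x k' = 0" if "k' \<in> {1..n}" "k' \<noteq> k" for k'
    using x(2)[OF that(1)] that assms(3,4) inj_onD[OF inj_weight[OF m], of k' k] by auto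
  then have "(\<Sum>k' = 1..n. cscale (x k') (w k')) = (\<Sum>k' = 1..n. if k' = k then cscale (x k) (w k) else 0)"
    by (intro sum.cong refl) (simp add: cscale_simps)
  also have "\<dots> = cscale (x k) (w k)" using assms(3) by (simp only: sum.delta finite_atLeastAtMost if_True)
  finally have "br (w i) (w j) = cscale (x k) (w k)" unfolding x(1) .
  then show ?thesis by (rule that)
qed

end

text \<open>Only these brackets are prescribed. The weights, antisymmetry and the derivation ad w_1
  force all others, so that \<open>br_table\<close> recovers the whole law.\<close>

locale graded_basis = weight_basis +
  assumes one: "\<And>j. 2 \<le> j \<Longrightarrow> j < 2*m \<Longrightarrow> bilinear_of (2*m+3) C (w 1) (w j) = w (Suc j)"
    and one_top: "bilinear_of (2*m+3) C (w 1) (w (2*m+1)) = w (2*m+2)"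
    and two_three: "bilinear_of (2*m+3) C (w 2) (w 3) = w (2*m-1)"
    and two_top: "bilinear_of (2*m+3) C (w 2) (w (2*m-1)) = w (2*m+1)"
begin

lemma low_zero:
  assumes i: "i \<in> {2..2*m}" and j: "j \<in> {2..2*m}" and s: "i + j \<notin> {5, 6, 2*m+1, 2*m+2}"
  shows "br (w i) (w j) = 0"
\<comment> \<open>For the sum 4 the weight 4m-8 is that of w_(2m-2), so weights exclude nothing; but
  then i = j = 2 and the bracket alternates.\<close>
proof (cases "i + j = 4")
  case True
  then have "i = 2" "j = 2" using i j by auto
  then show ?thesis using br_self[of 2] by simp
next
  case False
  show ?thesis
  proof (rule br_zero)
    fix k assume k: "k \<in> {1..n}"
    have sum: "weight m i + weight m j + 12 = 4*m + (i + j)" using i j m by (simp add: weight_simps)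
    have ne: "i + j \<noteq> 5" "i + j \<noteq> 6" "i + j \<noteq> 2*m+1" "i + j \<noteq> 2*m+2" "i + j \<ge> 4"
      using s i j by auto
    from m k show "weight m k \<noteq> weight m i + weight m j"
    proof (cases rule: weight_cases)
      case 2
      then have "k \<le> 2*m" by simp
      then show ?thesis using 2(2) sum ne False m by linarith
    qed (use sum ne False m in linarith)+
  qed (use i j in auto)
qed

lemma high_zero:
  assumes i: "i \<in> {2..2*m+2}" and j: "j \<in> {2..2*m+2}" and h: "i > 2*m \<or> j > 2*m"
  shows "br (w i) (w j) = 0"
proof (rule br_zero)
  have b: "weight m p \<ge> 2*m - 4" if "p \<in> {2..2*m+2}" for p
    using that m by (auto simp: weight_def)
  have t: "weight m p \<ge> 6*m - 11" if "p > 2*m" "p \<in> {2..2*m+2}" for p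
    using that m by (auto simp: weight_def)
  \<comment> \<open>One weight is at least 6m-11 and the other at least 2m-4, which together exceed
    the top weight 6m-10.\<close>
  have "weight m i + weight m j \<ge> 6*m - 9"
    using h b[OF i] b[OF j] t[OF _ i] t[OF _ j] m by linarith
  then show "weight m k \<noteq> weight m i + weight m j" for k
    using weight_bound(2)[OF m, of k] by linarith
qed (use i j in auto)

lemma one_table:
  assumes j: "j \<in> {1..2*m+2}"
  shows "br (w 1) (w j) = r_table m w 1 j"
proof -
  consider "j = 1" | "2 \<le> j" "j < 2*m" | "j = 2*m" | "j = 2*m+1" | "j = 2*m+2" using j by fastforce
  then show ?thesis
  proof cases
    case 1
    then show ?thesis using m br_self[of 1] r_table_one_left[OF j, of w] by simp
  next
    case 2
    then show ?thesis using m one[OF 2] r_table_one_left[OF j, of w] by simp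
  next
    case 3
    \<comment> \<open>The weight 4m-5 lies strictly between the consecutive weights 4m-6 and 6m-11
      because m >= 4.\<close>
    have "br (w 1) (w (2*m)) = 0"
    proof (rule br_zero)
      fix k assume "k \<in> {1..n}"
      then show "weight m k \<noteq> weight m 1 + weight m (2*m)"
        using m by (auto simp: weight_def split: if_splits)
    qed (use m in auto)
    then show ?thesis using r_table_one_left[OF j, of w] 3 m by simp
  next
    case 4
    have "Suc (2*m+1) = 2*m+2" "2 \<le> 2*m+1 \<and> 2*m+1 < 2*m \<or> 2*m+1 = 2*m+1" by simp_all
    then show ?thesis unfolding 4
      by (simp only: one_top r_table_one_left[OF j[unfolded 4]] if_True simp_thms)
  next
    case 5
    have "br (w 1) (w (2*m+2)) = 0"
    proof (rule br_zero)
      fix k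
      have "weight m 1 + weight m (2*m+2) = 6*m - 9" using m by (simp add: weight_simps)
      then show "weight m k \<noteq> weight m 1 + weight m (2*m+2)" using weight_bound(2)[OF m, of k] by simp
    qed auto
    then show ?thesis using r_table_one_left[OF j, of w] 5 m by simp
  qed
qed

lemma one_derivation:
  assumes i: "i \<in> {2..<2*m}" and j: "j \<in> {2..<2*m}"
  shows "br (w 1) (br (w i) (w j)) = br (w (Suc i)) (w j) + br (w i) (w (Suc j))"
  using br_derivation[of 1 i j] one[of i] one[of j] i j by simp

lemma sum_five:
  assumes "i \<in> {2..2*m}" "j \<in> {2..2*m}" "i + j = 5"
  shows "br (w i) (w j) = cscale (5 - 2 * of_nat i) (w (2*m-1))"
proof -
  consider "i = 2" "j = 3" | "i = 3" "j = 2" using assms by fastforce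
  then show ?thesis
  proof cases
    case 1
    then show ?thesis using two_three by (simp add: cscale_simps)
  next
    case 2
    have "br (w 3) (w 2) = cscale (-1) (w (2*m-1))"
      unfolding cscale_minus_one two_three[symmetric] by (rule br_antisym) (use m in auto)
    then show ?thesis using 2 by simp
  qed
qed

text \<open>Applying ad w_1 to [w_2, w_3] = w_(2m-1) yields [w_2, w_4] = w_(2m), since [w_3, w_3] =
  0.\<close>

lemma sum_six:
  assumes "i \<in> {2..2*m}" "j \<in> {2..2*m}" "i + j = 6"
  shows "br (w i) (w j) = cscale (3 - of_nat i) (w (2*m))"
proof -
  have mem: "2 \<in> {2..<2*m}" "3 \<in> {2..<2*m}" and S: "Suc 2 = 3" "Suc 3 = 4" using m by auto
  have "br (w 1) (br (w 2) (w 3)) = br (w 3) (w 3) + br (w 2) (w 4)"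
    using one_derivation[OF mem] by (simp only: S)
  moreover have "br (w 1) (w (2*m-1)) = w (2*m)" using one[of "2*m-1"] m by simp
  moreover have "br (w 3) (w 3) = 0" by (rule br_self) (use m in auto)
  ultimately have 24: "br (w 2) (w 4) = w (2*m)" by (simp only: two_three add_0)
  consider "i = 2" "j = 4" | "i = 3" "j = 3" | "i = 4" "j = 2" using assms by fastforce
  then show ?thesis
  proof cases
    case 1
    then show ?thesis using 24 by (simp add: cscale_simps)
  next
    case 2
    then show ?thesis using \<open>br (w 3) (w 3) = 0\<close> by (simp add: cscale_simps)
  next
    case 3
    have "br (w 4) (w 2) = cscale (-1) (w (2*m))"
      unfolding cscale_minus_one 24[symmetric] by (rule br_antisym) (use m in auto)
    then show ?thesis using 3 by simp
  qed
qed

text \<open>Brackets of index sum 2m vanish, so applying ad w_1 to them shows that consecutive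
  brackets of index sum 2m + 1 are opposite; the first one is \<open>two_top\<close>.\<close>

lemma sum_odd:
  assumes "2 \<le> i" "i \<le> 2*m-1"
  shows "br (w i) (w (2*m+1-i)) = cscale ((-1)^i) (w (2*m+1))"
  using assms
proof (induction i rule: dec_induct)
  case base
  have "2*m+1-2 = 2*m-1" by simp
  then show ?case by (simp only: two_top) (simp add: cscale_simps)
next
  case (step i)
  have i: "i \<in> {2..<2*m}" "2*m-i \<in> {2..<2*m}" "Suc (2*m-i) = 2*m+1-i" "2*m+1 - Suc i = 2*m-i"
    using step.hyps step.prems by auto
  have "br (w i) (w (2*m-i)) = 0" using i m step.hyps by (intro low_zero) auto
  then have "0 = br (w (Suc i)) (w (2*m-i)) + br (w i) (w (2*m+1-i))"
    using one_derivation[OF i(1,2)] by (simp add: i(3))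
  then have "br (w (Suc i)) (w (2*m-i)) = - cscale ((-1)^i) (w (2*m+1))"
    using step.IH step.prems by (simp add: eq_neg_iff_add_eq_0)
  then show ?case unfolding i(4) by (simp add: cscale_def fun_eq_iff)
qed

text \<open>By weight these brackets are multiples d_i w_(2m+2). Applying ad w_1 to the brackets of
  index sum 2m + 1 gives d_(i+1) + d_i = (-1)^i, so (-1)^i d_i + i is constant in i.\<close>

lemma sum_even:
  assumes i: "2 \<le> i" "i \<le> 2*m"
  shows "br (w i) (w (2*m+2-i)) = cscale ((-1)^i * (of_nat m + 1 - of_nat i)) (w (2*m+2))"
proof -
  have "\<exists>c. br (w i) (w (2*m+2-i)) = cscale c (w (2*m+2))" if "i \<in> {2..2*m}" for i
  proof -
    have i: "i \<in> {2..2*m}" "2*m+2-i \<in> {2..2*m}" "i \<in> {1..n}" "2*m+2-i \<in> {1..n}" "2*m+2 \<in> {1..n}"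
      using that by auto
    have "weight m (2*m+2) = weight m i + weight m (2*m+2-i)"
      using m that by (simp add: weight_simps(2)[OF m i(1)] weight_simps(2)[OF m i(2)] weight_simps(4)[OF m])
    then show ?thesis using br_multiple[OF i(3,4,5)] by metis
  qed
  then obtain d where d: "\<And>i. i \<in> {2..2*m} \<Longrightarrow> br (w i) (w (2*m+2-i)) = cscale (d i) (w (2*m+2))"
    by metis
  obtain l where l: "w (2*m+2) l \<noteq> 0" using w_nonzero[of "2*m+2"] by (auto simp: fun_eq_iff)
  have rec: "d (Suc i) + d i = (-1)^i" if i: "2 \<le> i" "i \<le> 2*m-1" for i
  proof -
    have i': "i \<in> {2..<2*m}" "2*m+1-i \<in> {2..<2*m}" "Suc (2*m+1-i) = 2*m+2-i" "2*m+2-Suc i = 2*m+1-i"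
      "Suc i \<in> {2..2*m}" "i \<in> {2..2*m}" using i by auto
    have "br (w 1) (br (w i) (w (2*m+1-i))) = cscale ((-1)^i) (w (2*m+2))"
      by (simp only: sum_odd[OF i] bilinear_of_linear one_top)
    moreover have "br (w 1) (br (w i) (w (2*m+1-i))) = cscale (d (Suc i)) (w (2*m+2)) + cscale (d i) (w (2*m+2))"
      using one_derivation[OF i'(1,2)] d[OF i'(5)] d[OF i'(6)] by (simp only: i'(3,4))
    ultimately have "(-1)^i * w (2*m+2) l = d (Suc i) * w (2*m+2) l + d i * w (2*m+2) l"
      by (metis (no_types, lifting) cscale_apply plus_fun_apply)
    then have "(-1)^i * w (2*m+2) l = (d (Suc i) + d i) * w (2*m+2) l" by (simp only: distrib_right)
    then show ?thesis using l by simp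
  qed
  have const: "(-1)^i * d i + of_nat i = d 2 + 2" if "2 \<le> i" "i \<le> 2*m" for i
    using that
  proof (induction i rule: dec_induct)
    case (step i)
    then have "d (Suc i) = (-1)^i - d i" using rec[of i] by (simp add: eq_diff_eq)
    moreover have "(-1)^i * (-1)^i = (1::complex)" by (simp flip: power_mult_distrib)
    ultimately have "(-1)^Suc i * d (Suc i) + of_nat (Suc i) = (-1)^i * d i + of_nat i"
      by (simp add: right_diff_distrib)
    then show ?case using step by simp
  qed simp
  \<comment> \<open>The middle index is paired with itself, so d_(m+1) = 0; this fixes the constant
    that the recursion leaves free.\<close>
  have "br (w (m+1)) (w (2*m+2-(m+1))) = cscale (d (m+1)) (w (2*m+2))"
    by (rule d) (use m in auto)
  moreover have "2*m+2-(m+1) = m+1" by simp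
  moreover have "br (w (m+1)) (w (m+1)) = 0" by (rule br_self) (use m in auto)
  ultimately have "cscale (d (m+1)) (w (2*m+2)) = 0" by (simp only:)
  then have "d (m+1) * w (2*m+2) l = 0" by (metis cscale_apply zero_fun_apply)
  then have "d (m+1) = 0" using l by simp
  then have "d 2 + 2 = of_nat m + 1" using const[of "m+1"] m by simp
  then have "(-1)^i * d i = of_nat m + 1 - of_nat i" using const[OF i] by (simp add: eq_diff_eq)
  then have "(-1)^i * ((-1)^i * d i) = (-1)^i * (of_nat m + 1 - of_nat i)" by simp
  then have "d i = (-1)^i * (of_nat m + 1 - of_nat i)"
    by (simp only: mult.assoc[symmetric] power_mult_distrib[symmetric]) simp
  then show ?thesis using d[of i] i by simp
qed

lemma br_table:
  assumes i: "i \<in> {1..n}" and j: "j \<in> {1..n}"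
  shows "br (w i) (w j) = r_table m w i j"
  using assms
proof (cases rule: index_pair_cases)
  case theta1
  then show ?thesis using theta[OF j] by (simp add: r_table_theta_left)
next
  case theta2
  have "br (w i) (w n) = - br (w n) (w i)" by (rule br_antisym[OF i]) simp
  then show ?thesis using theta2 theta[OF i]
    by (simp add: r_table_theta_right[OF m] cscale_def fun_eq_iff)
next
  case one1
  then show ?thesis using one_table by simp
next
  case one2
  have "br (w i) (w 1) = - br (w 1) (w i)" by (rule br_antisym[OF i]) simp
  also have "\<dots> = - r_table m w 1 i" using one2 one_table[of i] by simp
  also have "\<dots> = r_table m w i 1"
    using one2 by (simp add: r_table_one_left r_table_one_right cscale_minus_one)
  finally show ?thesis using one2 by simp
next
  case high
  then show ?thesis by (simp only: high_zero r_table_high)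
next
  case low
  note t = r_table_low[OF m low]
  show ?thesis
  proof (cases rule: index_sum_cases[where s = "i + j" and m = m])
    case 1
    then show ?thesis by (simp only: t(1) sum_five[OF low])
  next
    case 2
    then show ?thesis by (simp only: t(2) sum_six[OF low])
  next
    case 3
    then have "j = 2*m+1-i" "2 \<le> i" "i \<le> 2*m-1" using low by auto
    then show ?thesis using t(3)[OF 3] sum_odd[of i] by simp
  next
    case 4
    then have "j = 2*m+2-i" "2 \<le> i" "i \<le> 2*m" using low by auto
    then show ?thesis using t(4)[OF 4] sum_even[of i] by simp
  next
    case 5
    then show ?thesis by (simp only: t(5)[OF 5] low_zero[OF low 5])
  qed
qed

lemma in_orbit: "C \<in> orbit n (r_law m)"
proof -
  let ?g = "linear_of_basis n w"
  have "intertwines n ?g (r_law m) C"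
  proof (rule intertwinesI_basis[OF basis_GL])
    fix i j assume ij: "i \<in> {1..n}" "j \<in> {1..n}"
    have "?g (bilinear_of n (r_law m) (basis_vec i) (basis_vec j)) = ?g (r_table m basis_vec i j)"
      using r_bracket_basis_vec[OF m ij] by (simp only: r_bracket_def)
    also have "\<dots> = r_table m w i j"
      by (rule r_table_linear[OF m ij linear_linear_of_basis linear_of_basis_basis_vec])
    also have "\<dots> = br (?g (basis_vec i)) (?g (basis_vec j))"
      by (simp only: linear_of_basis_basis_vec ij br_table[OF ij])
    finally show "?g (bilinear_of n (r_law m) (basis_vec i) (basis_vec j)) =
      br (?g (basis_vec i)) (?g (basis_vec j))" .
  qed
  then show ?thesis
    using C basis_GL unfolding orbit_iff[OF law_support_r_law[OF m]] lie_laws_iff by blast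
qed

end


section \<open>A generic condition on laws\<close>

definition coordinate_functions :: "(structure_constants \<Rightarrow> complex) set" where
  "coordinate_functions = {\<lambda>C. C i j l | i j l. True}"

lemma polynomial_functions_eq: "polynomial_functions = poly_fun coordinate_functions"
proof
  show "polynomial_functions \<subseteq> poly_fun coordinate_functions"
  proof
    fix p assume "p \<in> polynomial_functions"
    then show "p \<in> poly_fun coordinate_functions"
    proof induction
      case (coord i j l)
      then show ?case by (intro poly_fun.gen) (auto simp: coordinate_functions_def)
    qed (auto intro: poly_fun.intros)
  qed
  show "poly_fun coordinate_functions \<subseteq> polynomial_functions"
  proof
    fix p assume "p \<in> poly_fun coordinate_functions"
    then show "p \<in> polynomial_functions"
    proof induction
      case (gen g)
      then show ?case by (auto simp: coordinate_functions_def intro: polynomial_functions.coord)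
    qed (auto intro: polynomial_functions.intros)
  qed
qed

lemma poly_fun_coordinate: "(\<lambda>C. C i j l) \<in> poly_fun coordinate_functions"
  by (rule poly_fun.gen) (auto simp: coordinate_functions_def)

lemma polynomial_functions_compose:
  assumes "p \<in> polynomial_functions" "\<And>i j l. (\<lambda>C. T C i j l) \<in> poly_fun G"
  shows "(\<lambda>C. p (T C)) \<in> poly_fun G"
  using assms(1) by induction (auto intro: poly_fun.intros assms(2))

lemma poly_fun_bilinear_of:
  assumes "\<And>i j l. (\<lambda>x. C x i j l) \<in> poly_fun G"
    "\<And>i. (\<lambda>x. u x i) \<in> poly_fun G" "\<And>i. (\<lambda>x. v x i) \<in> poly_fun G"
  shows "(\<lambda>x. bilinear_of n (C x) (u x) (v x) l) \<in> poly_fun G"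
  unfolding bilinear_of_def by (intro poly_fun_sum poly_fun.mult assms)

text \<open>The matrix of ad X_n with images in columns: entry (i, j) is the coefficient of X_i in
  [X_n, X_j], hence the exchanged indices. Below, n = 2m + 3 is the index of theta.\<close>

definition ad_matrix :: "nat \<Rightarrow> structure_constants \<Rightarrow> nat \<Rightarrow> nat \<Rightarrow> complex" where
  "ad_matrix n C i j = C n j i"

text \<open>The columns of the adjugate of \<open>t - ad X\<^sub>n\<close>, which are eigenvectors whenever \<open>t\<close> is an eigenvalue.\<close>

definition adjugate_column :: "nat \<Rightarrow> structure_constants \<Rightarrow> complex \<Rightarrow> nat \<Rightarrow> cvec" where
  "adjugate_column n C t a =
    (\<lambda>l. if l \<in> {1..n} \<and> a \<in> {1..n} then adjugate n (char_mat (ad_matrix n C) t) l a else 0)"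

definition ad_eigenvalue :: "nat \<Rightarrow> structure_constants \<Rightarrow> complex \<Rightarrow> bool" where
  "ad_eigenvalue n C t \<longleftrightarrow> det (coord_mat n (char_mat (ad_matrix n C) t)) = 0"

lemma poly_fun_ad_char_mat:
  assumes "\<And>i j l. (\<lambda>x. C x i j l) \<in> poly_fun G" "t \<in> poly_fun G"
  shows "(\<lambda>x. char_mat (ad_matrix n (C x)) (t x) i j) \<in> poly_fun G"
  unfolding char_mat_def ad_matrix_def
  by (cases "i = j") (auto intro!: poly_fun_intros assms)

lemma poly_fun_adjugate_column:
  assumes "\<And>i j l. (\<lambda>x. C x i j l) \<in> poly_fun G" "t \<in> poly_fun G"
  shows "(\<lambda>x. adjugate_column n (C x) (t x) a l) \<in> poly_fun G"
proof (cases "l \<in> {1..n} \<and> a \<in> {1..n}")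
  case True
  then show ?thesis
    using poly_fun_adjugate[of "\<lambda>x. char_mat (ad_matrix n (C x)) (t x)" G l n a] poly_fun_ad_char_mat[OF assms]
    by (simp add: adjugate_column_def)
next
  case False
  then show ?thesis by (simp only: adjugate_column_def if_False poly_fun.const)
qed

lemma bilinear_of_last:
  assumes "n \<ge> 1"
  shows "bilinear_of n C (basis_vec n) y i = (\<Sum>j = 1..n. ad_matrix n C i j * y j)"
proof -
  have "bilinear_of n C (basis_vec n) y i =
      (\<Sum>i' = 1..n. if i' = n then \<Sum>j = 1..n. ad_matrix n C i j * y j else 0)"
    unfolding bilinear_of_def
    by (intro sum.cong refl) (auto simp: basis_vec_def ad_matrix_def mult.commute)
  also have "\<dots> = (\<Sum>j = 1..n. ad_matrix n C i j * y j)"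
    using assms by (simp only: sum.delta finite_atLeastAtMost) simp
  finally show ?thesis .
qed

lemma sum_char_mat:
  assumes "i \<in> {1..n}"
  shows "(\<Sum>j = 1..n. char_mat M t i j * y j) = t * y i - (\<Sum>j = 1..n. M i j * y j)"
proof -
  have "(\<Sum>j = 1..n. char_mat M t i j * y j) =
      (\<Sum>j = 1..n. if j = i then t * y i else 0) - (\<Sum>j = 1..n. M i j * y j)"
    unfolding sum_subtractf[symmetric]
    by (intro sum.cong refl) (simp add: char_mat_def left_diff_distrib)
  then show ?thesis using assms by (simp only: sum.delta finite_atLeastAtMost if_True)
qed

lemma adjugate_column_closed: "adjugate_column n C t a \<in> coord_space n"
  by (simp add: adjugate_column_def coord_space_def)

text \<open>(t - D) adj(t - D) = det(t - D) = 0 for D = ad X_n.\<close>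

lemma ad_adjugate_column:
  assumes C: "law_support n C" and n: "n \<ge> 1" and a: "a \<in> {1..n}" and t: "ad_eigenvalue n C t"
  shows "bilinear_of n C (basis_vec n) (adjugate_column n C t a) = cscale t (adjugate_column n C t a)"
proof
  fix i
  let ?y = "adjugate_column n C t a" and ?M = "char_mat (ad_matrix n C) t"
  show "bilinear_of n C (basis_vec n) ?y i = cscale t ?y i"
  proof (cases "i \<in> {1..n}")
    case True
    have "(\<Sum>j = 1..n. ?M i j * ?y j) = (\<Sum>j = 1..n. ?M i j * adjugate n ?M j a)"
      using a by (intro sum.cong refl) (simp add: adjugate_column_def)
    also have "\<dots> = 0" using t mult_adjugate[OF True a, of ?M] by (simp add: ad_eigenvalue_def)
    finally show ?thesis
      using sum_char_mat[OF True, of "ad_matrix n C" t ?y] by (simp add: bilinear_of_last[OF n] cscale_apply)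
  next
    case False
    have "bilinear_of n C (basis_vec n) ?y i = 0"
      using bilinear_of_closed[OF C] False unfolding coord_space_def by blast
    moreover have "?y i = 0" using False by (simp only: adjugate_column_def if_False simp_thms)
    ultimately show ?thesis by (simp add: cscale_apply)
  qed
qed

text \<open>The i-th coordinate of adj(t - D) y for D = ad X_n. At a simple eigenvalue t, adj(t - D)
  is a nonzero multiple of the projection onto the eigenspace, so this is a polynomial substitute
  for the component of y there.\<close>

definition adjugate_apply :: "nat \<Rightarrow> structure_constants \<Rightarrow> complex \<Rightarrow> nat \<Rightarrow> cvec \<Rightarrow> complex" where
  "adjugate_apply n C t i y = (\<Sum>j = 1..n. adjugate_column n C t j i * y j)"

text \<open>Apply adj(t - D) (t - D) = det(t - D) to y, where (t - D) y = (t - s) y. It is used in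
  two ways: with t = s and y nonzero it gives det = 0, and with det = 0 a nonzero value of
  \<open>adjugate_apply\<close> gives t = s.\<close>

lemma adjugate_apply_eigenvector:
  assumes n: "n \<ge> 1" and i: "i \<in> {1..n}"
    and y: "bilinear_of n C (basis_vec n) y = cscale s y"
  shows "(t - s) * adjugate_apply n C t i y = det (coord_mat n (char_mat (ad_matrix n C) t)) * y i"
proof -
  let ?M = "char_mat (ad_matrix n C) t"
  have key: "(\<Sum>k = 1..n. ?M j k * y k) = (t - s) * y j" if "j \<in> {1..n}" for j
    using sum_char_mat[OF that, of "ad_matrix n C" t y] fun_cong[OF y, of j]
    by (simp add: bilinear_of_last[OF n] cscale_apply left_diff_distrib)
  have "(t - s) * adjugate_apply n C t i y = (\<Sum>j = 1..n. adjugate n ?M i j * ((t - s) * y j))"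
    unfolding adjugate_apply_def sum_distrib_left using i
    by (intro sum.cong refl) (simp add: adjugate_column_def)
  also have "\<dots> = (\<Sum>j = 1..n. adjugate n ?M i j * (\<Sum>k = 1..n. ?M j k * y k))"
    by (intro sum.cong refl) (simp only: key)
  also have "\<dots> = (\<Sum>k = 1..n. (\<Sum>j = 1..n. adjugate n ?M i j * ?M j k) * y k)"
    unfolding sum_distrib_left sum_distrib_right by (subst sum.swap) (simp only: mult.assoc)
  also have "\<dots> = (\<Sum>k = 1..n. if k = i then det (coord_mat n ?M) * y i else 0)"
    by (intro sum.cong refl) (simp only: adjugate_mult[OF i], simp)
  also have "\<dots> = det (coord_mat n ?M) * y i"
    using i by (simp only: sum.delta finite_atLeastAtMost if_True)
  finally show ?thesis .
qed

definition chain :: "nat \<Rightarrow> structure_constants \<Rightarrow> complex \<Rightarrow> complex \<Rightarrow> nat \<Rightarrow> cvec" where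
  "chain m C \<alpha> \<mu> k = (bilinear_of (2*m+3) C (adjugate_column (2*m+3) C \<alpha> 1) ^^ (k - 2))
     (adjugate_column (2*m+3) C \<mu> 2)"

definition top1 :: "nat \<Rightarrow> structure_constants \<Rightarrow> complex \<Rightarrow> complex \<Rightarrow> cvec" where
  "top1 m C \<alpha> \<mu> = bilinear_of (2*m+3) C (chain m C \<alpha> \<mu> 2) (chain m C \<alpha> \<mu> (2*m-1))"

definition top2 :: "nat \<Rightarrow> structure_constants \<Rightarrow> complex \<Rightarrow> complex \<Rightarrow> cvec" where
  "top2 m C \<alpha> \<mu> = bilinear_of (2*m+3) C (adjugate_column (2*m+3) C \<alpha> 1) (top1 m C \<alpha> \<mu>)"

text \<open>Nonvanishing of v_(2m) forces v_1 and all earlier v_k to be nonzero, and that of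
  \<open>top2\<close> does so for \<open>top1\<close>. The last factor has the eigenvalue of
  v_(2m-1) as its parameter, 2m-3 being (2m-1) - 2. The coordinates tested are those that survive at
  \<open>r_law m\<close>.\<close>

definition genericity :: "nat \<Rightarrow> structure_constants \<Rightarrow> complex \<Rightarrow> complex \<Rightarrow> complex" where
  "genericity m C \<alpha> \<mu> = \<alpha> * chain m C \<alpha> \<mu> (2*m) (2*m) * top2 m C \<alpha> \<mu> (2*m+2) *
     adjugate_apply (2*m+3) C (of_nat (2*m-3) * \<alpha> + \<mu>) (2*m-1)
       (bilinear_of (2*m+3) C (chain m C \<alpha> \<mu> 2) (chain m C \<alpha> \<mu> 3))"

text \<open>Points are nested as ((C, \<alpha>), \<mu>), so that \<mu> is eliminated before
  \<alpha>.\<close>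

lemma poly_fun_genericity:
  "(\<lambda>x. genericity m (fst (fst x)) (snd (fst x)) (snd x)) \<in>
    poly_fun (adjoin_variable (adjoin_variable coordinate_functions))"
proof -
  let ?G = "adjoin_variable (adjoin_variable coordinate_functions)"
  have C: "(\<lambda>x. fst (fst x) i j l) \<in> poly_fun ?G" for i j l
    by (rule poly_fun_adjoin_fst[of "\<lambda>x. fst x i j l"], rule poly_fun_adjoin_fst[of "\<lambda>C. C i j l"],
        rule poly_fun_coordinate)
  have L: "(\<lambda>x. snd (fst x)) \<in> poly_fun ?G"
    by (rule poly_fun_adjoin_fst[of "\<lambda>x. snd x"], rule poly_fun_adjoin_snd)
  have M: "(\<lambda>x. snd x) \<in> poly_fun ?G" by (rule poly_fun_adjoin_snd)
  have ch: "(\<lambda>x. chain m (fst (fst x)) (snd (fst x)) (snd x) k l) \<in> poly_fun ?G" for k l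
  proof -
    have "(\<lambda>x. (bilinear_of (2*m+3) (fst (fst x)) (adjugate_column (2*m+3) (fst (fst x)) (snd (fst x)) 1) ^^ k)
       (adjugate_column (2*m+3) (fst (fst x)) (snd x) 2) l) \<in> poly_fun ?G" for k l
      by (induction k arbitrary: l)
        (simp_all add: poly_fun_bilinear_of poly_fun_adjugate_column C L M)
    then show ?thesis by (simp only: chain_def)
  qed
  have t1: "(\<lambda>x. top1 m (fst (fst x)) (snd (fst x)) (snd x) l) \<in> poly_fun ?G" for l
    unfolding top1_def by (intro poly_fun_bilinear_of C ch)
  have t2: "(\<lambda>x. top2 m (fst (fst x)) (snd (fst x)) (snd x) l) \<in> poly_fun ?G" for l
    unfolding top2_def by (intro poly_fun_bilinear_of C t1 poly_fun_adjugate_column L)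
  have nu: "(\<lambda>x. of_nat (2*m-3) * snd (fst x) + snd x) \<in> poly_fun ?G"
    by (intro poly_fun_intros L M)
  show ?thesis
    unfolding genericity_def adjugate_apply_def
    by (intro poly_fun.mult poly_fun_sum L ch t2 poly_fun_bilinear_of C poly_fun_adjugate_column nu)
qed


section \<open>Rigidity\<close>

lemma chain_2: "chain m C \<alpha> \<mu> 2 = adjugate_column (2*m+3) C \<mu> 2"
  by (simp add: chain_def)

lemma chain_Suc: "k \<ge> 2 \<Longrightarrow>
  chain m C \<alpha> \<mu> (Suc k) = bilinear_of (2*m+3) C (adjugate_column (2*m+3) C \<alpha> 1) (chain m C \<alpha> \<mu> k)"
  by (simp only: chain_def Suc_diff_le funpow.simps o_apply)

lemma genericity_imp_orbit:
  assumes m: "m \<ge> 4" and C: "C \<in> lie_laws (2*m+3)"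
    and ev: "ad_eigenvalue (2*m+3) C \<alpha>" "ad_eigenvalue (2*m+3) C \<mu>"
    and gen: "genericity m C \<alpha> \<mu> \<noteq> 0"
  shows "C \<in> orbit (2*m+3) (r_law m)"
proof -
  let ?n = "2*m+3"
  let ?V = "coord_space ?n"
  define br where "br = bilinear_of ?n C"
  define E where "E = br (basis_vec ?n)"
  define v1 where "v1 = adjugate_column ?n C \<alpha> 1"
  define v where "v = chain m C \<alpha> \<mu>"
  define z where "z = br (v 2) (v 3)"
  define \<nu> where "\<nu> = of_nat (2*m-3) * \<alpha> + \<mu>"
  define t1 where "t1 = top1 m C \<alpha> \<mu>"
  define t2 where "t2 = top2 m C \<alpha> \<mu>"
  have supp: "law_support ?n C" using C by (simp add: lie_laws_iff)
  have n1: "?n \<ge> 1" by simp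
  have cl: "br x y \<in> ?V" for x y unfolding br_def by (rule bilinear_of_closed[OF supp])
  have eV: "basis_vec ?n \<in> ?V" by (rule basis_vec_coord_space) simp
  have lin: "br 0 x = 0" "br x 0 = 0" "br (cscale c x) y = cscale c (br x y)" "br x (cscale c y) = cscale c (br x y)"
    for c x y by (simp_all add: br_def bilinear_of_linear)
  have t1: "t1 = br (v 2) (v (2*m-1))" by (simp only: t1_def top1_def br_def v_def)
  have t2: "t2 = br v1 t1" by (simp only: t2_def top2_def br_def t1_def v1_def)
  have nz: "\<alpha> \<noteq> 0" "v (2*m) \<noteq> 0" "t2 \<noteq> 0" "adjugate_apply ?n C \<nu> (2*m-1) z \<noteq> 0"
    using gen by (auto simp: genericity_def v_def t2_def \<nu>_def z_def br_def)
  \<comment> \<open>ad X_theta is a derivation, so eigenvalues add under brackets.\<close>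
  have prod: "E (br x y) = cscale (s + t) (br x y)"
    if "x \<in> ?V" "y \<in> ?V" "E x = cscale s x" "E y = cscale t y" for x y s t
    using lie_laws_derivation[OF C eV that(1,2)] that(3,4)
    by (simp add: E_def br_def bilinear_of_linear cvec.scale_left_distrib)
  have v1: "v1 \<in> ?V" "E v1 = cscale \<alpha> v1"
    unfolding v1_def E_def br_def
    by (rule adjugate_column_closed) (rule ad_adjugate_column[OF supp n1 _ ev(1)], simp)
  have v_Suc: "v (Suc k) = br v1 (v k)" if "k \<ge> 2" for k
    unfolding v_def v1_def br_def by (rule chain_Suc[OF that])
  have v2: "v 2 \<in> ?V" "E (v 2) = cscale \<mu> (v 2)"
    unfolding v_def chain_2 E_def br_def
    by (rule adjugate_column_closed) (rule ad_adjugate_column[OF supp n1 _ ev(2)], simp)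
  have v: "v k \<in> ?V \<and> E (v k) = cscale (\<mu> + of_nat (k - 2) * \<alpha>) (v k)" if "k \<ge> 2" for k
    using that
  proof (induction k rule: dec_induct)
    case base
    then show ?case using v2 by simp
  next
    case (step k)
    have "E (br v1 (v k)) = cscale (\<alpha> + (\<mu> + of_nat (k - 2) * \<alpha>)) (br v1 (v k))"
      using prod v1 step.IH by blast
    moreover have "\<alpha> + (\<mu> + of_nat (k - 2) * \<alpha>) = \<mu> + of_nat (Suc k - 2) * \<alpha>"
      using step.hyps by (simp add: Suc_diff_le algebra_simps)
    ultimately show ?case using cl by (simp only: v_Suc[OF step.hyps(1)])
  qed
  \<comment> \<open>Each later vector of the chain is a bracket with its predecessor, so a zero
    would propagate up to v_(2m).\<close>
  have vnz: "v k \<noteq> 0" if k: "k \<ge> 2" "k \<le> 2*m" for k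
  proof
    assume 0: "v k = 0"
    from k(2) have "v (2*m) = 0"
    proof (induction rule: dec_induct)
      case (step j)
      then have "2 \<le> j" using k by simp
      then show ?case by (simp only: v_Suc step.IH lin)
    qed (rule 0)
    then show False using nz(2) by simp
  qed
  have v1nz: "v1 \<noteq> 0"
  proof
    assume "v1 = 0"
    then have "v (Suc 2) = 0" using v_Suc[of 2] by (simp add: lin)
    then show False using vnz[of "Suc 2"] m by simp
  qed
  have t1nz: "t1 \<noteq> 0" using nz(3) by (auto simp: t2 lin)
  have znz: "z \<noteq> 0"
  proof
    assume "z = 0"
    then have "adjugate_apply ?n C \<nu> (2*m-1) z = 0" by (simp add: adjugate_apply_def)
    then show False using nz(4) by simp
  qed
  have Ez: "E z = cscale (2 * \<mu> + \<alpha>) z"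
    using prod[OF _ _ _ conjunct2[OF v[of 3]], of "v 2" \<mu>] v[of 3] v2 by (simp add: z_def algebra_simps)
  have vl: "v (2*m-1) \<in> ?V" "E (v (2*m-1)) = cscale \<nu> (v (2*m-1))"
  proof -
    have "2*m - 1 - 2 = 2*m - 3" "2*m-1 \<ge> 2" using m by auto
    then show "v (2*m-1) \<in> ?V" "E (v (2*m-1)) = cscale \<nu> (v (2*m-1))"
      using v[of "2*m-1"] by (simp_all add: \<nu>_def add.commute)
  qed
  \<comment> \<open>v_(2m-1) is a nonzero eigenvector for \<nu>, so \<nu> is an eigenvalue.\<close>
  have det: "det (coord_mat ?n (char_mat (ad_matrix ?n C) \<nu>)) = 0"
  proof -
    have "v (2*m-1) \<noteq> 0" by (rule vnz) (use m in auto)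
    then obtain i where i: "v (2*m-1) i \<noteq> 0" by (auto simp: fun_eq_iff)
    then have "i \<in> {1..?n}" using vl(1) unfolding coord_space_def by blast
    then have "(\<nu> - \<nu>) * adjugate_apply ?n C \<nu> i (v (2*m-1)) =
        det (coord_mat ?n (char_mat (ad_matrix ?n C) \<nu>)) * v (2*m-1) i"
      by (rule adjugate_apply_eigenvector[OF n1]) (use vl(2) in \<open>simp only: E_def br_def\<close>)
    then show ?thesis using i by simp
  qed
  \<comment> \<open>With a vanishing determinant and a nonzero value of
    \<open>adjugate_apply\<close> at z, \<nu> must be the eigenvalue 2 \<mu> + \<alpha> of
    z.\<close>
  have "2*m-1 \<in> {1..?n}" using m by auto
  then have "(\<nu> - (2 * \<mu> + \<alpha>)) * adjugate_apply ?n C \<nu> (2*m-1) z =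
      det (coord_mat ?n (char_mat (ad_matrix ?n C) \<nu>)) * z (2*m-1)"
    by (rule adjugate_apply_eigenvector[OF n1]) (use Ez in \<open>simp only: E_def br_def\<close>)
  then have \<nu>: "\<nu> = 2 * \<mu> + \<alpha>" using nz(4) by (simp add: det)
  \<comment> \<open>Comparing (2m-3) \<alpha> + \<mu> with 2 \<mu> + \<alpha> leaves \<mu> = (2m-4)
    \<alpha>.\<close>
  have "of_nat (2*m-3) = (1 + of_nat (2*m-4) :: complex)"
    using m by (simp flip: of_nat_Suc add: Suc_diff_le)
  then have \<mu>: "\<mu> = of_nat (2*m-4) * \<alpha>"
    using \<nu> by (simp add: \<nu>_def algebra_simps)

  \<comment> \<open>Dividing X_theta by \<alpha> turns the eigenvalues, which are \<alpha> times the
    weights, into the weights themselves.\<close>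
  define u where "u k = (if k = 1 then v1 else if k \<le> 2*m then v k else if k = 2*m+1 then t1
      else if k = 2*m+2 then t2 else cscale (1 / \<alpha>) (basis_vec ?n))" for k
  have idx: "k = 1 \<or> k \<in> {2..2*m} \<or> k = 2*m+1 \<or> k = 2*m+2 \<or> k = ?n" if "k \<in> {1..?n}" for k
    using that by auto
  have u: "u 1 = v1" "k \<in> {2..2*m} \<Longrightarrow> u k = v k" "u (2*m+1) = t1" "u (2*m+2) = t2"
    "u ?n = cscale (1 / \<alpha>) (basis_vec ?n)" for k
    using m by (auto simp: u_def)
  have Et1: "t1 \<in> ?V \<and> E t1 = cscale (of_nat (6*m-11) * \<alpha>) t1"
  proof -
    have "E t1 = cscale (\<mu> + \<nu>) t1" unfolding t1 using prod v2 vl by blast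
    moreover have "of_nat (6*m-11) = (of_nat (2*m-4) + (of_nat (2*m-3) + of_nat (2*m-4)) :: complex)"
      unfolding of_nat_add[symmetric] of_nat_eq_iff using m by simp
    then have "\<mu> + \<nu> = of_nat (6*m-11) * \<alpha>" by (simp add: \<mu> \<nu>_def distrib_right)
    ultimately show ?thesis using cl by (simp add: t1)
  qed
  have Et2: "t2 \<in> ?V \<and> E t2 = cscale (of_nat (6*m-10) * \<alpha>) t2"
  proof -
    have "E t2 = cscale (\<alpha> + of_nat (6*m-11) * \<alpha>) t2" unfolding t2 using prod v1 Et1 by blast
    moreover have "of_nat (6*m-10) = (1 + of_nat (6*m-11) :: complex)"
      unfolding of_nat_Suc[symmetric] of_nat_eq_iff using m by simp
    then have "\<alpha> + of_nat (6*m-11) * \<alpha> = of_nat (6*m-10) * \<alpha>" by (simp add: distrib_right)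
    ultimately show ?thesis using cl by (simp add: t2)
  qed
  have u_eig: "u k \<in> ?V \<and> u k \<noteq> 0 \<and> E (u k) = cscale (of_nat (weight m k) * \<alpha>) (u k)"
    if k: "k \<in> {1..?n}" for k
  proof -
    consider "k = 1" | "k \<in> {2..2*m}" | "k = 2*m+1" | "k = 2*m+2" | "k = ?n" using idx[OF k] by blast
    then show ?thesis
    proof cases
      case 1
      then show ?thesis using v1 v1nz by (simp add: u weight_simps[OF m])
    next
      case 2
      then have "of_nat (2*m+k-6) = (of_nat (2*m-4) + of_nat (k-2) :: complex)"
        unfolding of_nat_add[symmetric] of_nat_eq_iff using m by auto
      then have "\<mu> + of_nat (k-2) * \<alpha> = of_nat (weight m k) * \<alpha>"
        using 2 by (simp add: weight_simps(2)[OF m] \<mu> distrib_right)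
      then show ?thesis using 2 v[of k] vnz[of k] by (simp add: u(2))
    next
      case 3
      show ?thesis unfolding 3 u weight_simps[OF m] using Et1 t1nz by blast
    next
      case 4
      show ?thesis unfolding 4 u weight_simps[OF m] using Et2 nz(3) by blast
    next
      case 5
      have "br (basis_vec ?n) (basis_vec ?n) = 0" using C eV by (simp add: br_def lie_laws_iff)
      then have "E (u ?n) = 0" by (simp only: u E_def lin cscale_simps)
      moreover have "u ?n ?n \<noteq> 0" using nz(1) by (simp add: u cscale_apply basis_vec_def)
      then have "u ?n \<noteq> 0" by (metis zero_fun_apply)
      moreover have "u ?n \<in> ?V" unfolding u by (rule cvec.subspace_scale[OF subspace_coord_space eV])
      ultimately show ?thesis by (simp add: 5 weight_simps[OF m] cscale_simps)
    qed
  qed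
  have u_theta: "br (u ?n) (u k) = cscale (of_nat (weight m k)) (u k)" if "k \<in> {1..?n}" for k
  proof -
    have "br (u ?n) (u k) = cscale (1 / \<alpha>) (E (u k))" by (simp only: u lin E_def)
    also have "\<dots> = cscale (of_nat (weight m k)) (u k)"
      using u_eig[OF that] nz(1) by (simp add: cscale_simps)
    finally show ?thesis .
  qed
  interpret u: weight_basis m C u
    by unfold_locales (use m C u_eig u_theta in \<open>auto simp: br_def\<close>)
  have mem: "2 \<in> {1..?n}" "3 \<in> {1..?n}" "2*m-1 \<in> {1..?n}" "2 \<in> {2..2*m}" "3 \<in> {2..2*m}" "2*m-1 \<in> {2..2*m}"
    using m by auto
  \<comment> \<open>The weights match, so simplicity of the spectrum makes z a multiple of v_(2m-1);
    its factor c is nonzero as z is nonzero.\<close>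
  have "weight m (2*m-1) = weight m 2 + weight m 3"
    unfolding weight_simps(2)[OF m mem(4)] weight_simps(2)[OF m mem(5)] weight_simps(2)[OF m mem(6)]
    using m by simp
  then obtain c where "br (u 2) (u 3) = cscale c (u (2*m-1))"
    unfolding br_def by (rule u.br_multiple[OF mem(1,2,3)])
  then have zc: "z = cscale c (v (2*m-1))" by (simp only: z_def u(2)[OF mem(4)] u(2)[OF mem(5)] u(2)[OF mem(6)])
  have c: "c \<noteq> 0" using znz by (auto simp: zc cscale_simps)

  \<comment> \<open>Scaling by \<open>1 / c\<close> turns \<open>[v\<^sub>2, v\<^sub>3] = c v\<^bsub>2m-1\<^esub>\<close> into \<open>[w\<^sub>2, w\<^sub>3] = w\<^bsub>2m-1\<^esub>\<close>.\<close>
  define a where "a k = (if k = 1 \<or> k = ?n then 1 else if k \<le> 2*m then 1 / c else 1 / (c * c))" for k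
  define w where "w k = cscale (a k) (u k)" for k
  have w: "w 1 = v1" "k \<in> {2..2*m} \<Longrightarrow> w k = cscale (1 / c) (v k)"
    "w (2*m+1) = cscale (1 / (c * c)) t1" "w (2*m+2) = cscale (1 / (c * c)) t2" "w ?n = u ?n" for k
    using m by (auto simp: w_def a_def u cscale_simps)
  interpret w: graded_basis m C w
  proof unfold_locales
    show "w k \<in> ?V" if "k \<in> {1..?n}" for k
      unfolding w_def using u_eig[OF that] by (intro cvec.subspace_scale[OF subspace_coord_space]) blast
    show "w k \<noteq> 0" if "k \<in> {1..?n}" for k
      using u_eig[OF that] c by (simp add: w_def a_def)
    show "bilinear_of ?n C (w ?n) (w k) = cscale (of_nat (weight m k)) (w k)" if "k \<in> {1..?n}" for k
      using u_theta[OF that] unfolding w(5) w_def[of k] br_def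
      by (simp only: bilinear_of_linear cscale_simps mult.commute)
    show "bilinear_of ?n C (w 1) (w j) = w (Suc j)" if "2 \<le> j" "j < 2*m" for j
    proof -
      have "j \<in> {2..2*m}" "Suc j \<in> {2..2*m}" using that by auto
      then show ?thesis using v_Suc[OF that(1)] by (simp add: w(1,2) br_def bilinear_of_linear)
    qed
    show "bilinear_of ?n C (w 1) (w (2*m+1)) = w (2*m+2)"
      unfolding w t2 by (simp add: br_def bilinear_of_linear)
    show "bilinear_of ?n C (w 2) (w 3) = w (2*m-1)"
    proof -
      have "bilinear_of ?n C (w 2) (w 3) = cscale (1 / c) (cscale (1 / c) z)"
        unfolding w(2)[OF mem(4)] w(2)[OF mem(5)] by (simp add: z_def br_def bilinear_of_linear)
      also have "\<dots> = w (2*m-1)" unfolding zc w(2)[OF mem(6)] using c by (simp add: cscale_simps)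
      finally show ?thesis .
    qed
    \<comment> \<open>Both arguments carry a factor 1/c, whence the 1/(c*c) at the two top vectors;
      w_1 is left unscaled to preserve the chain.\<close>
    show "bilinear_of ?n C (w 2) (w (2*m-1)) = w (2*m+1)"
      unfolding w(2)[OF mem(4)] w(2)[OF mem(6)] w(3) t1
      by (simp add: br_def bilinear_of_linear cscale_simps)
  qed (use m C in auto)
  show ?thesis by (rule w.in_orbit)
qed

lemma ad_matrix_r_law:
  assumes m: "m \<ge> 4"
  shows "i \<noteq> j \<Longrightarrow> ad_matrix (2*m+3) (r_law m) i j = 0"
    and "i \<in> {1..2*m+3} \<Longrightarrow> ad_matrix (2*m+3) (r_law m) i i = of_nat (weight m i)"
proof -
  show "ad_matrix (2*m+3) (r_law m) i j = 0" if "i \<noteq> j"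
  proof (cases "j \<in> {1..2*m+3}")
    case True
    show ?thesis using that unfolding ad_matrix_def r_law_theta[OF m True]
      by (simp add: cscale_apply basis_vec_def)
  next
    case False
    then show ?thesis using law_supportD[OF law_support_r_law[OF m]] unfolding ad_matrix_def by blast
  qed
  show "ad_matrix (2*m+3) (r_law m) i i = of_nat (weight m i)" if "i \<in> {1..2*m+3}"
    unfolding ad_matrix_def r_law_theta[OF m that] by (simp add: cscale_apply basis_vec_def)
qed

text \<open>At \<open>r_law m\<close> the matrix of ad X_theta is diagonal with the distinct weights
  as entries, so \<open>adjugate_diagonal\<close> applies.\<close>

lemma adjugate_column_r_law:
  assumes m: "m \<ge> 4" and k: "k \<in> {1..2*m+3}"
  defines "t \<equiv> of_nat (weight m k)"
  shows "ad_eigenvalue (2*m+3) (r_law m) t"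
    and "\<exists>a. a \<noteq> 0 \<and> adjugate_column (2*m+3) (r_law m) t k = cscale a (basis_vec k)"
proof -
  let ?n = "2*m+3" and ?M = "char_mat (ad_matrix (2*m+3) (r_law m)) t"
  have diag: "?M i j = 0" if "i \<noteq> j" for i j
    using that by (simp add: char_mat_def ad_matrix_r_law(1)[OF m])
  have Mii: "?M i i = t - of_nat (weight m i)" if "i \<in> {1..?n}" for i
    using that by (simp add: char_mat_def ad_matrix_r_law(2)[OF m])
  have nz: "?M i i \<noteq> 0" if "i \<in> {1..?n}" "i \<noteq> k" for i
  proof -
    have "weight m i \<noteq> weight m k" using inj_onD[OF inj_weight[OF m] _ that(1) k] that(2) by blast
    then show ?thesis using Mii[OF that(1)] by (simp add: t_def)
  qed
  have "(\<Prod>i = 1..?n. ?M i i) = 0"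
    using k Mii[OF k] by (intro prod_zero) (auto simp: t_def)
  moreover have "det (coord_mat ?n ?M) = (\<Prod>i = 1..?n. ?M i i)"
    by (rule det_coord_mat_diagonal) (rule diag)
  ultimately show "ad_eigenvalue ?n (r_law m) t" by (simp only: ad_eigenvalue_def)
  have "adjugate_column ?n (r_law m) t k = cscale (adjugate ?n ?M k k) (basis_vec k)"
  proof
    fix l
    show "adjugate_column ?n (r_law m) t k l = cscale (adjugate ?n ?M k k) (basis_vec k) l"
      using k adjugate_diagonal(2)[where M = ?M, OF diag k nz, of l]
      by (cases "l = k") (auto simp: adjugate_column_def cscale_apply basis_vec_def)
  qed
  then show "\<exists>a. a \<noteq> 0 \<and> adjugate_column ?n (r_law m) t k = cscale a (basis_vec k)"
    using adjugate_diagonal(1)[where M = ?M, OF diag k nz] by blast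
qed

text \<open>1 and 2m-4 are the weights of X_1 and X_2, so every vector in the construction is a
  nonzero multiple of the corresponding basis vector.\<close>

lemma genericity_r_law:
  assumes m: "m \<ge> 4"
  shows "genericity m (r_law m) 1 (of_nat (2*m-4)) \<noteq> 0"
proof -
  let ?n = "2*m+3" and ?r = "r_law m" and ?v = "chain m (r_law m) 1 (of_nat (2*m-4))"
  let ?br = "bilinear_of (2*m+3) (r_law m)"
  have mem: "1 \<in> {1..?n}" "2 \<in> {1..?n}" "3 \<in> {1..?n}" "2*m-1 \<in> {1..?n}" "2*m+1 \<in> {1..?n}"
    "2 \<in> {2..2*m}" "3 \<in> {2..2*m}" "2*m-1 \<in> {2..2*m}" using m by auto
  have W: "weight m 1 = 1" "weight m 2 = 2*m-4" "weight m (2*m-1) = 4*m-7"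
    unfolding weight_simps(1)[OF m] weight_simps(2)[OF m mem(6)] weight_simps(2)[OF m mem(8)]
    using m by auto
  have tab: "?br (basis_vec i) (basis_vec j) = r_table m basis_vec i j" if "i \<in> {1..?n}" "j \<in> {1..?n}" for i j
    using r_bracket_basis_vec[OF m that] by (simp only: r_bracket_def)
  obtain a where a: "a \<noteq> 0" "adjugate_column ?n ?r 1 1 = cscale a (basis_vec 1)"
    using adjugate_column_r_law(2)[OF m mem(1)] by (auto simp: W(1))
  obtain b where b: "b \<noteq> 0" "adjugate_column ?n ?r (of_nat (2*m-4)) 2 = cscale b (basis_vec 2)"
    using adjugate_column_r_law(2)[OF m mem(2)] unfolding W(2) by blast
  \<comment> \<open>Here a and b are the factors of the two adjugate columns; each further bracket
    with v_1 contributes one a.\<close>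
  have v: "?v k = cscale (a ^ (k - 2) * b) (basis_vec k)" if "2 \<le> k" "k \<le> 2*m" for k
    using that
  proof (induction k rule: dec_induct)
    case base
    then show ?case by (simp add: chain_2 b)
  next
    case (step k)
    have k: "k \<in> {1..2*m+2}" "2 \<le> k \<and> k < 2*m \<or> k = 2*m+1" "k \<in> {1..?n}" using step by auto
    have "?v (Suc k) = cscale (a * (a ^ (k - 2) * b)) (?br (basis_vec 1) (basis_vec k))"
      using step by (simp add: chain_Suc a bilinear_of_linear cscale_simps)
    also have "?br (basis_vec 1) (basis_vec k) = basis_vec (Suc k)"
      unfolding tab[OF mem(1) k(3)] r_table_one_left[OF k(1)] using k(2) by simp
    also have "a * (a ^ (k - 2) * b) = a ^ (Suc k - 2) * b"
      using step.hyps by (simp only: Suc_diff_le power_Suc mult.assoc)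
    finally show ?case .
  qed
  obtain c where c: "c \<noteq> 0" "top1 m ?r 1 (of_nat (2*m-4)) = cscale c (basis_vec (2*m+1))"
  proof -
    have "2 + (2*m-1) = 2*m+1" using m by simp
    then have "?br (basis_vec 2) (basis_vec (2*m-1)) = cscale ((-1)^2) (basis_vec (2*m+1))"
      unfolding tab[OF mem(2,4)] by (rule r_table_low(3)[OF m mem(6,8)])
    then have "?br (basis_vec 2) (basis_vec (2*m-1)) = basis_vec (2*m+1)"
      by (simp add: cscale_simps)
    moreover have "?v 2 = cscale b (basis_vec 2)" using v[of 2] m by simp
    moreover have "?v (2*m-1) = cscale (a ^ (2*m-1-2) * b) (basis_vec (2*m-1))" by (rule v) (use m in auto)
    ultimately have "top1 m ?r 1 (of_nat (2*m-4)) = cscale (b * (a ^ (2*m-1-2) * b)) (basis_vec (2*m+1))"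
      unfolding top1_def by (simp only: bilinear_of_linear cscale_simps)
        (simp only: mult.commute mult.left_commute)
    then show thesis by (rule that[rotated]) (use a b in simp)
  qed
  have t2: "top2 m ?r 1 (of_nat (2*m-4)) = cscale (a * c) (basis_vec (2*m+2))"
  proof -
    have "2*m+1 \<in> {1..2*m+2}" "Suc (2*m+1) = 2*m+2" by auto
    then have "?br (basis_vec 1) (basis_vec (2*m+1)) = basis_vec (2*m+2)"
      unfolding tab[OF mem(1,5)] using r_table_one_left[of "2*m+1" m basis_vec] by (simp only:) simp
    then show ?thesis unfolding top2_def a(2) c(2) by (simp only: bilinear_of_linear cscale_simps mult.commute)
  qed
  let ?z = "?br (?v 2) (?v 3)"
  obtain d where d: "d \<noteq> 0" "?z = cscale d (basis_vec (2*m-1))"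
  proof -
    have "2 + 3 = (5::nat)" by simp
    then have "?br (basis_vec 2) (basis_vec 3) = cscale (5 - 2 * of_nat 2) (basis_vec (2*m-1))"
      unfolding tab[OF mem(2,3)] by (rule r_table_low(1)[OF m mem(6,7)])
    then have "?br (basis_vec 2) (basis_vec 3) = basis_vec (2*m-1)"
      by (simp add: cscale_simps)
    moreover have "?v 2 = cscale b (basis_vec 2)" "?v 3 = cscale (a * b) (basis_vec 3)"
      using v[of 2] v[of 3] m by simp_all
    ultimately have "?z = cscale (a * b * b) (basis_vec (2*m-1))"
      by (simp only: bilinear_of_linear cscale_simps mult.commute)
    then show thesis by (rule that[rotated]) (use a b in simp)
  qed
  \<comment> \<open>The parameter of \<open>adjugate_apply\<close> is here the weight 4m-7 of
    X_(2m-1), an eigenvalue, so the adjugate column is again known.\<close>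
  have \<nu>: "of_nat (2*m-3) * 1 + of_nat (2*m-4) = (of_nat (weight m (2*m-1)) :: complex)"
    unfolding W mult_1_right of_nat_add[symmetric] of_nat_eq_iff using m by simp
  obtain e where e: "e \<noteq> 0"
    "adjugate_column ?n ?r (of_nat (weight m (2*m-1))) (2*m-1) = cscale e (basis_vec (2*m-1))"
    using adjugate_column_r_law(2)[OF m mem(4)] by blast
  have "adjugate_apply ?n ?r (of_nat (weight m (2*m-1))) (2*m-1) ?z =
      (\<Sum>j = 1..?n. if j = 2*m-1 then e * d else 0)"
    unfolding adjugate_apply_def d(2)
  proof (intro sum.cong refl)
    fix j
    show "adjugate_column ?n ?r (of_nat (weight m (2*m-1))) j (2*m-1) * cscale d (basis_vec (2*m-1)) j =
        (if j = 2*m-1 then e * d else 0)"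
      by (cases "j = 2*m-1") (simp_all add: e(2) cscale_apply basis_vec_def)
  qed
  also have "\<dots> = e * d" using mem(4) by (simp only: sum.delta finite_atLeastAtMost if_True)
  finally have "adjugate_apply ?n ?r (of_nat (2*m-3) * 1 + of_nat (2*m-4)) (2*m-1) ?z \<noteq> 0"
    unfolding \<nu> using e(1) d(1) by simp
  moreover have "?v (2*m) (2*m) \<noteq> 0"
    using v[of "2*m"] m a b by (simp add: cscale_apply basis_vec_def)
  moreover have "top2 m ?r 1 (of_nat (2*m-4)) (2*m+2) \<noteq> 0"
    using a c by (simp add: t2 cscale_apply basis_vec_def)
  ultimately show ?thesis unfolding genericity_def by simp
qed

lemma r_law_neighbourhood:
  assumes m: "m \<ge> 4"
  obtains p where "p \<in> polynomial_functions" "p (r_law m) \<noteq> 0"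
    "\<And>C. C \<in> lie_laws (2*m+3) \<Longrightarrow> p C \<noteq> 0 \<Longrightarrow> C \<in> orbit (2*m+3) (r_law m)"
proof -
  let ?n = "2*m+3" and ?G = "coordinate_functions"
  let ?f = "\<lambda>x. genericity m (fst (fst x)) (snd (fst x)) (snd x)"
  have mem: "1 \<in> {1..?n}" "2 \<in> {1..?n}" "2 \<in> {2..2*m}" using m by auto
  have ev: "ad_eigenvalue ?n (r_law m) 1" "ad_eigenvalue ?n (r_law m) (of_nat (2*m-4))"
    using adjugate_column_r_law(1)[OF m mem(1)] adjugate_column_r_law(1)[OF m mem(2)]
      weight_simps(1)[OF m] weight_simps(2)[OF m mem(3)] by simp_all
  have M1: "(\<lambda>x. ad_matrix ?n (fst x) i j) \<in> poly_fun (adjoin_variable ?G)" for i j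
    unfolding ad_matrix_def
    by (rule poly_fun_adjoin_fst[of "\<lambda>C. C ?n j i"]) (rule poly_fun_coordinate)
  have M0: "(\<lambda>C. ad_matrix ?n C i j) \<in> poly_fun ?G" for i j
    unfolding ad_matrix_def by (rule poly_fun_coordinate)
  \<comment> \<open>Eliminates \<mu> over the base of pairs (C, \<alpha>); the resulting
    \<open>q1\<close> still depends on \<alpha>.\<close>
  obtain q1 where q1: "q1 \<in> poly_fun (adjoin_variable ?G)" "q1 (r_law m, 1) \<noteq> 0"
    "\<And>x. q1 x \<noteq> 0 \<Longrightarrow> \<exists>t. det (coord_mat ?n (char_mat (ad_matrix ?n (fst x)) t)) = 0 \<and> ?f (x, t) \<noteq> 0"
    using eliminate_eigenvalue[of "\<lambda>x. ad_matrix ?n (fst x)", OF M1 poly_fun_genericity[of m],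
        of ?n "(r_law m, 1)" "of_nat (2*m-4)"] ev(2) genericity_r_law[OF m]
    by (auto simp: ad_eigenvalue_def)
  \<comment> \<open>Eliminates \<alpha> in the same way, leaving a polynomial in the structure
    constants alone.\<close>
  obtain q0 where q0: "q0 \<in> poly_fun ?G" "q0 (r_law m) \<noteq> 0"
    "\<And>C. q0 C \<noteq> 0 \<Longrightarrow> \<exists>t. det (coord_mat ?n (char_mat (ad_matrix ?n C) t)) = 0 \<and> q1 (C, t) \<noteq> 0"
    using eliminate_eigenvalue[of "ad_matrix ?n", OF M0 q1(1), of ?n "r_law m" 1] ev(1) q1(2)
    by (auto simp: ad_eigenvalue_def)
  show ?thesis
  proof (rule that[of q0])
    show "q0 \<in> polynomial_functions" using q0(1) by (simp only: polynomial_functions_eq)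
    fix C assume C: "C \<in> lie_laws ?n" "q0 C \<noteq> 0"
    obtain s where s: "ad_eigenvalue ?n C s" "q1 (C, s) \<noteq> 0"
      using q0(3)[OF C(2)] unfolding ad_eigenvalue_def by blast
    obtain t where t: "ad_eigenvalue ?n C t" "genericity m C s t \<noteq> 0"
      using q1(3)[OF s(2)] unfolding ad_eigenvalue_def by auto
    show "C \<in> orbit ?n (r_law m)" by (rule genericity_imp_orbit[OF m C(1) s(1) t])
  qed (rule q0(2))
qed

text \<open>Shows that for fixed \<open>h\<close> the new structure constants are linear in the old
  ones, so polynomial functions can be pulled back along the action.\<close>

lemma change_basis_formula:
  assumes C: "law_support n C" and h: "h \<in> GL n"
  shows "change_basis n h C i j l = (if i \<in> {1..n} \<and> j \<in> {1..n} \<and> l \<in> {1..n}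
    then \<Sum>k = 1..n. bilinear_of n C (inv_into (coord_space n) h (basis_vec i))
      (inv_into (coord_space n) h (basis_vec j)) k * h (basis_vec k) l else 0)"
proof -
  interpret h: Vector_Spaces.linear cscale cscale h by (rule GL_linear[OF h])
  have "h x l = (\<Sum>k = 1..n. x k * h (basis_vec k) l)" if "x \<in> coord_space n" for x
  proof -
    have "h x = (\<Sum>k = 1..n. cscale (x k) (h (basis_vec k)))"
      by (subst coord_space_expansion[OF that, symmetric]) (simp only: h.sum h.scale)
    then show ?thesis by (simp only: sum_fun_apply cscale_apply)
  qed
  then show ?thesis
    using bilinear_of_closed[OF C] unfolding change_basis_def Let_def by simp
qed

text \<open>One principal open set around \<open>C0\<close> inside the orbit is enough: the group
  acts transitively on the orbit by polynomial maps preserving the variety of laws, so every point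
  of the orbit has a translate of it as neighbourhood.\<close>

lemma rigidI:
  assumes C0: "C0 \<in> lie_laws n"
    and p: "p \<in> polynomial_functions" "p C0 \<noteq> 0"
    and nbhd: "\<And>C. C \<in> lie_laws n \<Longrightarrow> p C \<noteq> 0 \<Longrightarrow> C \<in> orbit n C0"
  shows "rigid n C0"
proof -
  let ?V = "lie_laws n" and ?O = "orbit n C0"
  have supp: "law_support n C" if "C \<in> ?V" for C using that by (simp add: lie_laws_iff)
  note orbit = orbit_iff[OF supp[OF C0]]
  have sub: "?O \<subseteq> ?V"
  proof
    fix C assume "C \<in> ?O"
    then obtain g where "law_support n C" "g \<in> GL n" "intertwines n g C0 C" unfolding orbit by blast
    then show "C \<in> ?V" by (rule lie_laws_intertwines[OF C0])
  qed
  \<comment> \<open>All polynomials vanishing on the complement of the orbit. What needs proof is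
    that they have no common zero in the orbit.\<close>
  define S where "S = {q \<in> polynomial_functions. \<forall>C\<in>?V - ?O. q C = 0}"
  have outside: "C \<notin> ?O" if C: "C \<in> ?V" "\<forall>q\<in>S. q C = 0" for C
  proof
    assume "C \<in> ?O"
    then obtain g where g: "g \<in> GL n" "intertwines n g C0 C" unfolding orbit by blast
    obtain h where h: "h \<in> GL n" "\<And>x. x \<in> coord_space n \<Longrightarrow> h (g x) = x"
      "\<And>x. x \<in> coord_space n \<Longrightarrow> g (h x) = x" using GL_inverse[OF g(1)] by metis
    \<comment> \<open>The right side of \<open>change_basis_formula\<close> is taken as definition
      because it is polynomial on all arguments, while it agrees with
      \<open>change_basis n h\<close> only where the support condition is known.\<close>
    define T where "T C i j l = (if i \<in> {1..n} \<and> j \<in> {1..n} \<and> l \<in> {1..n}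
      then \<Sum>k = 1..n. bilinear_of n C (inv_into (coord_space n) h (basis_vec i))
        (inv_into (coord_space n) h (basis_vec j)) k * h (basis_vec k) l else 0)" for C i j l
    have T: "T C' = change_basis n h C'" if "C' \<in> ?V" for C'
      by (intro ext) (simp only: T_def change_basis_formula[OF supp[OF that] h(1)])
    have Th: "intertwines n h C' (T C')" "law_support n (T C')" if "C' \<in> ?V" for C'
      using intertwines_change_basis[OF h(1) supp[OF that]] law_support_change_basis
      by (simp_all only: T[OF that])
    have "(\<lambda>C. T C i j l) \<in> poly_fun coordinate_functions" for i j l
    proof (cases "i \<in> {1..n} \<and> j \<in> {1..n} \<and> l \<in> {1..n}")
      case True
      show ?thesis unfolding T_def if_P[OF True]
        by (intro poly_fun_sum poly_fun.mult poly_fun.const poly_fun_bilinear_of poly_fun_coordinate)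
    next
      case False
      show ?thesis unfolding T_def if_not_P[OF False] by (rule poly_fun.const)
    qed
    then have "(\<lambda>C. p (T C)) \<in> polynomial_functions"
      unfolding polynomial_functions_eq by (rule polynomial_functions_compose[OF p(1)])
    \<comment> \<open>Otherwise \<open>T C'\<close> would lie in the orbit, and moving it back by g
      would place \<open>C'\<close> there as well.\<close>
    moreover have "p (T C') = 0" if C': "C' \<in> ?V - ?O" for C'
    proof (rule ccontr)
      assume nz: "p (T C') \<noteq> 0"
      have V: "C' \<in> ?V" using C' by blast
      have "T C' \<in> ?V" by (rule lie_laws_intertwines[OF V Th(2)[OF V] h(1) Th(1)[OF V]])
      then have "T C' \<in> ?O" using nz by (rule nbhd)
      then obtain g2 where g2: "g2 \<in> GL n" "intertwines n g2 C0 (T C')" unfolding orbit by blast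
      have "intertwines n g (T C') C'"
        by (rule intertwines_inverse[OF Th(1)[OF V] g(1) supp[OF V] h(3,2)])
      then have "intertwines n (g \<circ> g2) C0 C'" by (rule intertwines_comp[OF g2])
      then have "C' \<in> ?O" unfolding orbit using supp[OF V] GL_comp[OF g2(1) g(1)] by blast
      then show False using C' by blast
    qed
    ultimately have "(\<lambda>C. p (T C)) \<in> S" unfolding S_def by (intro CollectI conjI ballI)
    then have "p (T C) = 0" by (rule bspec[OF C(2)])
    \<comment> \<open>As h inverts g on \<open>coord_space n\<close>, the pulled-back polynomial
      takes the nonzero value \<open>p C0\<close> at C, contradicting that C is a common zero of
      \<open>S\<close>.\<close>
    moreover have "T C = C0"
      by (rule intertwines_unique[OF h(1) Th(1)[OF C(1)]
            intertwines_inverse[OF g(2) h(1) supp[OF C0] h(2,3)] Th(2)[OF C(1)] supp[OF C0]])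
    ultimately show False using p(2) by simp
  qed
  have "?V - ?O = {C \<in> ?V. \<forall>q\<in>S. q C = 0}"
  proof
    show "?V - ?O \<subseteq> {C \<in> ?V. \<forall>q\<in>S. q C = 0}" unfolding S_def by fast
    show "{C \<in> ?V. \<forall>q\<in>S. q C = 0} \<subseteq> ?V - ?O" using outside by fast
  qed
  moreover have "S \<subseteq> polynomial_functions" unfolding S_def by fast
  ultimately have "zariski_closed_in ?V (?V - ?O)" unfolding zariski_closed_in_def by (intro exI[of _ S] conjI)
  then have "zariski_open_in ?V ?O" unfolding zariski_open_in_def using sub by (intro conjI)
  then show ?thesis unfolding rigid_def using C0 by (intro conjI)
qed

theorem mainTheorem5:
  fixes m :: nat
  assumes "m \<ge> 4"
  shows "r_law m \<in> lie_laws (2*m + 3)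
    \<and> solvable (coord_space (2*m + 3)) (r_bracket m)
    \<and> decomposable (coord_space (2*m + 3)) (r_bracket m)
    \<and> rigid (2*m + 3) (r_law m)
    \<and> lie_isomorphic
        (nilradical (coord_space (2*m + 3)) (r_bracket m)) (r_bracket m)
        (coord_space (2*m + 2)) (g_psi_bracket m)"
proof -
  obtain p where "p \<in> polynomial_functions" "p (r_law m) \<noteq> 0"
    "\<And>C. C \<in> lie_laws (2*m+3) \<Longrightarrow> p C \<noteq> 0 \<Longrightarrow> C \<in> orbit (2*m+3) (r_law m)"
    using r_law_neighbourhood[OF assms] by metis
  then have "rigid (2*m+3) (r_law m)" by (rule rigidI[OF r_law_lie_law[OF assms]])
  then show ?thesis
    using r_law_lie_law[OF assms] r_solvable[OF assms] r_decomposable[OF assms]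
      r_nilradical_isomorphic[OF assms] by blast
qed

end
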